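(* For every finite set $I$ and every decomposition $I=S\sqcup T$, the following identity of maps $\mathrm{SM}[I]\to\mathrm{SM}[I]\otimes\mathrm{MOD}[S]\otimes\mathrm{MOD}[T]$ holds: $$(\mathrm{id}\otimes\Delta_{S,T})\circ\delta_{\mathrm{SM}}=(\mu\otimes\mathrm{id}\otimes\mathrm{id})\circ(\mathrm{id}\otimes\tau_{2,3}\otimes\mathrm{id})\circ(\delta_{\mathrm{SM}}\otimes\delta_{\mathrm{SM}})\circ\Delta_{S,T},$$ where $\tau_{2,3}$ exchanges the second and third factors of $\mathrm{SM}[S]\otimes\mathrm{MOD}[S]\otimes\mathrm{SM}[T]\otimes\mathrm{MOD}[T]$. Restricting to $\mathrm{MOD}\subseteq\mathrm{SM}$, this makes $\mathrm{MOD}$ a comodule species over itself (via $\delta_{\mathrm{MOD}}$, the map $\Delta$ being compatible with the coaction in the sense that $(\mathrm{id}\otimes\Delta_{S,T})\circ\delta_{\mathrm{MOD}}=(\mu\otimes\mathrm{id}\otimes\mathrm{id})\circ(\mathrm{id}\otimes\tau_{2,3}\otimes\mathrm{id})\circ(\delta_{\mathrm{MOD}}\otimes\delta_{\mathrm{MOD}})\circ\Delta_{S,T}$ as maps $\mathrm{MOD}[I]\to\mathrm{MOD}[I]\otimes\mathrm{MOD}[S]\otimes\mathrm{MOD}[T]$). Hence $(\mathrm{MOD},\mu,\Delta,\delta_{\mathrm{MOD}})$ is a double twisted bialgebra.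
   Context: $\hat{\mathbb R}=\mathbb R\cup\{\infty\}$. A function $z:\mathcal P(I)\to\hat{\mathbb R}$ ($I$ finite) with $z(\emptyset)=0$, $z(I)<\infty$ is submodular if $z(A\cup B)+z(A\cap B)\le z(A)+z(B)$ for all $A,B$, and modular if equality always holds. If $z(S)<\infty$: $z|_S$ is the restriction to $\mathcal P(S)$ and $z_{/S}(U)=z(S\cup U)-z(S)$, $U\subseteq I\setminus S$; for $A\subseteq B$ with finite values $z_{B/A}=(z|_B)_{/A}$. Product of $u$ on $S$ and $v$ on $T$: $(u\cdot v)(E)=u(E\cap S)+v(E\cap T)$ for $E\subseteq S\sqcup T$. $z'$ on $C$ decomposes along $C=C_1\sqcup C_2$ if $z'(E)=z'(E\cap C_1)+z'(E\cap C_2)$ for all $E\subseteq C$. A preorder is a reflexive transitive relation; bubbles are the classes of $x\le y\le x$; down-sets contain everything below their elements; convex subsets are $C=B\setminus A$ with $A\subseteq B$ down-sets; $C=C_1\sqcup C_2$ is a disconnected union if no element of $C_1$ is comparable to one of $C_2$; a totally disconnected preorder is an equivalence relation. $P$ is compatible with $z$ if $z(A)<\infty$ for all down-sets $A$, and for down-sets $A\subseteq B$ with $B\setminus A=C_1\sqcup C_2$ a disconnected union, $z_{B/A}$ decomposes along $C_1\sqcup C_2$; then $z_{B/A}$ depends only on $C=B\setminus A$ and is written $z_C$. $P$ conforms to $z$ if moreover, for convex $C$, a decomposition of $z_C$ along $C=C_1\sqcup C_2$ implies that $C=C_1\sqcup C_2$ is a disconnected union in $P$. $\mathrm{Pre}(z)$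 is the set of preorders conforming to $z$. For $P$ compatible with $z$: $z_P=\prod_{C\text{ bubble of }P}z_C$; $z^P(A)=z(A)$ if $A$ is a down-set of $P$ and $\infty$ otherwise ($z^P$ is modular; if $z$ is modular so is $z_P$). $\mathrm{pre}(z)$ is the preorder whose down-sets are the $A$ with $z(A)<\infty$. A (vector) species is a functor from finite sets with bijections to real vector spaces. $\mathrm{SM}[I]$ (resp. $\mathrm{MOD}[I]$) is the real vector space with basis the submodular (resp. modular) functions on $I$. The species $U$ has $U[\emptyset]=\mathbb R$, $U[I]=0$ for $I\neq\emptyset$. Structure maps on $\mathrm{SM}$ (restricting to $\mathrm{MOD}$): $\mu_{S,T}(u\otimes v)=u\cdot v$; $\Delta_{S,T}(z)=z|_S\otimes z_{/S}$ if $z(S)<\infty$, and $0$ otherwise; unit $\eta:U\to\mathrm{SM}$ sending $1$ to the unique function on $\mathcal P(\emptyset)$; counit $\epsilon_\Delta:\mathrm{SM}\to U$, $\epsilon_\Delta(z)=1$ if $I=\emptyset$, $0$ if $I\ne\emptyset$. Further $\delta_{\mathrm{SM}}:\mathrm{SM}[I]\to\mathrm{SM}[I]\otimes\mathrm{MOD}[I]$, $\delta_{\mathrm{SM}}(z)=\sum_{Q\in\mathrm{Pre}(z)}z_Q\otimes z^Q$, with restriction $\delta_{\mathrm{MOD}}:\mathrm{MOD}[I]\to\mathrm{MOD}[I]\otimes\mathrm{MOD}[I]$, and $\varepsilon_{\mathrm{MOD}}:\mathrm{MOD}[I]\to\mathbb R$ with $\varepsilon_{\mathrm{MOD}}(z)=1$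 if $\mathrm{pre}(z)$ is totally disconnected and $0$ otherwise. A double twisted bialgebra $(M,\mu,\Delta,\delta)$ is a species $M$ such that: (i) $(M,\mu,\Delta)$, with unit $\eta$ and counit $\epsilon_\Delta$, is a bimonoid in species for the Cauchy product; (ii) the natural maps $\delta:M[I]\to M[I]\otimes M[I]$ are coassociative with a counit $\varepsilon:M[I]\to\mathbb R$, and $\delta,\varepsilon$ are multiplicative for $\mu$ and preserve the unit, i.e. $\delta(\mu(u\otimes v))=(\mu\otimes\mu)\circ\tau_{2,3}(\delta(u)\otimes\delta(v))$ and $\varepsilon(\mu(u\otimes v))=\varepsilon(u)\varepsilon(v)$; (iii) $(\mathrm{id}\otimes\Delta_{S,T})\circ\delta=(\mu\otimes\mathrm{id}\otimes\mathrm{id})\circ\tau_{2,3}\circ(\delta\otimes\delta)\circ\Delta_{S,T}$ and $(\mathrm{id}\otimes\epsilon_\Delta)\circ\delta=\eta\circ\epsilon_\Delta$.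
   Formalization: Modular is taken to mean that equality holds whenever z(A) and z(B) are finite; if equality were required also at infinite values, z^P would not be modular (e.g. an indiscrete preorder on two points) and δ_SM would not map into SM⊗MOD. *)

theory Defs
  imports "HOL-Analysis.Analysis" "HOL-Analysis.Finite_Function_Topology"
begin

section \<open>Free vector spaces and tensor products of real vector spaces\<close>

text \<open>
  The real vector space with basis \<open>X\<close> is the subspace \<open>free_space X\<close> of the finitely supported
  functions \<open>'x \<Rightarrow>\<^sub>0 real\<close>; the basis vector of \<open>x\<close> is \<open>basis x\<close>.
\<close>

definition basis :: "'x \<Rightarrow> ('x \<Rightarrow>\<^sub>0 real)" where
  "basis x = Poly_Mapping.single x 1"

definition free_space :: "'x set \<Rightarrow> ('x \<Rightarrow>\<^sub>0 real) set" where
  "free_space X = {p. Poly_Mapping.keys p \<subseteq> X}"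

definition lin_ext :: "('x \<Rightarrow> 'v::real_vector) \<Rightarrow> ('x \<Rightarrow>\<^sub>0 real) \<Rightarrow> 'v" where
  "lin_ext f p = (\<Sum>x\<in>Poly_Mapping.keys p. Poly_Mapping.lookup p x *\<^sub>R f x)"

lemma lookup_scaleR_poly_mapping [simp]:
  fixes p :: "'x \<Rightarrow>\<^sub>0 'v::real_vector"
  shows "Poly_Mapping.lookup (c *\<^sub>R p) x = c *\<^sub>R Poly_Mapping.lookup p x"
proof -
  have "finite {i. c *\<^sub>R Poly_Mapping.lookup p i \<noteq> 0}"
    by (rule finite_subset[of _ "Poly_Mapping.keys p"]) (auto simp: in_keys_iff)
  then show ?thesis
    by (simp add: scaleR_poly_mapping_def Abs_poly_mapping_inverse)
qed

lemma lin_ext_superset: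
  assumes "finite A" "Poly_Mapping.keys p \<subseteq> A"
  shows "lin_ext f p = (\<Sum>x\<in>A. Poly_Mapping.lookup p x *\<^sub>R f x)"
  unfolding lin_ext_def using assms
  by (intro sum.mono_neutral_left) (auto simp: in_keys_iff)

lemma linear_lin_ext: "linear (lin_ext f)"
proof (rule linearI)
  fix p q :: "'a \<Rightarrow>\<^sub>0 real"
  let ?A = "Poly_Mapping.keys p \<union> Poly_Mapping.keys q"
  have "lin_ext f (p + q) = (\<Sum>x\<in>?A. Poly_Mapping.lookup (p + q) x *\<^sub>R f x)"
    using Poly_Mapping.keys_add[of p q] by (intro lin_ext_superset) auto
  also have "\<dots> = lin_ext f p + lin_ext f q"
    by (simp add: lin_ext_superset[of ?A] lookup_add scaleR_add_left sum.distrib)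
  finally show "lin_ext f (p + q) = lin_ext f p + lin_ext f q" .
next
  fix c :: real and p :: "'a \<Rightarrow>\<^sub>0 real"
  have "Poly_Mapping.keys (c *\<^sub>R p) \<subseteq> Poly_Mapping.keys p"
    by (auto simp: in_keys_iff)
  then show "lin_ext f (c *\<^sub>R p) = c *\<^sub>R lin_ext f p"
    by (simp add: lin_ext_superset[of "Poly_Mapping.keys p"] scaleR_sum_right)
qed

lemma lin_ext_basis [simp]: "lin_ext f (basis x) = f x"
  by (simp add: lin_ext_def basis_def)

lemma linear_eq_lin_ext:
  assumes "linear f"
  shows "f p = lin_ext (\<lambda>x. f (basis x)) p"
proof -
  have "p = (\<Sum>x\<in>Poly_Mapping.keys p. Poly_Mapping.lookup p x *\<^sub>R basis x)"
    by (rule poly_mapping_eqI)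
      (auto simp: lookup_sum basis_def lookup_single when_def in_keys_iff sum.delta' if_distrib cong: if_cong)
  then have "f p = f (\<Sum>x\<in>Poly_Mapping.keys p. Poly_Mapping.lookup p x *\<^sub>R basis x)"
    by simp
  then show ?thesis
    by (simp add: lin_ext_def linear_sum[OF assms] linear_cmul[OF assms])
qed

definition tensor_relations :: "('a::real_vector \<times> 'b::real_vector \<Rightarrow>\<^sub>0 real) set" where
  "tensor_relations = span (
     {basis (a + a', b) - (basis (a, b) + basis (a', b)) | a a' b. True} \<union>
     {basis (a, b + b') - (basis (a, b) + basis (a, b')) | a b b'. True} \<union>
     {basis (c *\<^sub>R a, b) - c *\<^sub>R basis (a, b) | c a b. True} \<union>
     {basis (a, c *\<^sub>R b) - c *\<^sub>R basis (a, b) | c a b. True})"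

lemma subspace_tensor_relations: "subspace tensor_relations"
  by (simp add: tensor_relations_def)

quotient_type (overloaded) ('a, 'b) tensor =
  "'a::real_vector \<times> 'b::real_vector \<Rightarrow>\<^sub>0 real" / "\<lambda>p q. p - q \<in> tensor_relations"
proof (rule equivpI)
  show "reflp (\<lambda>p q. p - q \<in> (tensor_relations :: ('a \<times> 'b \<Rightarrow>\<^sub>0 real) set))"
    by (auto intro: reflpI simp: subspace_0[OF subspace_tensor_relations])
  show "symp (\<lambda>p q. p - q \<in> (tensor_relations :: ('a \<times> 'b \<Rightarrow>\<^sub>0 real) set))"
    by (rule sympI) (drule subspace_neg[OF subspace_tensor_relations], simp)
  show "transp (\<lambda>p q. p - q \<in> (tensor_relations :: ('a \<times> 'b \<Rightarrow>\<^sub>0 real) set))"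
    by (rule transpI) (drule (1) subspace_add[OF subspace_tensor_relations], simp)
qed

instantiation tensor :: (real_vector, real_vector) real_vector
begin

lift_definition zero_tensor :: "('a, 'b) tensor" is 0 .

lift_definition plus_tensor :: "('a, 'b) tensor \<Rightarrow> ('a, 'b) tensor \<Rightarrow> ('a, 'b) tensor" is "(+)"
  by (simp only: add_diff_add subspace_add[OF subspace_tensor_relations])

lift_definition uminus_tensor :: "('a, 'b) tensor \<Rightarrow> ('a, 'b) tensor" is uminus
  by (simp only: minus_diff_minus subspace_neg[OF subspace_tensor_relations])

lift_definition minus_tensor :: "('a, 'b) tensor \<Rightarrow> ('a, 'b) tensor \<Rightarrow> ('a, 'b) tensor" is "(-)"
proof -
  fix p p' q q' :: "'a \<times> 'b \<Rightarrow>\<^sub>0 real"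
  assume "p - p' \<in> tensor_relations" "q - q' \<in> tensor_relations"
  then have "(p - p') - (q - q') \<in> tensor_relations"
    by (rule subspace_diff[OF subspace_tensor_relations])
  also have "(p - p') - (q - q') = p - q - (p' - q')"
    by (simp add: algebra_simps)
  finally show "p - q - (p' - q') \<in> tensor_relations" .
qed

lift_definition scaleR_tensor :: "real \<Rightarrow> ('a, 'b) tensor \<Rightarrow> ('a, 'b) tensor" is "scaleR"
  by (simp only: scaleR_diff_right[symmetric] subspace_scale[OF subspace_tensor_relations])

instance
proof
  fix x y z :: "('a, 'b) tensor" and c d :: real
  note [simp] = subspace_0[OF subspace_tensor_relations]
  show "x + y + z = x + (y + z)" by transfer (simp add: add.assoc)
  show "x + y = y + x" by transfer (simp add: add.commute)
  show "0 + x = x" by transfer simp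
  show "- x + x = 0" by transfer simp
  show "x - y = x + - y" by transfer simp
  show "c *\<^sub>R (x + y) = c *\<^sub>R x + c *\<^sub>R y" by transfer (simp add: scaleR_add_right)
  show "(c + d) *\<^sub>R x = c *\<^sub>R x + d *\<^sub>R x" by transfer (simp add: scaleR_add_left)
  show "c *\<^sub>R d *\<^sub>R x = (c * d) *\<^sub>R x" by transfer simp
  show "1 *\<^sub>R x = x" by transfer simp
qed

end

lift_definition pure_tensor :: "'a::real_vector \<Rightarrow> 'b::real_vector \<Rightarrow> ('a, 'b) tensor"
    (infixr \<open>\<otimes>\<close> 75)
  is "\<lambda>a b. basis (a, b)" .

lemma tensor_relations_intros:
  "basis (a + a', b) - (basis (a, b) + basis (a', b)) \<in> tensor_relations"
  "basis (a, b + b') - (basis (a, b) + basis (a, b')) \<in> tensor_relations"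
  "basis (c *\<^sub>R a, b) - c *\<^sub>R basis (a, b) \<in> tensor_relations"
  "basis (a, c *\<^sub>R b) - c *\<^sub>R basis (a, b) \<in> tensor_relations"
  unfolding tensor_relations_def by (rule span_base, blast)+

lemma bilinear_pure_tensor: "bilinear (\<otimes>)"
  unfolding bilinear_def
  by (auto intro!: linearI; transfer; rule tensor_relations_intros)

definition tensor_lift ::
    "('a::real_vector \<Rightarrow> 'b::real_vector \<Rightarrow> 'c::real_vector) \<Rightarrow> ('a, 'b) tensor \<Rightarrow> 'c" where
  "tensor_lift f t = lin_ext (\<lambda>(a, b). f a b) (rep_tensor t)"

lemma lin_ext_tensor_relations:
  assumes "bilinear f" "p \<in> tensor_relations"
  shows "lin_ext (\<lambda>(a, b). f a b) p = 0"
  using assms(2) unfolding tensor_relations_def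
proof (induction rule: span_induct)
  case base
  have "lin_ext (\<lambda>(a, b). f a b) 0 = 0" by (simp add: lin_ext_def)
  then show ?case
    by (auto simp: subspace_def linear_add[OF linear_lin_ext] linear_cmul[OF linear_lin_ext])
next
  case (step p)
  then show ?case
    by (auto simp: linear_add[OF linear_lin_ext] linear_cmul[OF linear_lin_ext]
        linear_diff[OF linear_lin_ext] bilinear_ladd[OF assms(1)] bilinear_radd[OF assms(1)]
        bilinear_lmul[OF assms(1)] bilinear_rmul[OF assms(1)])
qed

lemma tensor_lift_abs:
  assumes "bilinear f"
  shows "tensor_lift f (abs_tensor p) = lin_ext (\<lambda>(a, b). f a b) p"
proof -
  have "rep_tensor (abs_tensor p) - p \<in> tensor_relations"
    using Quotient3_rep_abs[OF Quotient3_tensor] subspace_0[OF subspace_tensor_relations]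
    by (metis (mono_tags, lifting) diff_self)
  from lin_ext_tensor_relations[OF assms this] show ?thesis
    by (simp add: tensor_lift_def linear_diff[OF linear_lin_ext])
qed

lemma tensor_lift_pure [simp]:
  assumes "bilinear f"
  shows "tensor_lift f (a \<otimes> b) = f a b"
  by (simp add: pure_tensor.abs_eq tensor_lift_abs[OF assms])

lemma linear_tensor_lift:
  assumes "bilinear f"
  shows "linear (tensor_lift f)"
proof (rule linearI)
  fix s t :: "('a, 'b) tensor" and c :: real
  obtain p q where "s = abs_tensor p" "t = abs_tensor q"
    by (metis Quotient3_abs_rep[OF Quotient3_tensor])
  then show "tensor_lift f (s + t) = tensor_lift f s + tensor_lift f t"
    and "tensor_lift f (c *\<^sub>R s) = c *\<^sub>R tensor_lift f s"
    by (simp_all add: plus_tensor.abs_eq scaleR_tensor.abs_eq tensor_lift_abs[OF assms]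
        linear_add[OF linear_lin_ext] linear_cmul[OF linear_lin_ext])
qed

definition tensor_map :: "('a::real_vector \<Rightarrow> 'c::real_vector) \<Rightarrow> ('b::real_vector \<Rightarrow> 'd::real_vector)
    \<Rightarrow> ('a, 'b) tensor \<Rightarrow> ('c, 'd) tensor"  (infixr \<open>\<otimes>\<^sub>m\<close> 75) where
  "f \<otimes>\<^sub>m g = tensor_lift (\<lambda>a b. f a \<otimes> g b)"

definition tensor_assoc ::
    "(('a::real_vector, 'b::real_vector) tensor, 'c::real_vector) tensor \<Rightarrow> ('a, ('b, 'c) tensor) tensor" where
  "tensor_assoc = tensor_lift (\<lambda>x c. tensor_lift (\<lambda>a b. a \<otimes> b \<otimes> c) x)"

text \<open>The map \<open>id \<otimes> \<tau>\<^sub>2\<^sub>,\<^sub>3 \<otimes> id\<close> on four factors.\<close>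

definition swap23 ::
    "(('a::real_vector, 'b::real_vector) tensor, ('c::real_vector, 'd::real_vector) tensor) tensor
      \<Rightarrow> (('a, 'c) tensor, ('b, 'd) tensor) tensor" where
  "swap23 = tensor_lift (\<lambda>x y.
     tensor_lift (\<lambda>a b. tensor_lift (\<lambda>c d. (a \<otimes> c) \<otimes> (b \<otimes> d)) y) x)"

definition tensor_lunit :: "(real, 'a::real_vector) tensor \<Rightarrow> 'a" where
  "tensor_lunit = tensor_lift (\<lambda>r a. r *\<^sub>R a)"

definition tensor_runit :: "('a::real_vector, real) tensor \<Rightarrow> 'a" where
  "tensor_runit = tensor_lift (\<lambda>a r. r *\<^sub>R a)"

lemma tensor_ext:
  assumes "linear f" "linear g" "\<And>a b. f (a \<otimes> b) = g (a \<otimes> b)"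
  shows "f t = g t"
proof -
  obtain p where t: "t = abs_tensor p"
    by (metis Quotient3_abs_rep[OF Quotient3_tensor])
  have lin: "linear (\<lambda>p. h (abs_tensor p))" if "linear h" for h :: "('a, 'b) tensor \<Rightarrow> 'c"
    using that
    by (auto intro!: linearI simp: plus_tensor.abs_eq[symmetric] scaleR_tensor.abs_eq[symmetric]
        linear_add linear_cmul)
  have "f (abs_tensor (basis x)) = g (abs_tensor (basis x))" for x
    using assms(3)[of "fst x" "snd x"] by (simp add: pure_tensor.abs_eq)
  then show ?thesis
    using linear_eq_lin_ext[OF lin[OF assms(1)], of p] linear_eq_lin_ext[OF lin[OF assms(2)], of p]
    by (simp add: t)
qed

lemma bilinear_tensorI:
  assumes "\<And>a. linear (f a)" "\<And>b. linear (\<lambda>a. f a b)"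
  shows "bilinear f"
  using assms by (simp add: bilinear_def)

lemma tensor_add_left: "(a + a') \<otimes> b = a \<otimes> b + a' \<otimes> b"
  and tensor_add_right: "a \<otimes> (b + b') = a \<otimes> b + a \<otimes> b'"
  and tensor_scaleR_left: "(c *\<^sub>R a) \<otimes> b = c *\<^sub>R (a \<otimes> b)"
  and tensor_scaleR_right: "a \<otimes> (c *\<^sub>R b) = c *\<^sub>R (a \<otimes> b)"
  by (simp_all add: bilinear_ladd bilinear_radd bilinear_lmul bilinear_rmul bilinear_pure_tensor)

lemmas tensor_bilin = tensor_add_left tensor_add_right tensor_scaleR_left tensor_scaleR_right

lemma bilinear_tensor_map:
  assumes "linear f" "linear g"
  shows "bilinear (\<lambda>a b. f a \<otimes> g b)"
  using assms by (auto intro!: bilinear_tensorI linearI simp: linear_add linear_cmul tensor_bilin)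

lemma linear_tensor_map: "linear f \<Longrightarrow> linear g \<Longrightarrow> linear (f \<otimes>\<^sub>m g)"
  by (simp add: tensor_map_def linear_tensor_lift bilinear_tensor_map)

lemma tensor_map_pure: "linear f \<Longrightarrow> linear g \<Longrightarrow> (f \<otimes>\<^sub>m g) (a \<otimes> b) = f a \<otimes> g b"
  by (simp add: tensor_map_def bilinear_tensor_map)

lemma tensor_lift_combine:
  assumes "\<And>z. bilinear (F z)" "\<And>a b. linear (\<lambda>z. F z a b)"
  shows "linear (\<lambda>z. tensor_lift (F z) t)"
proof (rule linearI)
  fix y z :: 'a and c :: real
  note lin = linear_tensor_lift[OF assms(1)] and pure = tensor_lift_pure[OF assms(1)]
  show "tensor_lift (F (y + z)) t = tensor_lift (F y) t + tensor_lift (F z) t"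
    by (rule tensor_ext[OF lin linear_compose_add[OF lin lin]])
      (simp only: pure linear_add[OF assms(2)])
  show "tensor_lift (F (c *\<^sub>R y)) t = c *\<^sub>R tensor_lift (F y) t"
    by (rule tensor_ext[OF lin linear_compose_scale_right[OF lin]])
      (simp only: pure linear_cmul[OF assms(2)])
qed

lemma bilinear_tensor_assoc:
  fixes c :: "'c::real_vector"
  shows "bilinear (\<lambda>(x :: ('a::real_vector, 'b::real_vector) tensor) (c::'c).
           tensor_lift (\<lambda>a b. a \<otimes> b \<otimes> c) x)"
    and "bilinear (\<lambda>(a::'a) (b::'b). a \<otimes> b \<otimes> c)"
proof -
  show *: "bilinear (\<lambda>(a::'a) (b::'b). a \<otimes> b \<otimes> c)" for c :: 'c
    by (intro bilinear_tensorI linearI) (simp_all add: tensor_bilin)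
  show "bilinear (\<lambda>(x :: ('a, 'b) tensor) (c::'c). tensor_lift (\<lambda>a b. a \<otimes> b \<otimes> c) x)"
    by (intro bilinear_tensorI linear_tensor_lift tensor_lift_combine * linearI)
      (simp_all add: tensor_bilin)
qed

lemma linear_tensor_assoc: "linear tensor_assoc"
  unfolding tensor_assoc_def by (rule linear_tensor_lift) (rule bilinear_tensor_assoc)

lemma tensor_assoc_pure: "tensor_assoc ((a \<otimes> b) \<otimes> c) = a \<otimes> b \<otimes> c"
  by (simp add: tensor_assoc_def bilinear_tensor_assoc)

lemma bilinear_swap23:
  fixes y :: "('c::real_vector, 'd::real_vector) tensor"
    and a :: "'a::real_vector" and b :: "'b::real_vector"
  shows "bilinear (\<lambda>(x :: ('a, 'b) tensor) (y :: ('c, 'd) tensor). tensor_lift (\<lambda>a b. tensor_lift (\<lambda>c d. (a \<otimes> c) \<otimes> (b \<otimes> d)) y) x)"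
    and "bilinear (\<lambda>(a::'a) (b::'b). tensor_lift (\<lambda>c d. (a \<otimes> c) \<otimes> (b \<otimes> d)) y)"
    and "bilinear (\<lambda>(c::'c) (d::'d). (a \<otimes> c) \<otimes> (b \<otimes> d))"
proof -
  show 1: "bilinear (\<lambda>(c::'c) (d::'d). (a \<otimes> c) \<otimes> (b \<otimes> d))" for a :: 'a and b :: 'b
    by (intro bilinear_tensorI linearI) (simp_all add: tensor_bilin)
  show 2: "bilinear (\<lambda>(a::'a) (b::'b). tensor_lift (\<lambda>c d. (a \<otimes> c) \<otimes> (b \<otimes> d)) y)" for y :: "('c, 'd) tensor"
    by (intro bilinear_tensorI tensor_lift_combine 1 linearI) (simp_all add: tensor_bilin)
  show "bilinear (\<lambda>(x :: ('a, 'b) tensor) (y :: ('c, 'd) tensor). tensor_lift (\<lambda>a b. tensor_lift (\<lambda>c d. (a \<otimes> c) \<otimes> (b \<otimes> d)) y) x)"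
    by (intro bilinear_tensorI linear_tensor_lift tensor_lift_combine 1 2)
qed

lemma linear_swap23: "linear swap23"
  unfolding swap23_def by (rule linear_tensor_lift) (rule bilinear_swap23)

lemma swap23_pure: "swap23 ((a \<otimes> b) \<otimes> (c \<otimes> d)) = (a \<otimes> c) \<otimes> (b \<otimes> d)"
  by (simp add: swap23_def bilinear_swap23)

text \<open>
  Vector spaces occur below as subspaces of a fixed real vector space.  Over a field, the tensor
  product of two subspaces is the span of its pure tensors in the ambient tensor product.
  A linear map \<open>V \<rightarrow> W\<close> is represented by a linear map of the ambient spaces that sends \<open>V\<close> to \<open>W\<close>
  (a linear extension always exists); only its values on \<open>V\<close> matter.
\<close>

definition tensor_space :: "'a::real_vector set \<Rightarrow> 'b::real_vector set \<Rightarrow> ('a, 'b) tensor set"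
    (infixr \<open>\<otimes>\<^sub>s\<close> 75) where
  "V \<otimes>\<^sub>s W = span {v \<otimes> w | v w. v \<in> V \<and> w \<in> W}"

definition lin_maps :: "'a::real_vector set \<Rightarrow> 'b::real_vector set \<Rightarrow> ('a \<Rightarrow> 'b) set" where
  "lin_maps V W = {f. linear f \<and> f ` V \<subseteq> W}"


section \<open>Species, bimonoids and double twisted bialgebras\<close>

text \<open>
  The finite sets are those of the universe \<open>'i\<close>; \<open>F \<sigma> I : M I \<rightarrow> M (\<sigma> ` I)\<close> is the image of
  the bijection \<open>\<sigma> : I \<rightarrow> \<sigma> ` I\<close>.
\<close>

locale species =
  fixes M :: "'i set \<Rightarrow> 'v::real_vector set"
    and F :: "('i \<Rightarrow> 'i) \<Rightarrow> 'i set \<Rightarrow> 'v \<Rightarrow> 'v"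
  assumes subspace_M: "finite I \<Longrightarrow> subspace (M I)"
    and F_lin: "\<lbrakk>finite I; inj_on \<sigma> I\<rbrakk> \<Longrightarrow> F \<sigma> I \<in> lin_maps (M I) (M (\<sigma> ` I))"
    and F_cong: "\<lbrakk>finite I; inj_on \<sigma> I; \<And>i. i \<in> I \<Longrightarrow> \<sigma> i = \<sigma>' i; x \<in> M I\<rbrakk>
                  \<Longrightarrow> F \<sigma> I x = F \<sigma>' I x"
    and F_id: "\<lbrakk>finite I; x \<in> M I\<rbrakk> \<Longrightarrow> F id I x = x"
    and F_comp: "\<lbrakk>finite I; inj_on \<sigma> I; inj_on \<sigma>' (\<sigma> ` I); x \<in> M I\<rbrakk>
                  \<Longrightarrow> F (\<sigma>' \<circ> \<sigma>) I x = F \<sigma>' (\<sigma> ` I) (F \<sigma> I x)"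

definition U_space :: "'i set \<Rightarrow> real set" where
  "U_space I = (if I = {} then UNIV else {0})"

text \<open>
  Bimonoids for the Cauchy product, written out in components
  \<open>\<mu> S T : M S \<otimes> M T \<rightarrow> M (S \<union> T)\<close> and \<open>\<Delta> S T : M (S \<union> T) \<rightarrow> M S \<otimes> M T\<close> for disjoint \<open>S\<close>, \<open>T\<close>.
\<close>

locale bimonoid_species = species M F
  for M :: "'i set \<Rightarrow> 'v::real_vector set" and F +
  fixes \<mu> :: "'i set \<Rightarrow> 'i set \<Rightarrow> ('v, 'v) tensor \<Rightarrow> 'v"
    and \<Delta> :: "'i set \<Rightarrow> 'i set \<Rightarrow> 'v \<Rightarrow> ('v, 'v) tensor"
    and \<eta> :: "'i set \<Rightarrow> real \<Rightarrow> 'v"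
    and \<epsilon> :: "'i set \<Rightarrow> 'v \<Rightarrow> real"
  assumes mu_lin: "\<lbrakk>finite S; finite T; S \<inter> T = {}\<rbrakk> \<Longrightarrow> \<mu> S T \<in> lin_maps (M S \<otimes>\<^sub>s M T) (M (S \<union> T))"
    and Delta_lin: "\<lbrakk>finite S; finite T; S \<inter> T = {}\<rbrakk> \<Longrightarrow> \<Delta> S T \<in> lin_maps (M (S \<union> T)) (M S \<otimes>\<^sub>s M T)"
    and eta_lin: "finite I \<Longrightarrow> \<eta> I \<in> lin_maps (U_space I) (M I)"
    and eps_lin: "finite I \<Longrightarrow> \<epsilon> I \<in> lin_maps (M I) (U_space I)"
    and mu_natural: "\<lbrakk>finite S; finite T; S \<inter> T = {}; inj_on \<sigma> (S \<union> T); t \<in> M S \<otimes>\<^sub>s M T\<rbrakk>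
          \<Longrightarrow> F \<sigma> (S \<union> T) (\<mu> S T t) = \<mu> (\<sigma> ` S) (\<sigma> ` T) ((F \<sigma> S \<otimes>\<^sub>m F \<sigma> T) t)"
    and Delta_natural: "\<lbrakk>finite S; finite T; S \<inter> T = {}; inj_on \<sigma> (S \<union> T); x \<in> M (S \<union> T)\<rbrakk>
          \<Longrightarrow> \<Delta> (\<sigma> ` S) (\<sigma> ` T) (F \<sigma> (S \<union> T) x) = (F \<sigma> S \<otimes>\<^sub>m F \<sigma> T) (\<Delta> S T x)"
    and mu_assoc: "\<lbrakk>finite R; finite S; finite T; R \<inter> S = {}; R \<inter> T = {}; S \<inter> T = {};
           w \<in> (M R \<otimes>\<^sub>s M S) \<otimes>\<^sub>s M T\<rbrakk>
          \<Longrightarrow> \<mu> (R \<union> S) T ((\<mu> R S \<otimes>\<^sub>m id) w) = \<mu> R (S \<union> T) ((id \<otimes>\<^sub>m \<mu> S T) (tensor_assoc w))"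
    and mu_unit: "\<lbrakk>finite I; x \<in> M I\<rbrakk> \<Longrightarrow> \<mu> {} I (\<eta> {} 1 \<otimes> x) = x"
                 "\<lbrakk>finite I; x \<in> M I\<rbrakk> \<Longrightarrow> \<mu> I {} (x \<otimes> \<eta> {} 1) = x"
    and Delta_coassoc: "\<lbrakk>finite R; finite S; finite T; R \<inter> S = {}; R \<inter> T = {}; S \<inter> T = {};
           x \<in> M (R \<union> S \<union> T)\<rbrakk>
          \<Longrightarrow> tensor_assoc ((\<Delta> R S \<otimes>\<^sub>m id) (\<Delta> (R \<union> S) T x)) = (id \<otimes>\<^sub>m \<Delta> S T) (\<Delta> R (S \<union> T) x)"
    and Delta_counit: "\<lbrakk>finite I; x \<in> M I\<rbrakk> \<Longrightarrow> tensor_lunit ((\<epsilon> {} \<otimes>\<^sub>m id) (\<Delta> {} I x)) = x"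
                      "\<lbrakk>finite I; x \<in> M I\<rbrakk> \<Longrightarrow> tensor_runit ((id \<otimes>\<^sub>m \<epsilon> {}) (\<Delta> I {} x)) = x"
    and Delta_mu: "\<lbrakk>finite S; finite T; S \<inter> T = {}; S' \<inter> T' = {}; S' \<union> T' = S \<union> T; t \<in> M S \<otimes>\<^sub>s M T\<rbrakk>
          \<Longrightarrow> \<Delta> S' T' (\<mu> S T t) =
              (\<mu> (S \<inter> S') (T \<inter> S') \<otimes>\<^sub>m \<mu> (S \<inter> T') (T \<inter> T'))
                (swap23 ((\<Delta> (S \<inter> S') (S \<inter> T') \<otimes>\<^sub>m \<Delta> (T \<inter> S') (T \<inter> T')) t))"
    and Delta_unit: "\<Delta> {} {} (\<eta> {} 1) = \<eta> {} 1 \<otimes> \<eta> {} 1"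
    and eps_mu: "\<lbrakk>x \<in> M {}; y \<in> M {}\<rbrakk> \<Longrightarrow> \<epsilon> {} (\<mu> {} {} (x \<otimes> y)) = \<epsilon> {} x * \<epsilon> {} y"
    and eps_eta: "\<epsilon> {} (\<eta> {} 1) = 1"

locale coalgebra_species = species M F
  for M :: "'i set \<Rightarrow> 'v::real_vector set" and F +
  fixes \<delta> :: "'i set \<Rightarrow> 'v \<Rightarrow> ('v, 'v) tensor"
    and \<epsilon>' :: "'i set \<Rightarrow> 'v \<Rightarrow> real"
  assumes delta_lin: "finite I \<Longrightarrow> \<delta> I \<in> lin_maps (M I) (M I \<otimes>\<^sub>s M I)"
    and eps'_lin: "finite I \<Longrightarrow> \<epsilon>' I \<in> lin_maps (M I) UNIV"
    and delta_natural: "\<lbrakk>finite I; inj_on \<sigma> I; x \<in> M I\<rbrakk>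
          \<Longrightarrow> \<delta> (\<sigma> ` I) (F \<sigma> I x) = (F \<sigma> I \<otimes>\<^sub>m F \<sigma> I) (\<delta> I x)"
    and eps'_natural: "\<lbrakk>finite I; inj_on \<sigma> I; x \<in> M I\<rbrakk> \<Longrightarrow> \<epsilon>' (\<sigma> ` I) (F \<sigma> I x) = \<epsilon>' I x"
    and delta_coassoc: "\<lbrakk>finite I; x \<in> M I\<rbrakk>
          \<Longrightarrow> tensor_assoc ((\<delta> I \<otimes>\<^sub>m id) (\<delta> I x)) = (id \<otimes>\<^sub>m \<delta> I) (\<delta> I x)"
    and delta_counit: "\<lbrakk>finite I; x \<in> M I\<rbrakk> \<Longrightarrow> tensor_lunit ((\<epsilon>' I \<otimes>\<^sub>m id) (\<delta> I x)) = x"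
                      "\<lbrakk>finite I; x \<in> M I\<rbrakk> \<Longrightarrow> tensor_runit ((id \<otimes>\<^sub>m \<epsilon>' I) (\<delta> I x)) = x"

locale comodule_species = coalgebra_species C FC \<delta> \<epsilon>' + species M FM
  for C :: "'i set \<Rightarrow> 'c::real_vector set" and FC \<delta> \<epsilon>'
    and M :: "'i set \<Rightarrow> 'v::real_vector set" and FM +
  fixes \<rho> :: "'i set \<Rightarrow> 'v \<Rightarrow> ('c, 'v) tensor"
  assumes rho_lin: "finite I \<Longrightarrow> \<rho> I \<in> lin_maps (M I) (C I \<otimes>\<^sub>s M I)"
    and rho_natural: "\<lbrakk>finite I; inj_on \<sigma> I; x \<in> M I\<rbrakk>
          \<Longrightarrow> \<rho> (\<sigma> ` I) (FM \<sigma> I x) = (FC \<sigma> I \<otimes>\<^sub>m FM \<sigma> I) (\<rho> I x)"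
    and rho_coassoc: "\<lbrakk>finite I; x \<in> M I\<rbrakk>
          \<Longrightarrow> tensor_assoc ((\<delta> I \<otimes>\<^sub>m id) (\<rho> I x)) = (id \<otimes>\<^sub>m \<rho> I) (\<rho> I x)"
    and rho_counit: "\<lbrakk>finite I; x \<in> M I\<rbrakk> \<Longrightarrow> tensor_lunit ((\<epsilon>' I \<otimes>\<^sub>m id) (\<rho> I x)) = x"

locale double_twisted_bialgebra =
  bimonoid_species M F \<mu> \<Delta> \<eta> \<epsilon> + coalgebra_species M F \<delta> \<epsilon>'
  for M :: "'i set \<Rightarrow> 'v::real_vector set" and F \<mu> \<Delta> \<eta> \<epsilon> \<delta> \<epsilon>' +
  assumes delta_mu: "\<lbrakk>finite S; finite T; S \<inter> T = {}; u \<in> M S; v \<in> M T\<rbrakk>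
          \<Longrightarrow> \<delta> (S \<union> T) (\<mu> S T (u \<otimes> v)) = (\<mu> S T \<otimes>\<^sub>m \<mu> S T) (swap23 (\<delta> S u \<otimes> \<delta> T v))"
    and eps'_mu: "\<lbrakk>finite S; finite T; S \<inter> T = {}; u \<in> M S; v \<in> M T\<rbrakk>
          \<Longrightarrow> \<epsilon>' (S \<union> T) (\<mu> S T (u \<otimes> v)) = \<epsilon>' S u * \<epsilon>' T v"
    and delta_unit: "\<delta> {} (\<eta> {} 1) = \<eta> {} 1 \<otimes> \<eta> {} 1"
    and eps'_unit: "\<epsilon>' {} (\<eta> {} 1) = 1"
    and delta_Delta: "\<lbrakk>finite S; finite T; S \<inter> T = {}; x \<in> M (S \<union> T)\<rbrakk>
          \<Longrightarrow> (id \<otimes>\<^sub>m \<Delta> S T) (\<delta> (S \<union> T) x) =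
              (\<mu> S T \<otimes>\<^sub>m id) (swap23 ((\<delta> S \<otimes>\<^sub>m \<delta> T) (\<Delta> S T x)))"
    and delta_eps: "\<lbrakk>finite I; x \<in> M I\<rbrakk> \<Longrightarrow> tensor_runit ((id \<otimes>\<^sub>m \<epsilon> I) (\<delta> I x)) = \<eta> I (\<epsilon> I x)"


section \<open>Submodular functions\<close>

text \<open>Functions on \<open>Pow I\<close> take the value \<open>undefined\<close> elsewhere.\<close>

definition set_functions :: "'i set \<Rightarrow> ('i set \<Rightarrow> ereal) set" where
  "set_functions I = {z \<in> Pow I \<rightarrow>\<^sub>E {r. r \<noteq> - \<infinity>}. z {} = 0 \<and> z I < \<infinity>}"

definition submodular_functions :: "'i set \<Rightarrow> ('i set \<Rightarrow> ereal) set" where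
  "submodular_functions I = {z \<in> set_functions I.
     \<forall>A\<subseteq>I. \<forall>B\<subseteq>I. z (A \<union> B) + z (A \<inter> B) \<le> z A + z B}"

text \<open>
  In the modular case equality is required only where \<open>z A\<close> and \<open>z B\<close> are finite; where one of them
  is \<open>\<infinity>\<close> the submodular inequality carries no information.  Demanding equality there as well would
  force \<open>z\<close> to be finite everywhere (take \<open>B = I - A\<close>), and the functions \<open>z\<^sup>P\<close> below would
  not be modular.
\<close>

definition modular_functions :: "'i set \<Rightarrow> ('i set \<Rightarrow> ereal) set" where
  "modular_functions I = {z \<in> set_functions I.
     \<forall>A\<subseteq>I. \<forall>B\<subseteq>I. z A < \<infinity> \<longrightarrow> z B < \<infinity> \<longrightarrow> z (A \<union> B) + z (A \<inter> B) = z A + z B}"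

definition restriction :: "('i set \<Rightarrow> ereal) \<Rightarrow> 'i set \<Rightarrow> 'i set \<Rightarrow> ereal" where
  "restriction z S = restrict z (Pow S)"

text \<open>\<open>contraction I z S\<close> is \<open>z\<^bsub>/S\<^esub>\<close> for \<open>z\<close> on \<open>I\<close>; \<open>minor z A B\<close> is \<open>z\<^bsub>B/A\<^esub>\<close>.\<close>

definition contraction :: "'i set \<Rightarrow> ('i set \<Rightarrow> ereal) \<Rightarrow> 'i set \<Rightarrow> 'i set \<Rightarrow> ereal" where
  "contraction I z S = (\<lambda>E\<in>Pow (I - S). z (S \<union> E) - z S)"

definition minor :: "('i set \<Rightarrow> ereal) \<Rightarrow> 'i set \<Rightarrow> 'i set \<Rightarrow> 'i set \<Rightarrow> ereal" where
  "minor z A B = contraction B (restriction z B) A"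

definition set_prod :: "'i set \<Rightarrow> 'i set \<Rightarrow> ('i set \<Rightarrow> ereal) \<Rightarrow> ('i set \<Rightarrow> ereal) \<Rightarrow> 'i set \<Rightarrow> ereal" where
  "set_prod S T u v = (\<lambda>E\<in>Pow (S \<union> T). u (E \<inter> S) + v (E \<inter> T))"

definition decomposes :: "('i set \<Rightarrow> ereal) \<Rightarrow> 'i set \<Rightarrow> 'i set \<Rightarrow> 'i set \<Rightarrow> bool" where
  "decomposes z C C\<^sub>1 C\<^sub>2 \<longleftrightarrow>
     C = C\<^sub>1 \<union> C\<^sub>2 \<and> C\<^sub>1 \<inter> C\<^sub>2 = {} \<and> (\<forall>E\<subseteq>C. z E = z (E \<inter> C\<^sub>1) + z (E \<inter> C\<^sub>2))"


section \<open>Preorders\<close>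

text \<open>\<open>(x, y) \<in> P\<close> means \<open>x \<le> y\<close>.\<close>

definition down_set :: "'i set \<Rightarrow> 'i rel \<Rightarrow> 'i set \<Rightarrow> bool" where
  "down_set I P A \<longleftrightarrow> A \<subseteq> I \<and> (\<forall>x y. y \<in> A \<longrightarrow> (x, y) \<in> P \<longrightarrow> x \<in> A)"

definition bubbles :: "'i set \<Rightarrow> 'i rel \<Rightarrow> 'i set set" where
  "bubbles I P = I // (P \<inter> P\<inverse>)"

definition convex_set :: "'i set \<Rightarrow> 'i rel \<Rightarrow> 'i set \<Rightarrow> bool" where
  "convex_set I P C \<longleftrightarrow> (\<exists>A B. down_set I P A \<and> down_set I P B \<and> A \<subseteq> B \<and> C = B - A)"

definition disconnected_union :: "'i rel \<Rightarrow> 'i set \<Rightarrow> 'i set \<Rightarrow> 'i set \<Rightarrow> bool" where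
  "disconnected_union P C C\<^sub>1 C\<^sub>2 \<longleftrightarrow>
     C = C\<^sub>1 \<union> C\<^sub>2 \<and> C\<^sub>1 \<inter> C\<^sub>2 = {} \<and> (\<forall>x\<in>C\<^sub>1. \<forall>y\<in>C\<^sub>2. (x, y) \<notin> P \<and> (y, x) \<notin> P)"

definition compatible :: "'i set \<Rightarrow> 'i rel \<Rightarrow> ('i set \<Rightarrow> ereal) \<Rightarrow> bool" where
  "compatible I P z \<longleftrightarrow>
     (\<forall>A. down_set I P A \<longrightarrow> z A < \<infinity>) \<and>
     (\<forall>A B C\<^sub>1 C\<^sub>2. down_set I P A \<longrightarrow> down_set I P B \<longrightarrow> A \<subseteq> B \<longrightarrow>
        disconnected_union P (B - A) C\<^sub>1 C\<^sub>2 \<longrightarrow> decomposes (minor z A B) (B - A) C\<^sub>1 C\<^sub>2)"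

text \<open>\<open>z\<^sub>C\<close> for convex \<open>C\<close>; well defined when \<open>P\<close> is compatible with \<open>z\<close>.\<close>

definition convex_minor :: "'i set \<Rightarrow> 'i rel \<Rightarrow> ('i set \<Rightarrow> ereal) \<Rightarrow> 'i set \<Rightarrow> 'i set \<Rightarrow> ereal" where
  "convex_minor I P z C =
     (THE f. \<exists>A B. down_set I P A \<and> down_set I P B \<and> A \<subseteq> B \<and> C = B - A \<and> f = minor z A B)"

definition conforms :: "'i set \<Rightarrow> 'i rel \<Rightarrow> ('i set \<Rightarrow> ereal) \<Rightarrow> bool" where
  "conforms I P z \<longleftrightarrow> compatible I P z \<and>
     (\<forall>C C\<^sub>1 C\<^sub>2. convex_set I P C \<longrightarrow> decomposes (convex_minor I P z C) C C\<^sub>1 C\<^sub>2 \<longrightarrow>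
        disconnected_union P C C\<^sub>1 C\<^sub>2)"

definition Pre :: "'i set \<Rightarrow> ('i set \<Rightarrow> ereal) \<Rightarrow> 'i rel set" where
  "Pre I z = {P. preorder_on I P \<and> conforms I P z}"

text \<open>
  \<open>lower I P z\<close> is \<open>z\<^sub>P\<close>, the iterated product of the \<open>z\<^sub>C\<close> over the bubbles \<open>C\<close>;
  \<open>upper I P z\<close> is \<open>z\<^sup>P\<close>.
\<close>

definition lower :: "'i set \<Rightarrow> 'i rel \<Rightarrow> ('i set \<Rightarrow> ereal) \<Rightarrow> 'i set \<Rightarrow> ereal" where
  "lower I P z = (\<lambda>E\<in>Pow I. \<Sum>C\<in>bubbles I P. convex_minor I P z C (E \<inter> C))"

definition upper :: "'i set \<Rightarrow> 'i rel \<Rightarrow> ('i set \<Rightarrow> ereal) \<Rightarrow> 'i set \<Rightarrow> ereal" where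
  "upper I P z = (\<lambda>A\<in>Pow I. if down_set I P A then z A else \<infinity>)"

text \<open>
  Well defined for submodular \<open>z\<close> on a finite \<open>I\<close>: the sets where \<open>z\<close> is finite contain \<open>{}\<close>
  and \<open>I\<close> and are closed under \<open>\<union>\<close> and \<open>\<inter>\<close>.
\<close>

definition pre :: "'i set \<Rightarrow> ('i set \<Rightarrow> ereal) \<Rightarrow> 'i rel" where
  "pre I z = (THE P. preorder_on I P \<and> (\<forall>A\<subseteq>I. down_set I P A \<longleftrightarrow> z A < \<infinity>))"


section \<open>The species of submodular and of modular functions\<close>

text \<open>
  The structure maps are defined by linear extension to all functions \<open>'i set \<Rightarrow> ereal\<close>; their
  restrictions to \<open>SM\<close> and to \<open>MOD\<close> are the maps of interest.
\<close>

type_synonym 'i fun_space = "('i set \<Rightarrow> ereal) \<Rightarrow>\<^sub>0 real"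

definition SM :: "'i set \<Rightarrow> 'i fun_space set" where
  "SM I = free_space (submodular_functions I)"

definition MOD :: "'i set \<Rightarrow> 'i fun_space set" where
  "MOD I = free_space (modular_functions I)"

definition SM_map :: "('i \<Rightarrow> 'i) \<Rightarrow> 'i set \<Rightarrow> 'i fun_space \<Rightarrow> 'i fun_space" where
  "SM_map \<sigma> I = lin_ext (\<lambda>z. basis (\<lambda>B\<in>Pow (\<sigma> ` I). z (\<sigma> -` B \<inter> I)))"

definition SM_mu :: "'i set \<Rightarrow> 'i set \<Rightarrow> ('i fun_space, 'i fun_space) tensor \<Rightarrow> 'i fun_space" where
  "SM_mu S T =
     tensor_lift (\<lambda>x y. lin_ext (\<lambda>u. lin_ext (\<lambda>v. basis (set_prod S T u v)) y) x)"

definition SM_Delta :: "'i set \<Rightarrow> 'i set \<Rightarrow> 'i fun_space \<Rightarrow> ('i fun_space, 'i fun_space) tensor" where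
  "SM_Delta S T = lin_ext (\<lambda>z.
     if z S < \<infinity> then basis (restriction z S) \<otimes> basis (contraction (S \<union> T) z S) else 0)"

definition SM_eta :: "'i set \<Rightarrow> real \<Rightarrow> 'i fun_space" where
  "SM_eta I r = (if I = {} then r *\<^sub>R basis (\<lambda>E\<in>Pow {}. 0) else 0)"

definition SM_eps :: "'i set \<Rightarrow> 'i fun_space \<Rightarrow> real" where
  "SM_eps I = lin_ext (\<lambda>z. if I = {} then 1 else 0)"

definition SM_delta :: "'i set \<Rightarrow> 'i fun_space \<Rightarrow> ('i fun_space, 'i fun_space) tensor" where
  "SM_delta I = lin_ext (\<lambda>z. \<Sum>Q\<in>Pre I z. basis (lower I Q z) \<otimes> basis (upper I Q z))"

definition MOD_eps :: "'i set \<Rightarrow> 'i fun_space \<Rightarrow> real" where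
  "MOD_eps I = lin_ext (\<lambda>z. if equiv I (pre I z) then 1 else 0)"

lemma linear_tensor_lift_lin_ext:
  "bilinear (\<lambda>x y. lin_ext (\<lambda>u. lin_ext (f u) y) x)"
proof (rule bilinear_tensorI)
  show "linear (\<lambda>y. lin_ext (\<lambda>u. lin_ext (f u) y) x)" for x
    by (rule linearI)
      (simp_all add: lin_ext_def[of _ x] linear_add[OF linear_lin_ext] linear_cmul[OF linear_lin_ext]
        scaleR_add_right sum.distrib scaleR_sum_right mult.commute)
qed (rule linear_lin_ext)

lemma SM_mu_basis: "SM_mu S T (basis u \<otimes> basis v) = basis (set_prod S T u v)"
  by (simp add: SM_mu_def linear_tensor_lift_lin_ext)

end

theory Submission
  imports Defs
begin

text \<open>
  Everything reduces to rings of sets.  For submodular \<open>z\<close>, a preorder conforms to \<open>z\<close> iff \<open>z\<close> is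
  finite and modular on the ring of its down-sets, and this ring contains \<open>X\<close> and \<open>Y\<close> as soon as it
  contains \<open>X \<inter> Y\<close> and \<open>X \<union> Y\<close> and \<open>z X + z Y = z (X \<inter> Y) + z (X \<union> Y)\<close> (\<open>conforms_iff\<close>).  As
  preorders on a finite set correspond to rings of subsets (Birkhoff), conforming preorders can be
  built and compared through their down-sets.  The geometric picture is that the conforming
  preorders are the faces of the polyhedron of \<open>z\<close>: \<open>z\<^sub>P\<close> is the function of the face of \<open>P\<close> and
  \<open>z\<^sup>P\<close> that of the tangent cone along it.

  On basis elements both sides of the identity relating \<open>\<Delta>\<close> and \<open>\<delta>\<close>, of the multiplicativity of
  \<open>\<delta>\<close> and of its coassociativity are sums over sets of conforming preorders.  Each identity amounts
  to a bijection of the index sets together with the equality of corresponding terms.  For \<open>\<Delta>\<close> a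
  preorder \<open>Q\<close> with down-set \<open>S\<close> corresponds to its restrictions to \<open>S\<close> and to the complement
  (\<open>bij_betw_split_Pre\<close>); multiplicativity is the same bijection, because \<open>S\<close> is a down-set of every
  preorder conforming to a product on \<open>S\<close> and \<open>T\<close>.  For coassociativity, pairs \<open>P \<in> Pre(z)\<close>,
  \<open>Q \<in> Pre(z\<^sup>P)\<close> correspond to pairs \<open>Q \<in> Pre(z)\<close>, \<open>R \<in> Pre(z\<^sub>Q)\<close> by \<open>R = P \<inter> Q\<inverse>\<close>
  (\<open>bij_betw_iterated_Pre\<close>): a face of a face is a face.

  Both bijections are inverted by one construction.  If \<open>w \<le> z\<close> are submodular with \<open>w I = z I\<close> and
  \<open>R\<close> conforms to \<open>w\<close>, then the down-sets of \<open>R\<close> on which \<open>w\<close> and \<open>z\<close> agree are the down-sets of a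
  preorder conforming to \<open>z\<close> (\<open>lift_preorder\<close>); \<open>w\<close> is the product of the minors along \<open>S\<close> in the
  first case and \<open>z\<^sub>Q\<close> in the second.  That one gets back the original preorder follows from
  \<open>Pre_eq_if_same_bubbles\<close>: nested conforming preorders with the same bubbles are equal.

  The counit laws say that exactly one term of \<open>\<delta> z\<close> survives on either side: there is exactly one
  equivalence relation conforming to \<open>z\<close>, given by its decomposition into connected factors, and for
  modular \<open>z\<close> the only \<open>Q\<close> for which \<open>z\<^sub>Q\<close> is totally disconnected is \<open>pre z\<close>.  The other axioms are
  computations with \<open>\<cdot>\<close>, restriction and contraction on basis elements.
\<close>

section \<open>Preorders and their down-sets\<close>

lemma down_set_subset: "down_set I P A \<Longrightarrow> A \<subseteq> I"
  by (simp add: down_set_def)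

lemma down_setD: "down_set I P A \<Longrightarrow> y \<in> A \<Longrightarrow> (x, y) \<in> P \<Longrightarrow> x \<in> A"
  by (auto simp: down_set_def)

lemma down_set_empty [simp]: "down_set I P {}"
  by (simp add: down_set_def)

lemma down_set_Un: "down_set I P A \<Longrightarrow> down_set I P B \<Longrightarrow> down_set I P (A \<union> B)"
  by (auto simp: down_set_def)

lemma down_set_Int: "down_set I P A \<Longrightarrow> down_set I P B \<Longrightarrow> down_set I P (A \<inter> B)"
  by (auto simp: down_set_def)

lemma preorder_on_subset: "preorder_on I P \<Longrightarrow> (x, y) \<in> P \<Longrightarrow> x \<in> I \<and> y \<in> I"
  by (auto simp: preorder_on_def)

lemma preorder_on_refl: "preorder_on I P \<Longrightarrow> x \<in> I \<Longrightarrow> (x, x) \<in> P"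
  by (auto simp: preorder_on_def refl_on_def)

lemma preorder_on_trans: "preorder_on I P \<Longrightarrow> (x, y) \<in> P \<Longrightarrow> (y, z) \<in> P \<Longrightarrow> (x, z) \<in> P"
  by (auto simp: preorder_on_def dest: transD)

lemma down_set_full: "preorder_on I P \<Longrightarrow> down_set I P I"
  by (auto simp: down_set_def dest: preorder_on_subset)

lemma down_set_below: "preorder_on I P \<Longrightarrow> down_set I P {x. (x, y) \<in> P}"
  unfolding down_set_def by (auto dest: preorder_on_subset preorder_on_trans)

lemma preorder_le_iff:
  assumes "preorder_on I P" "y \<in> I"
  shows "(x, y) \<in> P \<longleftrightarrow> (\<forall>A. down_set I P A \<longrightarrow> y \<in> A \<longrightarrow> x \<in> A)"
  using down_set_below[OF assms(1), of y] preorder_on_refl[OF assms] by (auto dest: down_setD)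

lemma preorder_subsetI:
  assumes "preorder_on I P" "preorder_on I Q" "\<And>A. down_set I Q A \<Longrightarrow> down_set I P A"
  shows "P \<subseteq> Q"
  using preorder_on_subset[OF assms(1)] down_setD[OF assms(3)]
  by (auto simp: preorder_le_iff[OF assms(2)])

lemma down_set_anti_mono: "P \<subseteq> Q \<Longrightarrow> down_set I Q A \<Longrightarrow> down_set I P A"
  by (auto simp: down_set_def)

lemma preorder_eqI:
  assumes "preorder_on I P" "preorder_on I Q" "\<And>A. down_set I P A \<longleftrightarrow> down_set I Q A"
  shows "P = Q"
  using assms by (intro equalityI preorder_subsetI) auto

lemma finite_preorders: "finite I \<Longrightarrow> finite {P. preorder_on I P}"
  by (rule finite_subset[of _ "Pow (I \<times> I)"]) (auto simp: preorder_on_def)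

definition preorder_of_ring :: "'i set \<Rightarrow> 'i set set \<Rightarrow> 'i rel" where
  "preorder_of_ring I L = {(x, y) \<in> I \<times> I. \<forall>A\<in>L. y \<in> A \<longrightarrow> x \<in> A}"

lemma preorder_on_preorder_of_ring: "preorder_on I (preorder_of_ring I L)"
  by (auto simp: preorder_of_ring_def preorder_on_def refl_on_def trans_def)

text \<open>
  Birkhoff's correspondence between preorders on a finite set and rings of subsets: a down-set \<open>A\<close> is
  the union over \<open>y \<in> A\<close> of the least member of the ring that contains \<open>y\<close>.
\<close>

lemma down_set_preorder_of_ring:
  assumes "finite I" "L \<subseteq> Pow I" "{} \<in> L" "I \<in> L"
    and un: "\<And>A B. A \<in> L \<Longrightarrow> B \<in> L \<Longrightarrow> A \<union> B \<in> L"
    and int: "\<And>A B. A \<in> L \<Longrightarrow> B \<in> L \<Longrightarrow> A \<inter> B \<in> L"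
  shows "down_set I (preorder_of_ring I L) A \<longleftrightarrow> A \<in> L"
proof
  assume "A \<in> L"
  then show "down_set I (preorder_of_ring I L) A"
    using assms(2) by (auto simp: down_set_def preorder_of_ring_def)
next
  assume dA: "down_set I (preorder_of_ring I L) A"
  define least where "least y = \<Inter> {B \<in> L. y \<in> B}" for y
  have finL: "finite L"
    using assms(1,2) finite_subset by blast
  have least_L: "least y \<in> L" if "y \<in> I" for y
  proof -
    have "\<Inter> F \<in> L" if "finite F" "F \<noteq> {}" "F \<subseteq> L" for F
      using that by (induction F rule: finite_ne_induct) (auto intro: int)
    from this[of "{B \<in> L. y \<in> B}"] show ?thesis
      unfolding least_def using finL \<open>I \<in> L\<close> that by fastforce
  qed
  have "A = \<Union> (least ` A)"
  proof
    show "A \<subseteq> \<Union> (least ` A)" unfolding least_def by blast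
    show "\<Union> (least ` A) \<subseteq> A"
    proof
      fix x assume "x \<in> \<Union> (least ` A)"
      then obtain y where y: "y \<in> A" "x \<in> least y" by blast
      then have "(x, y) \<in> preorder_of_ring I L"
        using dA \<open>I \<in> L\<close> by (auto simp: preorder_of_ring_def least_def down_set_def)
      then show "x \<in> A" using dA y(1) by (rule down_setD[rotated 2])
    qed
  qed
  moreover have "\<Union> F \<in> L" if "finite F" "F \<subseteq> L" for F
    using that \<open>{} \<in> L\<close> by (induction F rule: finite_induct) (auto intro: un)
  moreover have "finite (least ` A)" "least ` A \<subseteq> L"
    using dA \<open>finite I\<close> least_L by (auto simp: down_set_def intro: finite_subset)
  ultimately show "A \<in> L" by metis
qed

text \<open>
  If \<open>x \<le> y\<close> but not \<open>y \<le> x\<close>, the complement of the down-closure of \<open>x\<close> contains \<open>y\<close> and not \<open>x\<close>.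
\<close>

lemma equiv_iff_down_sets_complement:
  assumes "preorder_on I P"
  shows "equiv I P \<longleftrightarrow> (\<forall>A. down_set I P A \<longrightarrow> down_set I P (I - A))"
proof
  assume "equiv I P"
  then show "\<forall>A. down_set I P A \<longrightarrow> down_set I P (I - A)"
    using preorder_on_subset[OF assms]
    by (auto simp: down_set_def equiv_def dest: symD)
next
  assume *: "\<forall>A. down_set I P A \<longrightarrow> down_set I P (I - A)"
  have "(y, x) \<in> P" if "(x, y) \<in> P" for x y
  proof (rule ccontr)
    assume "(y, x) \<notin> P"
    have "down_set I P (I - {u. (u, x) \<in> P})"
      using * down_set_below[OF assms] by blast
    then have "x \<in> I - {u. (u, x) \<in> P}"
      using that \<open>(y, x) \<notin> P\<close> preorder_on_subset[OF assms that] by (auto dest: down_setD)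
    then show False
      using preorder_on_refl[OF assms] by auto
  qed
  then show "equiv I P"
    using assms by (auto simp: equiv_def preorder_on_def intro: symI)
qed

text \<open>
  If \<open>P' \<subseteq> P\<close> have the same bubbles and differ, there is a pair of bubbles \<open>X\<close>, \<open>Y\<close> with \<open>Y\<close>
  covering \<open>X\<close> in \<open>P\<close> but incomparable in \<open>P'\<close>.  Adding one of \<open>X\<close>, \<open>Y\<close> to the part of the
  down-set of \<open>Y\<close> below both gives two down-sets of \<open>P'\<close> that violate the closure hypothesis.
\<close>

lemma preorder_eq_if_relatively_closed:
  assumes "finite I" and P: "preorder_on I P" and P': "preorder_on I P'"
    and sub: "P' \<subseteq> P" and bub: "P \<inter> P\<inverse> \<subseteq> P'"
    and closed: "\<And>X Y. down_set I P' X \<Longrightarrow> down_set I P' Y \<Longrightarrow> down_set I P (X \<inter> Y) \<Longrightarrow>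
                   down_set I P (X \<union> Y) \<Longrightarrow> down_set I P Y"
  shows "P' = P"
proof (rule ccontr)
  assume "P' \<noteq> P"
  define between where "between = (\<lambda>(x, y). {u. (x, u) \<in> P \<and> (u, y) \<in> P})"
  have fin: "finite (between p)" for p
    by (rule finite_subset[OF _ \<open>finite I\<close>])
      (use preorder_on_subset[OF P] in \<open>auto simp: between_def\<close>)
  \<comment> \<open>A missing pair with the smallest interval is a cover, as intermediate pairs would compose to it.\<close>
  obtain p where "p \<in> P - P'" and min: "\<And>q. q \<in> P - P' \<Longrightarrow> card (between p) \<le> card (between q)"
  proof -
    obtain q where "q \<in> P - P'" using sub \<open>P' \<noteq> P\<close> by blast
    from ex_has_least_nat[of "\<lambda>p. p \<in> P - P'", OF this, of "\<lambda>p. card (between p)"]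
    show ?thesis using that by blast
  qed
  then obtain x y where p: "p = (x, y)" and xy: "(x, y) \<in> P" "(x, y) \<notin> P'"
    by (cases p) auto
  note tr = preorder_on_trans[OF P] and tr' = preorder_on_trans[OF P']
  note rf = preorder_on_refl[OF P] and I = preorder_on_subset[OF P]
  have yx: "(y, x) \<notin> P" using xy bub by blast
  have cover: "(u, x) \<in> P \<or> (y, u) \<in> P" if u: "(x, u) \<in> P" "(u, y) \<in> P" for u
  proof (rule ccontr)
    assume n: "\<not> ((u, x) \<in> P \<or> (y, u) \<in> P)"
    have "between (x, u) \<subset> between (x, y)"
      using n u I[OF u(1)] I[OF u(2)] rf tr unfolding between_def psubset_eq prod.case by blast
    moreover have "between (u, y) \<subset> between (x, y)"
      using n u I[OF u(1)] I[OF u(2)] rf tr unfolding between_def psubset_eq prod.case by blast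
    ultimately have "card (between (x, u)) < card (between p)" "card (between (u, y)) < card (between p)"
      unfolding p by (meson fin psubset_card_mono)+
    then have "(x, u) \<in> P'" "(u, y) \<in> P'"
      using min u by (meson DiffI leD)+
    then show False using xy tr' by blast
  qed
  \<comment> \<open>\<open>X\<close> and \<open>Y\<close> are the bubbles of \<open>x\<close> and \<open>y\<close>, and \<open>B\<close> is the rest of the down-closure of \<open>y\<close>.\<close>
  define B where "B = {u. (u, y) \<in> P \<and> (x, u) \<notin> P}"
  define X where "X = {u. (u, x) \<in> P \<and> (x, u) \<in> P}"
  define Y where "Y = {u. (u, y) \<in> P \<and> (y, u) \<in> P}"
  have dB: "down_set I P B"
    using I tr unfolding B_def down_set_def by blast
  have BXY: "B \<union> X \<union> Y = {u. (u, y) \<in> P}"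
    using cover xy tr unfolding B_def X_def Y_def by blast
  have "X \<inter> Y = {}" using yx tr unfolding X_def Y_def by blast
  have dBX: "down_set I P (B \<union> X)"

  proof -
    have "a \<in> B \<union> X" if b: "b \<in> B \<union> X" and ab: "(a, b) \<in> P" for a b
    proof -
      have "(a, y) \<in> P" "(b, x) \<in> P \<or> (x, b) \<notin> P"
        using b xy tr[OF ab] tr[of b x y] by (auto simp: B_def X_def)
      then show ?thesis
        using tr[OF ab, of x] tr[OF _ ab, of x] by (auto simp: B_def X_def)
    qed
    then show ?thesis using I unfolding down_set_def B_def X_def by blast
  qed
  have "down_set I P' (B \<union> Y)"
    unfolding down_set_def
  proof (intro conjI allI impI)
    show "B \<union> Y \<subseteq> I" using I by (auto simp: B_def Y_def)
    fix a b assume b: "b \<in> B \<union> Y" and ab: "(a, b) \<in> P'"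
    show "a \<in> B \<union> Y"
    proof (cases "b \<in> B")
      case True
      then show ?thesis using ab sub down_setD[OF dB] by blast
    next
      case False
      then have bY: "b \<in> Y" using b by blast
      then have "(a, y) \<in> P" using ab sub tr unfolding Y_def by blast
      moreover have "a \<notin> X"
      proof
        assume "a \<in> X"
        then have "(x, a) \<in> P'" "(b, y) \<in> P'" using bY bub by (auto simp: X_def Y_def)
        then show False using ab xy tr' by blast
      qed
      ultimately show ?thesis using BXY by blast
    qed
  qed
  moreover have "down_set I P' (B \<union> X)"
    using dBX sub by (rule down_set_anti_mono[rotated])
  moreover have "down_set I P ((B \<union> X) \<inter> (B \<union> Y))"
    using dB \<open>X \<inter> Y = {}\<close> by (simp flip: Un_Int_distrib)
  moreover have "down_set I P ((B \<union> X) \<union> (B \<union> Y))"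
  proof -
    have "(B \<union> X) \<union> (B \<union> Y) = {u. (u, y) \<in> P}" using BXY by blast
    then show ?thesis using down_set_below[OF P] by simp
  qed
  ultimately have "down_set I P (B \<union> Y)"
    using closed[of "B \<union> X" "B \<union> Y"] by blast
  then have "x \<in> B \<union> Y"
    using down_setD xy(1) I[OF xy(1)] rf[of y] by (fastforce simp: Y_def)
  then show False
    using yx I[OF xy(1)] rf[of x] by (simp add: B_def Y_def)
qed

section \<open>Submodular functions and their minors\<close>

lemma submodular_ineq:
  "z \<in> submodular_functions I \<Longrightarrow> A \<subseteq> I \<Longrightarrow> B \<subseteq> I \<Longrightarrow> z (A \<union> B) + z (A \<inter> B) \<le> z A + z B"
  by (simp add: submodular_functions_def)

lemma modular_eq:
  "z \<in> modular_functions I \<Longrightarrow> A \<subseteq> I \<Longrightarrow> B \<subseteq> I \<Longrightarrow> z A < \<infinity> \<Longrightarrow> z B < \<infinity> \<Longrightarrow>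
     z (A \<union> B) + z (A \<inter> B) = z A + z B"
  by (simp add: modular_functions_def)

lemma submodular_not_MInf: "z \<in> submodular_functions I \<Longrightarrow> A \<subseteq> I \<Longrightarrow> z A \<noteq> - \<infinity>"
  by (auto simp: submodular_functions_def set_functions_def PiE_iff)

lemma submodular_empty: "z \<in> submodular_functions I \<Longrightarrow> z {} = 0"
  by (simp add: submodular_functions_def set_functions_def)

lemma submodular_full: "z \<in> submodular_functions I \<Longrightarrow> z I < \<infinity>"
  by (simp add: submodular_functions_def set_functions_def)

lemma submodular_extensional: "z \<in> submodular_functions I \<Longrightarrow> z \<in> extensional (Pow I)"
  by (simp add: submodular_functions_def set_functions_def PiE_iff)

lemma extensional_Pow_eqI:
  "u \<in> extensional (Pow I) \<Longrightarrow> v \<in> extensional (Pow I) \<Longrightarrow> (\<And>E. E \<subseteq> I \<Longrightarrow> u E = v E) \<Longrightarrow> u = v"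
  by (rule extensionalityI) auto

lemma submodular_functionsI:
  assumes "z \<in> extensional (Pow I)" "z {} = 0" "z I < \<infinity>" "\<And>A. A \<subseteq> I \<Longrightarrow> z A \<noteq> - \<infinity>"
    "\<And>A B. A \<subseteq> I \<Longrightarrow> B \<subseteq> I \<Longrightarrow> z (A \<union> B) + z (A \<inter> B) \<le> z A + z B"
  shows "z \<in> submodular_functions I"
  using assms by (auto simp: submodular_functions_def set_functions_def PiE_iff)

lemma modular_functionsI:
  assumes "z \<in> submodular_functions I"
    "\<And>A B. A \<subseteq> I \<Longrightarrow> B \<subseteq> I \<Longrightarrow> z A < \<infinity> \<Longrightarrow> z B < \<infinity> \<Longrightarrow> z (A \<union> B) + z (A \<inter> B) = z A + z B"
  shows "z \<in> modular_functions I"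
  using assms by (auto simp: submodular_functions_def modular_functions_def)

text \<open>
  Where one of the two values is \<open>\<infinity>\<close>, the submodular inequality has right-hand side \<open>\<infinity>\<close> because
  \<open>- \<infinity>\<close> is excluded.
\<close>

lemma modular_imp_submodular:
  assumes "z \<in> modular_functions I"
  shows "z \<in> submodular_functions I"
proof -
  have ni: "z A \<noteq> - \<infinity>" if "A \<subseteq> I" for A
    using assms that by (auto simp: modular_functions_def set_functions_def PiE_iff)
  have "z (A \<union> B) + z (A \<inter> B) \<le> z A + z B" if AB: "A \<subseteq> I" "B \<subseteq> I" for A B
  proof (cases "z A < \<infinity> \<and> z B < \<infinity>")
    case True
    then show ?thesis using modular_eq[OF assms AB] by simp
  next
    case False
    then have eq: "z A + z B = \<infinity>" using ni[OF AB(1)] ni[OF AB(2)] by auto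
    show ?thesis unfolding eq by simp
  qed
  then show ?thesis
    using assms by (auto simp: modular_functions_def submodular_functions_def)
qed

lemma submodular_finite_Un_Int:
  assumes z: "z \<in> submodular_functions I" and AB: "A \<subseteq> I" "B \<subseteq> I" "z A < \<infinity>" "z B < \<infinity>"
  shows "z (A \<union> B) < \<infinity>" "z (A \<inter> B) < \<infinity>"
proof -
  have "z (A \<union> B) \<noteq> - \<infinity>" "z (A \<inter> B) \<noteq> - \<infinity>"
    using submodular_not_MInf[OF z, of "A \<union> B"] submodular_not_MInf[OF z, of "A \<inter> B"] AB by auto
  moreover have "z (A \<union> B) + z (A \<inter> B) < \<infinity>"
    using submodular_ineq[OF z AB(1,2)] AB(3,4) by (cases "z A"; cases "z B") auto
  ultimately show "z (A \<union> B) < \<infinity>" "z (A \<inter> B) < \<infinity>" by auto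
qed

lemma submodular_real:
  assumes "z \<in> submodular_functions I" "A \<subseteq> I" "z A < \<infinity>"
  obtains r where "z A = ereal r"
  using submodular_not_MInf[OF assms(1,2)] assms(3) by (cases "z A") auto

lemma restriction_submodular:
  assumes "z \<in> submodular_functions I" "S \<subseteq> I" "z S < \<infinity>"
  shows "restriction z S \<in> submodular_functions S"
proof (rule submodular_functionsI)
  fix A B assume "A \<subseteq> S" "B \<subseteq> S"
  moreover from this have "A \<inter> B \<subseteq> S" by blast
  ultimately show "restriction z S (A \<union> B) + restriction z S (A \<inter> B) \<le> restriction z S A + restriction z S B"
    using submodular_ineq[OF assms(1), of A B] assms(2) by (simp add: restriction_def)
qed (use assms submodular_not_MInf[OF assms(1)] in \<open>auto simp: restriction_def submodular_empty\<close>)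

lemma contraction_apply: "E \<subseteq> I - S \<Longrightarrow> contraction I z S E = z (S \<union> E) - z S"
  by (simp add: contraction_def)

lemma contraction_submodular:
  assumes "z \<in> submodular_functions I" "S \<subseteq> I" "z S < \<infinity>"
  shows "contraction I z S \<in> submodular_functions (I - S)"
proof -
  obtain r where r: "z S = ereal r" using submodular_real[OF assms] .
  show ?thesis
  proof (rule submodular_functionsI)
    show "contraction I z S (I - S) < \<infinity>"
      using submodular_full[OF assms(1)] assms(2) by (cases "z I") (auto simp: contraction_apply r Un_absorb1)
  next
    fix A assume A: "A \<subseteq> I - S"
    then have "z (S \<union> A) \<noteq> - \<infinity>"
      using assms(2) by (intro submodular_not_MInf[OF assms(1)]) auto
    then show "contraction I z S A \<noteq> - \<infinity>"
      using A by (cases "z (S \<union> A)") (auto simp: contraction_apply r)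
  next
    fix A B assume AB: "A \<subseteq> I - S" "B \<subseteq> I - S"
    have "z ((S \<union> A) \<union> (S \<union> B)) + z ((S \<union> A) \<inter> (S \<union> B)) \<le> z (S \<union> A) + z (S \<union> B)"
      using AB assms(2) by (intro submodular_ineq[OF assms(1)]) auto
    also have "(S \<union> A) \<union> (S \<union> B) = S \<union> (A \<union> B)" by blast
    also have "(S \<union> A) \<inter> (S \<union> B) = S \<union> (A \<inter> B)" by blast
    finally have "z (S \<union> (A \<union> B)) + z (S \<union> (A \<inter> B)) \<le> z (S \<union> A) + z (S \<union> B)" .
    moreover have "A \<union> B \<subseteq> I - S" "A \<inter> B \<subseteq> I - S" using AB by auto
    ultimately show "contraction I z S (A \<union> B) + contraction I z S (A \<inter> B)
        \<le> contraction I z S A + contraction I z S B"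
      using AB
      by (simp add: contraction_apply r,
          cases "z (S \<union> (A \<union> B))"; cases "z (S \<union> (A \<inter> B))"; cases "z (S \<union> A)"; cases "z (S \<union> B)")
        auto
  qed (auto simp: contraction_def r)
qed

lemma minor_apply: "A \<subseteq> B \<Longrightarrow> E \<subseteq> B - A \<Longrightarrow> minor z A B E = z (A \<union> E) - z A"
  by (auto simp: minor_def contraction_def restriction_def Un_subset_iff)

lemma minor_extensional: "minor z A B \<in> extensional (Pow (B - A))"
  by (simp add: minor_def contraction_def)

lemma minor_submodular:
  assumes "z \<in> submodular_functions I" "A \<subseteq> B" "B \<subseteq> I" "z A < \<infinity>" "z B < \<infinity>"
  shows "minor z A B \<in> submodular_functions (B - A)"
  unfolding minor_def
  by (rule contraction_submodular[OF restriction_submodular[OF assms(1,3,5)] assms(2)])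
    (use assms in \<open>simp add: restriction_def\<close>)

text \<open>
  A submodular function decomposes as soon as it is additive on the two blocks: for every \<open>E\<close> the
  submodular inequalities of the pairs \<open>E, C\<^sub>1\<close> and \<open>E \<union> C\<^sub>1, C\<^sub>2\<close> add up to the
  inequality opposite to subadditivity.
\<close>

lemma decomposes_iff_additive:
  assumes z: "z \<in> submodular_functions C"
  shows "decomposes z C C\<^sub>1 C\<^sub>2 \<longleftrightarrow> C = C\<^sub>1 \<union> C\<^sub>2 \<and> C\<^sub>1 \<inter> C\<^sub>2 = {} \<and> z C\<^sub>1 + z C\<^sub>2 = z C"
    (is "?L \<longleftrightarrow> ?R")
proof
  assume ?L
  then have C: "C = C\<^sub>1 \<union> C\<^sub>2" "C\<^sub>1 \<inter> C\<^sub>2 = {}" and *: "\<forall>E\<subseteq>C. z E = z (E \<inter> C\<^sub>1) + z (E \<inter> C\<^sub>2)"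
    by (auto simp: decomposes_def)
  have "C \<inter> C\<^sub>1 = C\<^sub>1" "C \<inter> C\<^sub>2 = C\<^sub>2" using C by auto
  with *[rule_format, of C] C show ?R by simp
next
  assume R: ?R
  have "z E = z (E \<inter> C\<^sub>1) + z (E \<inter> C\<^sub>2)" if E: "E \<subseteq> C" for E
  proof -
    have sets: "(E \<inter> C\<^sub>1) \<union> (E \<inter> C\<^sub>2) = E" "(E \<inter> C\<^sub>1) \<inter> (E \<inter> C\<^sub>2) = {}"
      "(E \<union> C\<^sub>1) \<union> C\<^sub>2 = C" "(E \<union> C\<^sub>1) \<inter> C\<^sub>2 = E \<inter> C\<^sub>2"
      using R E by blast+
    have sub: "E \<inter> C\<^sub>1 \<subseteq> C" "E \<inter> C\<^sub>2 \<subseteq> C" "C\<^sub>1 \<subseteq> C" "C\<^sub>2 \<subseteq> C" "E \<union> C\<^sub>1 \<subseteq> C" using E R by auto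
    note ni = submodular_not_MInf[OF z]
    have 1: "z E \<le> z (E \<inter> C\<^sub>1) + z (E \<inter> C\<^sub>2)"
      using submodular_ineq[OF z sub(1,2)] by (simp add: sets submodular_empty[OF z])
    have 2: "z (E \<union> C\<^sub>1) + z (E \<inter> C\<^sub>1) \<le> z E + z C\<^sub>1"
      using submodular_ineq[OF z E sub(3)] .
    have 3: "z C + z (E \<inter> C\<^sub>2) \<le> z (E \<union> C\<^sub>1) + z C\<^sub>2"
      using submodular_ineq[OF z sub(5,4)] by (simp add: sets)
    obtain c where c: "z C = ereal c" using submodular_real[OF z _ submodular_full[OF z]] by blast
    obtain c1 c2 where c12: "z C\<^sub>1 = ereal c1" "z C\<^sub>2 = ereal c2" "c1 + c2 = c"
      using R c ni[OF sub(3)] ni[OF sub(4)] by (cases "z C\<^sub>1"; cases "z C\<^sub>2") auto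
    show ?thesis
    proof (cases "z E")
      case (real e)
      note 2 = 2[unfolded real c12] and 3 = 3[unfolded c c12]
      obtain e1 f where f: "z (E \<inter> C\<^sub>1) = ereal e1" "z (E \<union> C\<^sub>1) = ereal f"
        using 2 ni[OF sub(1)] ni[OF sub(5)] by (cases "z (E \<inter> C\<^sub>1)"; cases "z (E \<union> C\<^sub>1)") auto
      obtain e2 where "z (E \<inter> C\<^sub>2) = ereal e2"
        using 3[unfolded f] ni[OF sub(2)] by (cases "z (E \<inter> C\<^sub>2)") auto
      then show ?thesis using 1 2 3 f real c12(3) by simp
    next
      case PInf
      then show ?thesis using 1 by (simp add: top.extremum_unique flip: top_ereal_def)
    next
      case MInf
      then show ?thesis using ni[OF E] by simp
    qed
  qed
  with R show ?L unfolding decomposes_def by blast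
qed

lemma decomposes_minor_iff:
  assumes z: "z \<in> submodular_functions I" and AB: "A \<subseteq> B" "B \<subseteq> I" "z A < \<infinity>" "z B < \<infinity>"
  shows "decomposes (minor z A B) (B - A) C\<^sub>1 C\<^sub>2 \<longleftrightarrow>
    B - A = C\<^sub>1 \<union> C\<^sub>2 \<and> C\<^sub>1 \<inter> C\<^sub>2 = {} \<and> z (A \<union> C\<^sub>1) + z (A \<union> C\<^sub>2) = z A + z B"
proof (cases "B - A = C\<^sub>1 \<union> C\<^sub>2 \<and> C\<^sub>1 \<inter> C\<^sub>2 = {}")
  case True
  then have C: "C\<^sub>1 \<subseteq> B - A" "C\<^sub>2 \<subseteq> B - A" by auto
  then have "A \<union> C\<^sub>1 \<subseteq> I" "A \<union> C\<^sub>2 \<subseteq> I" using AB by auto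
  note ni = this[THEN submodular_not_MInf[OF z]]
  obtain a where a: "z A = ereal a" using submodular_real[OF z _ AB(3)] AB(1,2) by blast
  obtain b where b: "z B = ereal b" using submodular_real[OF z _ AB(4)] AB(1,2) by blast
  have "A \<union> (B - A) = B" using AB by blast
  then show ?thesis
    using C ni unfolding decomposes_iff_additive[OF minor_submodular[OF z AB]]
    by (cases "z (A \<union> C\<^sub>1)"; cases "z (A \<union> C\<^sub>2)") (auto simp: minor_apply[OF AB(1)] a b)
next
  case False
  then show ?thesis by (auto simp: decomposes_def)
qed

section \<open>Conforming preorders in terms of down-sets\<close>

lemma disconnected_union_iff_down_sets:
  assumes P: "preorder_on I P" and AB: "down_set I P A" "down_set I P B" "A \<subseteq> B"
  shows "disconnected_union P (B - A) C\<^sub>1 C\<^sub>2 \<longleftrightarrow>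
    B - A = C\<^sub>1 \<union> C\<^sub>2 \<and> C\<^sub>1 \<inter> C\<^sub>2 = {} \<and> down_set I P (A \<union> C\<^sub>1) \<and> down_set I P (A \<union> C\<^sub>2)"
    (is "?L \<longleftrightarrow> ?R")
proof
  assume L: ?L
  then have C: "B - A = C\<^sub>1 \<union> C\<^sub>2" "C\<^sub>1 \<inter> C\<^sub>2 = {}" by (auto simp: disconnected_union_def)
  have "down_set I P (A \<union> D)" if "D = C\<^sub>1 \<or> D = C\<^sub>2" for D
  proof -
    have "x \<in> A \<union> D" if y: "y \<in> A \<union> D" and xy: "(x, y) \<in> P" for x y
    proof (cases "y \<in> A")
      case True
      then show ?thesis using down_setD[OF AB(1) _ xy] by blast
    next
      case False
      then have "x \<in> B" using down_setD[OF AB(2) _ xy] C y \<open>D = C\<^sub>1 \<or> D = C\<^sub>2\<close> by blast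
      then show ?thesis
        using L False y xy C \<open>D = C\<^sub>1 \<or> D = C\<^sub>2\<close> unfolding disconnected_union_def by blast
    qed
    moreover have "A \<union> D \<subseteq> I" using down_set_subset[OF AB(2)] AB(3) C that by blast
    ultimately show ?thesis unfolding down_set_def by blast
  qed
  with C show ?R by blast
next
  assume R: ?R
  have "(x, y) \<notin> P \<and> (y, x) \<notin> P" if "x \<in> C\<^sub>1" "y \<in> C\<^sub>2" for x y
    using R that down_setD[of I P "A \<union> C\<^sub>1" x y] down_setD[of I P "A \<union> C\<^sub>2" y x] by blast
  with R show ?L by (auto simp: disconnected_union_def)
qed

lemma compatible_finite: "compatible I P z \<Longrightarrow> down_set I P A \<Longrightarrow> z A < \<infinity>"
  by (simp add: compatible_def)

text \<open>
  Two down-sets \<open>X\<close>, \<open>Y\<close> split \<open>(X \<union> Y) - (X \<inter> Y)\<close> into the disconnected blocks \<open>X - Y\<close> and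
  \<open>Y - X\<close>, and every disconnected convex set arises in this way.
\<close>

lemma compatible_iff:
  assumes z: "z \<in> submodular_functions I" and P: "preorder_on I P"
  shows "compatible I P z \<longleftrightarrow> (\<forall>A. down_set I P A \<longrightarrow> z A < \<infinity>) \<and>
    (\<forall>X Y. down_set I P X \<longrightarrow> down_set I P Y \<longrightarrow> z X + z Y = z (X \<inter> Y) + z (X \<union> Y))"
    (is "_ \<longleftrightarrow> ?fin \<and> ?mod")
proof (cases ?fin)
  case fin: True
  have "(\<forall>A B C\<^sub>1 C\<^sub>2. down_set I P A \<longrightarrow> down_set I P B \<longrightarrow> A \<subseteq> B \<longrightarrow>
        disconnected_union P (B - A) C\<^sub>1 C\<^sub>2 \<longrightarrow> decomposes (minor z A B) (B - A) C\<^sub>1 C\<^sub>2) \<longleftrightarrow> ?mod"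
    (is "?dec \<longleftrightarrow> _")
  proof
    assume dec: ?dec
    show ?mod
    proof (intro allI impI)
      fix X Y assume X: "down_set I P X" and Y: "down_set I P Y"
      define A B where AB: "A = X \<inter> Y" "B = X \<union> Y"
      have d: "down_set I P A" "down_set I P B" "A \<subseteq> B"
        using X Y by (auto simp: AB down_set_Un down_set_Int)
      have C: "A \<union> (X - Y) = X" "A \<union> (Y - X) = Y" "B - A = (X - Y) \<union> (Y - X)" by (auto simp: AB)
      have "disconnected_union P (B - A) (X - Y) (Y - X)"
        unfolding disconnected_union_iff_down_sets[OF P d] using X Y C by auto
      then have "decomposes (minor z A B) (B - A) (X - Y) (Y - X)"
        using dec d by blast
      then show "z X + z Y = z (X \<inter> Y) + z (X \<union> Y)"
        using decomposes_minor_iff[OF z d(3) down_set_subset[OF d(2)]] fin d C by (simp add: AB)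
    qed
  next
    assume mod: ?mod
    show ?dec
    proof (intro allI impI)
      fix A B C\<^sub>1 C\<^sub>2
      assume d: "down_set I P A" "down_set I P B" "A \<subseteq> B" and "disconnected_union P (B - A) C\<^sub>1 C\<^sub>2"
      then have C: "B - A = C\<^sub>1 \<union> C\<^sub>2" "C\<^sub>1 \<inter> C\<^sub>2 = {}" "down_set I P (A \<union> C\<^sub>1)" "down_set I P (A \<union> C\<^sub>2)"
        unfolding disconnected_union_iff_down_sets[OF P d] by auto
      moreover have "(A \<union> C\<^sub>1) \<inter> (A \<union> C\<^sub>2) = A" "(A \<union> C\<^sub>1) \<union> (A \<union> C\<^sub>2) = B" using C d(3) by blast+
      ultimately show "decomposes (minor z A B) (B - A) C\<^sub>1 C\<^sub>2"
        using decomposes_minor_iff[OF z d(3) down_set_subset[OF d(2)]] fin d mod by metis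
    qed
  qed
  then show ?thesis by (simp add: compatible_def)
next
  case False
  then show ?thesis by (auto simp: compatible_def)
qed

lemma compatible_modular:
  "compatible I P z \<Longrightarrow> z \<in> submodular_functions I \<Longrightarrow> preorder_on I P \<Longrightarrow>
     down_set I P X \<Longrightarrow> down_set I P Y \<Longrightarrow> z X + z Y = z (X \<inter> Y) + z (X \<union> Y)"
  by (simp add: compatible_iff)

text \<open>
  Two presentations of the same convex set \<open>C\<close> are compared through the intersection of their lower
  ends: enlarging \<open>A\<^sub>0\<close> to \<open>A\<close> adds elements not comparable to \<open>C\<close>, so the function splits off
  their contribution.
\<close>

lemma minor_eq_of_smaller_base:
  assumes z: "z \<in> submodular_functions I" and P: "preorder_on I P" and c: "compatible I P z"
    and d: "down_set I P A" "down_set I P B" "down_set I P A\<^sub>0" "down_set I P B\<^sub>0"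
    and sub: "A \<subseteq> B" "A\<^sub>0 \<subseteq> B\<^sub>0" "A\<^sub>0 \<subseteq> A" "B\<^sub>0 \<subseteq> B" and C: "B - A = B\<^sub>0 - A\<^sub>0"
  shows "minor z A B = minor z A\<^sub>0 B\<^sub>0"
proof (rule extensional_Pow_eqI[OF minor_extensional minor_extensional[of _ A\<^sub>0 B\<^sub>0, folded C]])
  fix E assume E: "E \<subseteq> B - A"
  note fin = compatible_finite[OF c]
  have sub': "A\<^sub>0 \<subseteq> B" using sub by blast
  have split: "B - A\<^sub>0 = (B - A) \<union> (A - A\<^sub>0)" using sub C by blast
  have un: "A\<^sub>0 \<union> (B - A) = B\<^sub>0" "A\<^sub>0 \<union> A = A" using sub C by blast+
  have io: "B\<^sub>0 \<inter> A = A\<^sub>0" "B\<^sub>0 \<union> A = B" using sub C by blast+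
  have E': "E \<union> (A - A\<^sub>0) \<subseteq> B - A\<^sub>0" "E \<subseteq> B - A\<^sub>0" "A - A\<^sub>0 \<subseteq> B - A\<^sub>0" using E split by blast+
  have "decomposes (minor z A\<^sub>0 B) (B - A\<^sub>0) (B - A) (A - A\<^sub>0)"
    unfolding decomposes_minor_iff[OF z sub' down_set_subset[OF d(2)] fin[OF d(3)] fin[OF d(2)]]
    using split compatible_modular[OF c z P d(4,1)] by (auto simp: un io)
  then have "\<forall>F\<subseteq>B - A\<^sub>0. minor z A\<^sub>0 B F = minor z A\<^sub>0 B (F \<inter> (B - A)) + minor z A\<^sub>0 B (F \<inter> (A - A\<^sub>0))"
    unfolding decomposes_def by blast
  then have "minor z A\<^sub>0 B (E \<union> (A - A\<^sub>0)) =
      minor z A\<^sub>0 B ((E \<union> (A - A\<^sub>0)) \<inter> (B - A)) + minor z A\<^sub>0 B ((E \<union> (A - A\<^sub>0)) \<inter> (A - A\<^sub>0))"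
    using E' by blast
  also have "(E \<union> (A - A\<^sub>0)) \<inter> (B - A) = E" using E by auto
  also have "(E \<union> (A - A\<^sub>0)) \<inter> (A - A\<^sub>0) = A - A\<^sub>0" using E by auto
  finally have "z (A\<^sub>0 \<union> (E \<union> (A - A\<^sub>0))) - z A\<^sub>0 = (z (A\<^sub>0 \<union> E) - z A\<^sub>0) + (z A - z A\<^sub>0)"
    using E' by (simp add: minor_apply[OF sub'] un)
  moreover have "A\<^sub>0 \<union> (E \<union> (A - A\<^sub>0)) = A \<union> E" using sub by blast
  ultimately have *: "z (A \<union> E) - z A\<^sub>0 = (z (A\<^sub>0 \<union> E) - z A\<^sub>0) + (z A - z A\<^sub>0)" by simp
  obtain a where a: "z A = ereal a"
    using submodular_real[OF z down_set_subset[OF d(1)] fin[OF d(1)]] .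
  obtain a0 where a0: "z A\<^sub>0 = ereal a0"
    using submodular_real[OF z down_set_subset[OF d(3)] fin[OF d(3)]] .
  have "z (A \<union> E) - z A = z (A\<^sub>0 \<union> E) - z A\<^sub>0"
    using * unfolding a a0 by (cases "z (A \<union> E)"; cases "z (A\<^sub>0 \<union> E)") auto
  then show "minor z A B E = minor z A\<^sub>0 B\<^sub>0 E"
    using E C by (simp add: minor_apply sub)
qed

text \<open>
  Hence the definite description in \<open>convex_minor\<close> has a unique solution, and the minor of a bubble may
  be computed with any convenient lower end.
\<close>

lemma convex_minor_eq_minor:
  assumes z: "z \<in> submodular_functions I" and P: "preorder_on I P" and c: "compatible I P z"
    and d: "down_set I P A" "down_set I P B" "A \<subseteq> B"
  shows "convex_minor I P z (B - A) = minor z A B"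
  unfolding convex_minor_def
proof (rule the_equality)
  show "\<exists>A' B'. down_set I P A' \<and> down_set I P B' \<and> A' \<subseteq> B' \<and> B - A = B' - A' \<and> minor z A B = minor z A' B'"
    using d by blast
next
  fix f assume "\<exists>A' B'. down_set I P A' \<and> down_set I P B' \<and> A' \<subseteq> B' \<and> B - A = B' - A' \<and> f = minor z A' B'"
  then obtain A' B' where d': "down_set I P A'" "down_set I P B'" "A' \<subseteq> B'" "B - A = B' - A'" "f = minor z A' B'"
    by blast
  have C: "B - A = (B \<inter> B') - (A \<inter> A')" "B' - A' = (B \<inter> B') - (A \<inter> A')" using d d' by blast+
  have "minor z A B = minor z (A \<inter> A') (B \<inter> B')" "minor z A' B' = minor z (A \<inter> A') (B \<inter> B')"
    by (rule minor_eq_of_smaller_base[OF z P c]; use d d' C in \<open>auto intro: down_set_Int\<close>)+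
  with d' show "f = minor z A B" by simp
qed

text \<open>
  Blocks \<open>C\<^sub>1\<close>, \<open>C\<^sub>2\<close> of a convex set \<open>B - A\<close> are encoded by \<open>X = A \<union> C\<^sub>1\<close> and \<open>Y = A \<union> C\<^sub>2\<close>, so that
  \<open>X \<inter> Y = A\<close> and \<open>X \<union> Y = B\<close>.  The union is disconnected iff \<open>X\<close> and \<open>Y\<close> are down-sets, and the
  minor decomposes iff \<open>z\<close> satisfies the modular law at \<open>X\<close>, \<open>Y\<close>; exchanging \<open>X\<close> and \<open>Y\<close> gives
  the conclusion for \<open>Y\<close>.
\<close>

lemma conforms_iff:
  assumes z: "z \<in> submodular_functions I" and P: "preorder_on I P"
  shows "conforms I P z \<longleftrightarrow> (\<forall>A. down_set I P A \<longrightarrow> z A < \<infinity>) \<and>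
    (\<forall>X Y. down_set I P X \<longrightarrow> down_set I P Y \<longrightarrow> z X + z Y = z (X \<inter> Y) + z (X \<union> Y)) \<and>
    (\<forall>X Y. X \<subseteq> I \<longrightarrow> Y \<subseteq> I \<longrightarrow> down_set I P (X \<inter> Y) \<longrightarrow> down_set I P (X \<union> Y) \<longrightarrow>
       z X + z Y = z (X \<inter> Y) + z (X \<union> Y) \<longrightarrow> down_set I P X)"
proof (cases "compatible I P z")
  case c: True
  note fin = compatible_finite[OF c]
  have "(\<forall>C C\<^sub>1 C\<^sub>2. convex_set I P C \<longrightarrow> decomposes (convex_minor I P z C) C C\<^sub>1 C\<^sub>2 \<longrightarrow>
        disconnected_union P C C\<^sub>1 C\<^sub>2) \<longleftrightarrow>
    (\<forall>X Y. X \<subseteq> I \<longrightarrow> Y \<subseteq> I \<longrightarrow> down_set I P (X \<inter> Y) \<longrightarrow> down_set I P (X \<union> Y) \<longrightarrow>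
       z X + z Y = z (X \<inter> Y) + z (X \<union> Y) \<longrightarrow> down_set I P X)" (is "?L \<longleftrightarrow> ?R")
  proof
    assume L: ?L
    show ?R
    proof (intro allI impI)
      fix X Y
      assume d: "down_set I P (X \<inter> Y)" "down_set I P (X \<union> Y)" and eq: "z X + z Y = z (X \<inter> Y) + z (X \<union> Y)"
      define A B where AB: "A = X \<inter> Y" "B = X \<union> Y"
      note d = d[folded AB]
      have sub: "A \<subseteq> B" by (auto simp: AB)
      have C: "A \<union> (X - Y) = X" "A \<union> (Y - X) = Y" "B - A = (X - Y) \<union> (Y - X)" by (auto simp: AB)
      have "decomposes (minor z A B) (B - A) (X - Y) (Y - X)"
        unfolding decomposes_minor_iff[OF z sub down_set_subset[OF d(2)] fin[OF d(1)] fin[OF d(2)]] C(1,2)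
        using eq C(3) unfolding AB by blast
      then have "disconnected_union P (B - A) (X - Y) (Y - X)"
        using L d sub convex_minor_eq_minor[OF z P c d sub] unfolding convex_set_def by metis
      then show "down_set I P X"
        unfolding disconnected_union_iff_down_sets[OF P d sub] by (simp add: C(1))
    qed
  next
    assume R: ?R
    show ?L
    proof (intro allI impI)
      fix C C\<^sub>1 C\<^sub>2 assume "convex_set I P C" and dec: "decomposes (convex_minor I P z C) C C\<^sub>1 C\<^sub>2"
      then obtain A B where d: "down_set I P A" "down_set I P B" "A \<subseteq> B" and C: "C = B - A"
        by (auto simp: convex_set_def)
      have *: "B - A = C\<^sub>1 \<union> C\<^sub>2" "C\<^sub>1 \<inter> C\<^sub>2 = {}" "z (A \<union> C\<^sub>1) + z (A \<union> C\<^sub>2) = z A + z B"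
        using dec unfolding C convex_minor_eq_minor[OF z P c d]
          decomposes_minor_iff[OF z d(3) down_set_subset[OF d(2)] fin[OF d(1)] fin[OF d(2)]]
        by auto
      then have s: "(A \<union> C\<^sub>1) \<inter> (A \<union> C\<^sub>2) = A" "(A \<union> C\<^sub>1) \<union> (A \<union> C\<^sub>2) = B"
        "(A \<union> C\<^sub>2) \<inter> (A \<union> C\<^sub>1) = A" "(A \<union> C\<^sub>2) \<union> (A \<union> C\<^sub>1) = B" using d(3) by blast+
      have I: "A \<union> C\<^sub>1 \<subseteq> I" "A \<union> C\<^sub>2 \<subseteq> I" using s down_set_subset[OF d(2)] by blast+
      have "down_set I P (A \<union> C\<^sub>1)"
        using R[rule_format, OF I] d *(3) by (simp add: s)
      moreover have "down_set I P (A \<union> C\<^sub>2)"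
        using R[rule_format, OF I(2,1)] d *(3) by (simp add: s add.commute)
      ultimately show "disconnected_union P C C\<^sub>1 C\<^sub>2"
        unfolding C disconnected_union_iff_down_sets[OF P d] using * by blast
    qed
  qed
  then show ?thesis using c compatible_iff[OF z P] by (simp add: conforms_def)
next
  case False
  then show ?thesis unfolding conforms_def compatible_iff[OF z P] by blast
qed

lemma PreI:
  assumes "z \<in> submodular_functions I" "preorder_on I P"
    and "\<And>A. down_set I P A \<Longrightarrow> z A < \<infinity>"
    and "\<And>X Y. down_set I P X \<Longrightarrow> down_set I P Y \<Longrightarrow> z X + z Y = z (X \<inter> Y) + z (X \<union> Y)"
    and "\<And>X Y. X \<subseteq> I \<Longrightarrow> Y \<subseteq> I \<Longrightarrow> down_set I P (X \<inter> Y) \<Longrightarrow> down_set I P (X \<union> Y) \<Longrightarrow>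
       z X + z Y = z (X \<inter> Y) + z (X \<union> Y) \<Longrightarrow> down_set I P X"
  shows "P \<in> Pre I z"
proof -
  have "conforms I P z"
    unfolding conforms_iff[OF assms(1,2)] using assms(3-5) by blast
  with assms(2) show ?thesis by (simp add: Pre_def)
qed

lemma Pre_preorder: "P \<in> Pre I z \<Longrightarrow> preorder_on I P"
  by (simp add: Pre_def)

lemma Pre_compatible: "P \<in> Pre I z \<Longrightarrow> compatible I P z"
  by (simp add: Pre_def conforms_def)

lemma Pre_finite: "P \<in> Pre I z \<Longrightarrow> down_set I P A \<Longrightarrow> z A < \<infinity>"
  by (rule compatible_finite[OF Pre_compatible])

lemma Pre_modular:
  "P \<in> Pre I z \<Longrightarrow> z \<in> submodular_functions I \<Longrightarrow> down_set I P X \<Longrightarrow> down_set I P Y \<Longrightarrow>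
     z X + z Y = z (X \<inter> Y) + z (X \<union> Y)"
  by (rule compatible_modular[OF Pre_compatible _ Pre_preorder])

lemma Pre_closed:
  assumes "P \<in> Pre I z" "z \<in> submodular_functions I" "X \<subseteq> I" "Y \<subseteq> I"
    "down_set I P (X \<inter> Y)" "down_set I P (X \<union> Y)" "z X + z Y = z (X \<inter> Y) + z (X \<union> Y)"
  shows "down_set I P X" "down_set I P Y"
proof -
  have "conforms I P z" "preorder_on I P" using assms(1) by (auto simp: Pre_def)
  from this(1)[unfolded conforms_iff[OF assms(2) this(2)]]
  have *: "X \<subseteq> I \<Longrightarrow> Y \<subseteq> I \<Longrightarrow> down_set I P (X \<inter> Y) \<Longrightarrow> down_set I P (X \<union> Y) \<Longrightarrow>
       z X + z Y = z (X \<inter> Y) + z (X \<union> Y) \<Longrightarrow> down_set I P X" for X Y by blast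
  show "down_set I P X" using *[of X Y] assms by blast
  show "down_set I P Y" using *[of Y X] assms by (simp add: ac_simps)
qed

lemma finite_Pre: "finite I \<Longrightarrow> finite (Pre I z)"
  by (rule finite_subset[OF _ finite_preorders[of I]]) (auto simp: Pre_def)

text \<open>
  The modular law of \<open>z\<close> on the down-sets of the smaller preorder \<open>P'\<close> is exactly what conformity of
  \<open>P\<close> turns into the closure hypothesis of \<open>preorder_eq_if_relatively_closed\<close>.
\<close>

lemma Pre_eq_if_same_bubbles:
  assumes "finite I" and z: "z \<in> submodular_functions I" and P: "P \<in> Pre I z" and P': "P' \<in> Pre I z"
    and sub: "P' \<subseteq> P" "P \<inter> P\<inverse> \<subseteq> P'"
  shows "P' = P"
proof (rule preorder_eq_if_relatively_closed[OF \<open>finite I\<close> Pre_preorder[OF P] Pre_preorder[OF P'] sub])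
  fix X Y
  assume d: "down_set I P' X" "down_set I P' Y" "down_set I P (X \<inter> Y)" "down_set I P (X \<union> Y)"
  show "down_set I P Y"
    using Pre_closed(2)[OF P z _ _ d(3,4) Pre_modular[OF P' z d(1,2)]] d by (simp add: down_set_subset)
qed

text \<open>
  If \<open>w \<le> z\<close> agree on the whole set, the down-sets of a preorder conforming to \<open>w\<close> on which
  \<open>w\<close> and \<open>z\<close> agree are those of a preorder conforming to \<open>z\<close>: if \<open>X \<inter> Y\<close> and \<open>X \<union> Y\<close> are among
  them and \<open>z X + z Y = z (X \<inter> Y) + z (X \<union> Y)\<close>, then \<open>w X + w Y \<le> z X + z Y = w (X \<inter> Y) + w (X \<union> Y)\<close>
  and submodularity of \<open>w\<close> force equality everywhere.  When \<open>w\<close> is the function of a face of the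
  polyhedron of \<open>z\<close> and \<open>R\<close> a face of \<open>w\<close>, this is \<open>R\<close> regarded as a face of \<open>z\<close>.
\<close>

definition lift_preorder :: "'i set \<Rightarrow> ('i set \<Rightarrow> ereal) \<Rightarrow> ('i set \<Rightarrow> ereal) \<Rightarrow> 'i rel \<Rightarrow> 'i rel" where
  "lift_preorder I z w R = preorder_of_ring I {A. down_set I R A \<and> z A = w A}"

lemma lift_preorder:
  assumes "finite I" and z: "z \<in> submodular_functions I" and w: "w \<in> submodular_functions I"
    and le: "\<And>A. A \<subseteq> I \<Longrightarrow> w A \<le> z A" and full: "w I = z I" and R: "R \<in> Pre I w"
  shows "lift_preorder I z w R \<in> Pre I z"
    and "down_set I (lift_preorder I z w R) A \<longleftrightarrow> down_set I R A \<and> z A = w A"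
proof -
  have main: "down_set I R X \<and> z X = w X \<and> down_set I R Y \<and> z Y = w Y"
    if XY: "X \<subseteq> I" "Y \<subseteq> I" and d: "down_set I R (X \<inter> Y)" "down_set I R (X \<union> Y)"
      and eq: "z (X \<inter> Y) = w (X \<inter> Y)" "z (X \<union> Y) = w (X \<union> Y)" "z X + z Y = z (X \<inter> Y) + z (X \<union> Y)" for X Y
  proof -
    obtain a b where ab: "w (X \<inter> Y) = ereal a" "w (X \<union> Y) = ereal b"
      using submodular_real[OF w] d Pre_finite[OF R] down_set_subset by metis
    have "z X = w X \<and> z Y = w Y \<and> w X + w Y = w (X \<inter> Y) + w (X \<union> Y)"
      using eq submodular_ineq[OF w XY] le[OF XY(1)] le[OF XY(2)] ab
        submodular_not_MInf[OF w XY(1)] submodular_not_MInf[OF w XY(2)]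
      by (cases "z X"; cases "z Y"; cases "w X"; cases "w Y") auto
    then show ?thesis using Pre_closed[OF R w XY d] by blast
  qed
  define L where "L = {A. down_set I R A \<and> z A = w A}"
  \<comment> \<open>On \<open>L\<close> the function \<open>z\<close> agrees with \<open>w\<close>, which is modular there, and elsewhere it is no smaller.\<close>
  have closed: "A \<union> B \<in> L \<and> A \<inter> B \<in> L \<and> z A + z B = z (A \<inter> B) + z (A \<union> B)"
    if "A \<in> L" "B \<in> L" for A B
  proof -
    have d: "down_set I R A" "down_set I R B" "down_set I R (A \<inter> B)" "down_set I R (A \<union> B)"
      and eq: "z A = w A" "z B = w B"
      using that by (auto simp: L_def down_set_Int down_set_Un)
    note s = d[THEN down_set_subset]
    have fin: "\<exists>r. w C = ereal r" if "down_set I R C" for C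
      using submodular_real[OF w down_set_subset[OF that] Pre_finite[OF R that]] by blast
    obtain a b c e where r: "w A = ereal a" "w B = ereal b" "w (A \<inter> B) = ereal c" "w (A \<union> B) = ereal e"
      using fin d by metis
    have "a + b = c + e" using Pre_modular[OF R w d(1,2)] by (simp add: r)
    then have "z (A \<inter> B) = w (A \<inter> B) \<and> z (A \<union> B) = w (A \<union> B)"
      using submodular_ineq[OF z s(1,2)] le[OF s(3)] le[OF s(4)] eq r
      by (cases "z (A \<inter> B)"; cases "z (A \<union> B)") auto
    then show ?thesis
      using d eq \<open>a + b = c + e\<close> by (simp add: L_def r)
  qed
  have "I \<in> L" "{} \<in> L" "L \<subseteq> Pow I"
    using full down_set_full[OF Pre_preorder[OF R]] submodular_empty[OF z] submodular_empty[OF w]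
    by (auto simp: L_def dest: down_set_subset)
  then have ds: "down_set I (lift_preorder I z w R) A \<longleftrightarrow> A \<in> L" for A
    unfolding lift_preorder_def L_def[symmetric]
    by (intro down_set_preorder_of_ring) (use \<open>finite I\<close> closed in auto)
  then show "down_set I (lift_preorder I z w R) A \<longleftrightarrow> down_set I R A \<and> z A = w A"
    by (simp add: L_def)
  show "lift_preorder I z w R \<in> Pre I z"
  proof (rule PreI[OF z])
    show "preorder_on I (lift_preorder I z w R)"
      by (simp add: lift_preorder_def preorder_on_preorder_of_ring)
    fix A assume "down_set I (lift_preorder I z w R) A"
    then show "z A < \<infinity>" using Pre_finite[OF R] by (simp add: ds L_def)
  next
    fix X Y assume "down_set I (lift_preorder I z w R) X" "down_set I (lift_preorder I z w R) Y"
    then show "z X + z Y = z (X \<inter> Y) + z (X \<union> Y)" using closed unfolding ds by blast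
  next
    fix X Y
    assume "X \<subseteq> I" "Y \<subseteq> I" "down_set I (lift_preorder I z w R) (X \<inter> Y)"
      "down_set I (lift_preorder I z w R) (X \<union> Y)" "z X + z Y = z (X \<inter> Y) + z (X \<union> Y)"
    then show "down_set I (lift_preorder I z w R) X"
      using main[of X Y] unfolding ds L_def mem_Collect_eq by blast
  qed
qed

section \<open>The two functions attached to a conforming preorder\<close>

text \<open>
  The strict down-closure of \<open>C\<close>.  For a bubble \<open>C\<close> it is the least down-set \<open>A\<close> for which \<open>A \<union> C\<close> is
  a down-set too, hence a canonical way to present the bubble as a convex set.
\<close>

definition base :: "'i rel \<Rightarrow> 'i set \<Rightarrow> 'i set" where
  "base P C = {x. x \<notin> C \<and> (\<exists>c\<in>C. (x, c) \<in> P)}"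

lemma bubbles_iff: "C \<in> bubbles I P \<longleftrightarrow> (\<exists>y\<in>I. C = {x. (x, y) \<in> P \<and> (y, x) \<in> P})"
proof -
  have "(P \<inter> P\<inverse>) `` {y} = {x. (x, y) \<in> P \<and> (y, x) \<in> P}" for y by auto
  then show ?thesis by (auto simp: bubbles_def quotient_def)
qed

lemma bubble_exists:
  assumes "preorder_on I P" "y \<in> I"
  obtains C where "C \<in> bubbles I P" "y \<in> C"
  using assms preorder_on_refl[OF assms] by (auto simp: bubbles_iff)

lemma bubble_le:
  assumes P: "preorder_on I P" and C: "C \<in> bubbles I P" "x \<in> C" "y \<in> C"
  shows "(x, y) \<in> P"
  using C preorder_on_trans[OF P] unfolding bubbles_iff by blast

lemma bubble_closed:
  assumes P: "preorder_on I P" and C: "C \<in> bubbles I P" "y \<in> C" "(x, y) \<in> P" "(y, x) \<in> P"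
  shows "x \<in> C"
  using C preorder_on_trans[OF P] unfolding bubbles_iff by blast

lemma bubble_subset: "preorder_on I P \<Longrightarrow> C \<in> bubbles I P \<Longrightarrow> C \<subseteq> I"
  by (auto simp: bubbles_iff dest: preorder_on_subset)

lemma bubble_nonempty: "preorder_on I P \<Longrightarrow> C \<in> bubbles I P \<Longrightarrow> C \<noteq> {}"
  by (auto simp: bubbles_iff dest: preorder_on_refl)

lemma bubbles_disjoint:
  assumes P: "preorder_on I P" and C: "C \<in> bubbles I P" "D \<in> bubbles I P" "x \<in> C" "x \<in> D"
  shows "C = D"
  using bubble_closed[OF P C(1,3)] bubble_closed[OF P C(2,4)] bubble_le[OF P C(1)] bubble_le[OF P C(2)] C
  by blast

lemma finite_bubbles: "finite I \<Longrightarrow> preorder_on I P \<Longrightarrow> finite (bubbles I P)"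
  by (rule finite_subset[of _ "Pow I"]) (auto dest: bubble_subset)

lemma bubble_in_down_set:
  assumes P: "preorder_on I P" and "C \<in> bubbles I P" "down_set I P A" "x \<in> C" "x \<in> A"
  shows "C \<subseteq> A"
  using bubble_le[OF P assms(2)] assms(3-5) by (auto dest: down_setD)

lemma base_disjoint: "base P C \<inter> C = {}"
  by (auto simp: base_def)

lemma down_set_base:
  assumes P: "preorder_on I P" and C: "C \<in> bubbles I P"
  shows "down_set I P (base P C)" "down_set I P (base P C \<union> C)"
proof -
  note tr = preorder_on_trans[OF P] and I = preorder_on_subset[OF P]
  have "x \<in> base P C" if y: "y \<in> base P C" and xy: "(x, y) \<in> P" for x y
  proof -
    obtain c where c: "c \<in> C" "(y, c) \<in> P" "y \<notin> C" using y by (auto simp: base_def)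
    have "x \<notin> C" using bubble_closed[OF P C c(1,2)] tr[OF _ xy] bubble_le[OF P C c(1)] c(3) by blast
    then show ?thesis using c tr[OF xy] by (auto simp: base_def)
  qed
  moreover have "base P C \<subseteq> I" using I by (auto simp: base_def)
  ultimately show "down_set I P (base P C)" by (auto simp: down_set_def)
  then show "down_set I P (base P C \<union> C)"
    using bubble_subset[OF P C] unfolding down_set_def base_def by blast
qed

lemma bubble_diff_down_set:
  assumes P: "preorder_on I P" and C: "C \<in> bubbles I P" and A: "down_set I P A"
    and max: "\<And>y u. y \<in> C \<Longrightarrow> u \<in> A \<Longrightarrow> (y, u) \<in> P \<Longrightarrow> (u, y) \<in> P"
  shows "down_set I P (A - C)"
  unfolding down_set_def
proof (intro conjI allI impI)
  show "A - C \<subseteq> I" using down_set_subset[OF A] by blast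
  fix x u assume u: "u \<in> A - C" "(x, u) \<in> P"
  then have "x \<in> A" using A by (auto dest: down_setD)
  moreover have "x \<notin> C" using max[of x u] u bubble_closed[OF P C] by blast
  ultimately show "x \<in> A - C" by blast
qed

text \<open>
  A nonempty down-set of a finite preorder contains a maximal bubble, namely that of an element with
  the largest number of elements below it; removing it leaves a down-set.
\<close>

lemma down_set_bubble_induct [consumes 3, case_names empty step]:
  assumes "finite I" and P: "preorder_on I P" and "down_set I P B" and "Q {}"
    and step: "\<And>B C. down_set I P B \<Longrightarrow> C \<in> bubbles I P \<Longrightarrow> B \<inter> C = {} \<Longrightarrow> down_set I P (B \<union> C) \<Longrightarrow>
                 Q B \<Longrightarrow> Q (B \<union> C)"
  shows "Q B"
  using \<open>down_set I P B\<close>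
proof (induction "card B" arbitrary: B rule: less_induct)
  case less
  show ?case
  proof (cases "B = {}")
    case False
    have B: "B \<subseteq> I" "finite B"
      using down_set_subset[OF less.prems] \<open>finite I\<close> by (auto intro: finite_subset)
    obtain y0 where y0: "y0 \<in> B" using False by blast
    define f where "f y = card {u. (u, y) \<in> P}" for y
    obtain y where y: "y \<in> B" and max: "\<And>u. u \<in> B \<Longrightarrow> f u \<le> f y"
    proof -
      have "Max (f ` B) \<in> f ` B" using B y0 by (intro Max_in) auto
      then obtain y where "y \<in> B" "f y = Max (f ` B)" by force
      then show ?thesis using that[of y] B by simp
    qed
    have "y \<in> I" using y B by blast
    then obtain C where C: "C \<in> bubbles I P" "y \<in> C" using bubble_exists[OF P] by blast
    have up: "(u, y) \<in> P" if "u \<in> B" "(y, u) \<in> P" for u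
    proof (rule ccontr)
      assume n: "(u, y) \<notin> P"
      have "{v. (v, y) \<in> P} \<subset> {v. (v, u) \<in> P}"
        using n that preorder_on_trans[OF P] preorder_on_refl[OF P, of u] B by blast
      moreover have "finite {v. (v, u) \<in> P}"
        by (rule finite_subset[OF _ \<open>finite I\<close>]) (auto dest: preorder_on_subset[OF P])
      ultimately have "f y < f u" unfolding f_def by (rule psubset_card_mono[rotated])
      then show False using max[OF that(1)] by simp
    qed
    have d: "down_set I P (B - C)"
    proof (rule bubble_diff_down_set[OF P C(1) less.prems])
      fix c u assume *: "c \<in> C" "u \<in> B" "(c, u) \<in> P"
      then have "(y, u) \<in> P" "(y, c) \<in> P"
        using bubble_le[OF P C(1) C(2) *(1)] preorder_on_trans[OF P] by blast+
      then show "(u, c) \<in> P" using up[OF *(2)] preorder_on_trans[OF P] by blast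
    qed
    have "C \<subseteq> B" using bubble_in_down_set[OF P C(1) less.prems C(2) y] .
    then have un: "(B - C) \<union> C = B" by blast
    have "card (B - C) < card B" using B y C by (intro psubset_card_mono) auto
    then have "Q (B - C)" using less.hyps d by blast
    then show ?thesis using step[OF d C(1)] less.prems by (simp only: un Diff_disjoint Int_commute)
  qed (use \<open>Q {}\<close> in simp)
qed

lemma convex_minor_apply:
  assumes z: "z \<in> submodular_functions I" and P: "P \<in> Pre I z"
    and d: "down_set I P A" "down_set I P (A \<union> C)" "A \<inter> C = {}" and E: "E \<subseteq> C"
  shows "convex_minor I P z C E = z (A \<union> E) - z A"
proof -
  have C: "(A \<union> C) - A = C" using d(3) by blast
  have "convex_minor I P z ((A \<union> C) - A) E = minor z A (A \<union> C) E"
    by (subst convex_minor_eq_minor[OF z Pre_preorder[OF P] Pre_compatible[OF P]]) (use d in auto)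
  then show ?thesis using E d(3) by (simp add: C minor_apply)
qed

lemmas convex_minor_bubble =
  convex_minor_apply[OF _ _ down_set_base[OF Pre_preorder] base_disjoint]

lemma convex_minor_submodular:
  assumes z: "z \<in> submodular_functions I" and P: "P \<in> Pre I z" and C: "C \<in> bubbles I P"
  shows "convex_minor I P z C \<in> submodular_functions C"
proof -
  have d: "down_set I P (base P C)" "down_set I P (base P C \<union> C)" "(base P C \<union> C) - base P C = C"
    using down_set_base[OF Pre_preorder[OF P] C] base_disjoint[of P C] by auto
  have "minor z (base P C) (base P C \<union> C) \<in> submodular_functions ((base P C \<union> C) - base P C)"
    by (rule minor_submodular[OF z Un_upper1 down_set_subset[OF d(2)] Pre_finite[OF P d(1)] Pre_finite[OF P d(2)]])
  then show ?thesis
    using convex_minor_eq_minor[OF z Pre_preorder[OF P] Pre_compatible[OF P] d(1,2)] by (simp add: d(3))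
qed

lemma lower_apply: "E \<subseteq> I \<Longrightarrow> lower I P z E = (\<Sum>C\<in>bubbles I P. convex_minor I P z C (E \<inter> C))"
  by (simp add: lower_def)

lemma sum_not_MInf:
  fixes f :: "'a \<Rightarrow> ereal"
  shows "(\<And>i. i \<in> A \<Longrightarrow> f i \<noteq> - \<infinity>) \<Longrightarrow> sum f A \<noteq> - \<infinity>"
  by (induction A rule: infinite_finite_induct) auto

lemma lower_less_PInf_iff:
  assumes "finite I" "preorder_on I P" "E \<subseteq> I"
  shows "lower I P z E < \<infinity> \<longleftrightarrow> (\<forall>C\<in>bubbles I P. convex_minor I P z C (E \<inter> C) < \<infinity>)"
  using finite_bubbles[OF assms(1,2)] by (simp add: lower_apply[OF assms(3)] sum_Pinfty)

lemma lower_submodular: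
  assumes "finite I" and z: "z \<in> submodular_functions I" and P: "P \<in> Pre I z"
  shows "lower I P z \<in> submodular_functions I"
proof (rule submodular_functionsI)
  note cm = convex_minor_submodular[OF z P]
  note sub = bubble_subset[OF Pre_preorder[OF P]]
  show "lower I P z {} = 0" using submodular_empty[OF cm] by (simp add: lower_apply)
  show "lower I P z I < \<infinity>"
    unfolding lower_less_PInf_iff[OF \<open>finite I\<close> Pre_preorder[OF P] subset_refl]
    using submodular_full[OF cm] sub by (simp add: Int_absorb1)
  fix A assume A: "A \<subseteq> I"
  show "lower I P z A \<noteq> - \<infinity>"
    unfolding lower_apply[OF A] using submodular_not_MInf[OF cm] by (intro sum_not_MInf) auto
  fix B assume B: "B \<subseteq> I"
  have "(\<Sum>C\<in>bubbles I P. convex_minor I P z C ((A \<union> B) \<inter> C) + convex_minor I P z C ((A \<inter> B) \<inter> C))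
      \<le> (\<Sum>C\<in>bubbles I P. convex_minor I P z C (A \<inter> C) + convex_minor I P z C (B \<inter> C))"
  proof (rule sum_mono)
    fix C assume C: "C \<in> bubbles I P"
    have "(A \<union> B) \<inter> C = (A \<inter> C) \<union> (B \<inter> C)" "(A \<inter> B) \<inter> C = (A \<inter> C) \<inter> (B \<inter> C)" by auto
    then show "convex_minor I P z C ((A \<union> B) \<inter> C) + convex_minor I P z C ((A \<inter> B) \<inter> C)
        \<le> convex_minor I P z C (A \<inter> C) + convex_minor I P z C (B \<inter> C)"
      using submodular_ineq[OF cm[OF C], of "A \<inter> C" "B \<inter> C"] by simp
  qed
  moreover have "A \<union> B \<subseteq> I" "A \<inter> B \<subseteq> I" using A B by auto
  ultimately show "lower I P z (A \<union> B) + lower I P z (A \<inter> B) \<le> lower I P z A + lower I P z B"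
    using A B by (simp add: lower_apply sum.distrib)
qed (simp add: lower_def)

lemma convex_minor_less_PInf_iff:
  assumes z: "z \<in> submodular_functions I" and P: "P \<in> Pre I z" and C: "C \<in> bubbles I P" and E: "E \<subseteq> C"
  shows "convex_minor I P z C E < \<infinity> \<longleftrightarrow> z (base P C \<union> E) < \<infinity>"
proof -
  have d: "down_set I P (base P C)" using down_set_base[OF Pre_preorder[OF P] C] by auto
  obtain r where r: "z (base P C) = ereal r"
    using submodular_real[OF z down_set_subset[OF d] Pre_finite[OF P d]] .
  show ?thesis
    unfolding convex_minor_bubble[OF z P P C P C E] r by (cases "z (base P C \<union> E)") auto
qed

text \<open>
  The minor at a bubble differs from \<open>z\<close> by the constant \<open>z (base P C)\<close>, which is finite and cancels.
\<close>

lemma convex_minor_additive: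
  assumes z: "z \<in> submodular_functions I" and P: "P \<in> Pre I z" and C: "C \<in> bubbles I P"
    and XY: "X \<subseteq> C" "Y \<subseteq> C" "U \<subseteq> C" "V \<subseteq> C"
  shows "convex_minor I P z C X + convex_minor I P z C Y = convex_minor I P z C U + convex_minor I P z C V
    \<longleftrightarrow> z (base P C \<union> X) + z (base P C \<union> Y) = z (base P C \<union> U) + z (base P C \<union> V)"
proof -
  have d: "down_set I P (base P C)" using down_set_base[OF Pre_preorder[OF P] C] by auto
  obtain r where r: "z (base P C) = ereal r"
    using submodular_real[OF z down_set_subset[OF d] Pre_finite[OF P d]] .
  have "base P C \<union> D \<subseteq> I" if "D \<subseteq> C" for D
    using down_set_subset[OF d] bubble_subset[OF Pre_preorder[OF P] C] that by blast
  then have ni: "z (base P C \<union> D) \<noteq> - \<infinity>" if "D \<subseteq> C" for D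
    using submodular_not_MInf[OF z] that by blast
  show ?thesis
    using ni[OF XY(1)] ni[OF XY(2)] ni[OF XY(3)] ni[OF XY(4)]
    unfolding convex_minor_bubble[OF z P P C P C XY(1)] convex_minor_bubble[OF z P P C P C XY(2)]
      convex_minor_bubble[OF z P P C P C XY(3)] convex_minor_bubble[OF z P P C P C XY(4)] r
    by (cases "z (base P C \<union> X)"; cases "z (base P C \<union> Y)";
        cases "z (base P C \<union> U)"; cases "z (base P C \<union> V)") auto
qed

lemma lower_modular:
  assumes "finite I" and z: "z \<in> modular_functions I" and P: "P \<in> Pre I z"
  shows "lower I P z \<in> modular_functions I"
proof (rule modular_functionsI)
  note zs = modular_imp_submodular[OF z]
  show "lower I P z \<in> submodular_functions I" using lower_submodular[OF \<open>finite I\<close> zs P] .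
  fix A B assume A: "A \<subseteq> I" and B: "B \<subseteq> I" and fin: "lower I P z A < \<infinity>" "lower I P z B < \<infinity>"
  have "(\<Sum>C\<in>bubbles I P. convex_minor I P z C ((A \<union> B) \<inter> C) + convex_minor I P z C ((A \<inter> B) \<inter> C))
      = (\<Sum>C\<in>bubbles I P. convex_minor I P z C (A \<inter> C) + convex_minor I P z C (B \<inter> C))"
  proof (rule sum.cong)
    fix C assume C: "C \<in> bubbles I P"
    let ?b = "base P C"
    have d: "?b \<subseteq> I" "C \<subseteq> I" using down_set_base[OF Pre_preorder[OF P] C] by (auto dest: down_set_subset)
    have "convex_minor I P z C (A \<inter> C) < \<infinity>" "convex_minor I P z C (B \<inter> C) < \<infinity>"
      using fin C unfolding lower_less_PInf_iff[OF \<open>finite I\<close> Pre_preorder[OF P] A]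
        lower_less_PInf_iff[OF \<open>finite I\<close> Pre_preorder[OF P] B] by auto
    then have "z (?b \<union> (A \<inter> C)) < \<infinity>" "z (?b \<union> (B \<inter> C)) < \<infinity>"
      by (simp_all only: convex_minor_less_PInf_iff[OF zs P C Int_lower2])
    then have "z ((?b \<union> (A \<inter> C)) \<union> (?b \<union> (B \<inter> C))) + z ((?b \<union> (A \<inter> C)) \<inter> (?b \<union> (B \<inter> C)))
        = z (?b \<union> (A \<inter> C)) + z (?b \<union> (B \<inter> C))"
      using d by (intro modular_eq[OF z]) auto
    moreover have "(?b \<union> (A \<inter> C)) \<union> (?b \<union> (B \<inter> C)) = ?b \<union> ((A \<union> B) \<inter> C)"
      "(?b \<union> (A \<inter> C)) \<inter> (?b \<union> (B \<inter> C)) = ?b \<union> ((A \<inter> B) \<inter> C)" by auto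
    ultimately show "convex_minor I P z C ((A \<union> B) \<inter> C) + convex_minor I P z C ((A \<inter> B) \<inter> C)
      = convex_minor I P z C (A \<inter> C) + convex_minor I P z C (B \<inter> C)"
      by (subst convex_minor_additive[OF zs P C]) auto
  qed simp
  moreover have "A \<union> B \<subseteq> I" "A \<inter> B \<subseteq> I" using A B by auto
  ultimately show "lower I P z (A \<union> B) + lower I P z (A \<inter> B) = lower I P z A + lower I P z B"
    using A B by (simp add: lower_apply sum.distrib)
qed

text \<open>
  Adding the bubbles one after the other, from the bottom up, the minor at each bubble is at most
  the increment of \<open>z\<close> on the trace of \<open>E\<close>, by submodularity; on down-sets of a finer conforming
  preorder \<open>z\<close> is modular and no inequality is lost.
\<close>

lemma lower_le_aux:
  assumes "finite I" and z: "z \<in> submodular_functions I" and P: "P \<in> Pre I z" and E: "E \<subseteq> I"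
    and B: "down_set I P B"
  shows "(\<Sum>C\<in>{C \<in> bubbles I P. C \<subseteq> B}. convex_minor I P z C (E \<inter> C)) \<le> z (E \<inter> B) \<and>
    (P' \<in> Pre I z \<longrightarrow> P' \<subseteq> P \<longrightarrow> down_set I P' E \<longrightarrow>
      (\<Sum>C\<in>{C \<in> bubbles I P. C \<subseteq> B}. convex_minor I P z C (E \<inter> C)) = z (E \<inter> B))"
  using \<open>finite I\<close> Pre_preorder[OF P] B
proof (induction rule: down_set_bubble_induct)
  case empty
  have "{C \<in> bubbles I P. C \<subseteq> {}} = {}" using bubble_nonempty[OF Pre_preorder[OF P]] by auto
  then show ?case by (simp only: sum.empty Int_empty_right submodular_empty[OF z]) simp
next
  case (step B C)
  let ?f = "\<lambda>C. convex_minor I P z C (E \<inter> C)"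
  note pre = Pre_preorder[OF P]
  have "{D \<in> bubbles I P. D \<subseteq> B \<union> C} = insert C {D \<in> bubbles I P. D \<subseteq> B}"
  proof -
    have "D \<subseteq> B" if D: "D \<in> bubbles I P" "D \<subseteq> B \<union> C" "D \<noteq> C" for D
      using bubbles_disjoint[OF pre D(1) step.hyps(2)] D by blast
    then show ?thesis using step.hyps(2) by auto
  qed
  moreover have "C \<notin> {D \<in> bubbles I P. D \<subseteq> B}"
    using bubble_nonempty[OF pre step.hyps(2)] step.hyps(3) by blast
  ultimately have sum: "(\<Sum>D\<in>{D \<in> bubbles I P. D \<subseteq> B \<union> C}. ?f D) = ?f C + (\<Sum>D\<in>{D \<in> bubbles I P. D \<subseteq> B}. ?f D)"
    using finite_bubbles[OF \<open>finite I\<close> pre] by simp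
  have sub: "B \<union> (E \<inter> C) \<subseteq> I" "E \<inter> (B \<union> C) \<subseteq> I" "E \<inter> B \<subseteq> I" "B \<subseteq> I"
    using down_set_subset[OF step.hyps(4)] E by auto
  have fC: "?f C = z (B \<union> (E \<inter> C)) - z B"
    by (rule convex_minor_apply[OF z P step.hyps(1,4,3)]) simp
  obtain b where b: "z B = ereal b"
    using submodular_real[OF z sub(4) Pre_finite[OF P step.hyps(1)]] .
  have un: "B \<union> (E \<inter> (B \<union> C)) = B \<union> (E \<inter> C)" and int: "B \<inter> (E \<inter> (B \<union> C)) = E \<inter> B" by auto
  have "z (B \<union> (E \<inter> C)) + z (E \<inter> B) \<le> z B + z (E \<inter> (B \<union> C))"
    using submodular_ineq[OF z sub(4,2)] by (simp only: un int)
  then have 1: "?f C + z (E \<inter> B) \<le> z (E \<inter> (B \<union> C))"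
    unfolding fC b using submodular_not_MInf[OF z sub(1)] submodular_not_MInf[OF z sub(3)]
    by (cases "z (B \<union> (E \<inter> C))"; cases "z (E \<inter> B)"; cases "z (E \<inter> (B \<union> C))") auto
  have 2: "?f C + z (E \<inter> B) = z (E \<inter> (B \<union> C))"
    if P': "P' \<in> Pre I z" "P' \<subseteq> P" and E': "down_set I P' E"
  proof -
    have d: "down_set I P' B" "down_set I P' (E \<inter> (B \<union> C))"
      using step.hyps E' down_set_anti_mono[OF P'(2)] by (auto intro: down_set_Int)
    then have d': "down_set I P' (E \<inter> B)" using E' by (auto intro: down_set_Int)
    have "z B + z (E \<inter> (B \<union> C)) = z (E \<inter> B) + z (B \<union> (E \<inter> C))"
      using Pre_modular[OF P'(1) z d] by (simp only: un int)
    then show ?thesis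
      unfolding fC b using submodular_real[OF z down_set_subset[OF d'] Pre_finite[OF P'(1) d']]
        submodular_real[OF z down_set_subset[OF d(2)] Pre_finite[OF P'(1) d(2)]]
      by (cases "z (B \<union> (E \<inter> C))"; cases "z (E \<inter> B)"; cases "z (E \<inter> (B \<union> C))") auto
  qed
  show ?case
    unfolding sum
  proof (intro conjI impI)
    show "?f C + (\<Sum>D\<in>{D \<in> bubbles I P. D \<subseteq> B}. ?f D) \<le> z (E \<inter> (B \<union> C))"
      using step.IH by (intro order_trans[OF add_left_mono 1]) blast
    assume P': "P' \<in> Pre I z" "P' \<subseteq> P" "down_set I P' E"
    then have eq: "(\<Sum>D\<in>{D \<in> bubbles I P. D \<subseteq> B}. ?f D) = z (E \<inter> B)" using step.IH by blast
    show "?f C + (\<Sum>D\<in>{D \<in> bubbles I P. D \<subseteq> B}. ?f D) = z (E \<inter> (B \<union> C))"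
      unfolding eq by (rule 2[OF P'])
  qed
qed

lemma bubbles_all: "preorder_on I P \<Longrightarrow> {C \<in> bubbles I P. C \<subseteq> I} = bubbles I P"
  by (auto dest: bubble_subset)

text \<open>
  Geometrically: the face of \<open>P\<close> is contained in the polyhedron of \<open>z\<close>.
\<close>

lemma lower_le:
  assumes "finite I" and z: "z \<in> submodular_functions I" and P: "P \<in> Pre I z" and E: "E \<subseteq> I"
  shows "lower I P z E \<le> z E"
  using lower_le_aux[OF assms down_set_full[OF Pre_preorder[OF P]]] E
  by (simp add: bubbles_all[OF Pre_preorder[OF P]] lower_apply Int_absorb2)

text \<open>
  Down-sets of a finer conforming \<open>P'\<close> are tight on the face of \<open>P'\<close>, which lies in that of \<open>P\<close>.
\<close>

lemma lower_eq_on_down_set: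
  assumes "finite I" and z: "z \<in> submodular_functions I" and P: "P \<in> Pre I z"
    and P': "P' \<in> Pre I z" "P' \<subseteq> P" "down_set I P' E"
  shows "lower I P z E = z E"
  using lower_le_aux[OF assms(1-3) down_set_subset[OF P'(3)] down_set_full[OF Pre_preorder[OF P]], of P']
    P' down_set_subset[OF P'(3)]
  by (simp add: bubbles_all[OF Pre_preorder[OF P]] lower_apply Int_absorb2)

lemma lower_full:
  assumes "finite I" and z: "z \<in> submodular_functions I" and P: "P \<in> Pre I z"
  shows "lower I P z I = z I"
  using lower_eq_on_down_set[OF assms P] down_set_full[OF Pre_preorder[OF P]] by blast

lemma upper_apply: "E \<subseteq> I \<Longrightarrow> upper I P z E = (if down_set I P E then z E else \<infinity>)"
  by (simp add: upper_def)

lemma upper_modular: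
  assumes z: "z \<in> submodular_functions I" and P: "P \<in> Pre I z"
  shows "upper I P z \<in> modular_functions I"
proof -
  have "upper I P z A \<noteq> - \<infinity>" if "A \<subseteq> I" for A
    using submodular_not_MInf[OF z that] that by (simp add: upper_apply)
  then have "upper I P z \<in> set_functions I"
    using submodular_empty[OF z] submodular_full[OF z] down_set_full[OF Pre_preorder[OF P]]
    by (auto simp: set_functions_def PiE_iff upper_def)
  moreover have "upper I P z (A \<union> B) + upper I P z (A \<inter> B) = upper I P z A + upper I P z B"
    if A: "A \<subseteq> I" "upper I P z A < \<infinity>" and B: "B \<subseteq> I" "upper I P z B < \<infinity>" for A B
  proof -
    have d: "down_set I P A" "down_set I P B" using A B by (auto simp: upper_apply split: if_splits)
    then have "down_set I P (A \<union> B)" "down_set I P (A \<inter> B)" by (auto intro: down_set_Un down_set_Int)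
    then show ?thesis
      using d Pre_modular[OF P z d] by (simp add: upper_apply down_set_subset add.commute)
  qed
  ultimately show ?thesis by (simp add: modular_functions_def)
qed

text \<open>
  Since \<open>z\<^sup>P\<close> is finite exactly on the down-sets of \<open>P\<close> and modular there, conformity to \<open>z\<^sup>P\<close> depends
  on \<open>P\<close> alone: \<open>Q\<close> coarsens \<open>P\<close> in such a way that convex sets of \<open>Q\<close> disconnected in \<open>P\<close> are
  disconnected in \<open>Q\<close>.
\<close>

lemma Pre_upper_iff:
  assumes z: "z \<in> submodular_functions I" and P: "P \<in> Pre I z"
  shows "Q \<in> Pre I (upper I P z) \<longleftrightarrow> preorder_on I Q \<and> P \<subseteq> Q \<and>
    (\<forall>X Y. down_set I P X \<longrightarrow> down_set I P Y \<longrightarrow> down_set I Q (X \<inter> Y) \<longrightarrow> down_set I Q (X \<union> Y) \<longrightarrow>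
      down_set I Q X)" (is "?L \<longleftrightarrow> ?R")
proof
  note u = modular_imp_submodular[OF upper_modular[OF z P]]
  assume L: ?L
  have Q: "preorder_on I Q" by (rule Pre_preorder[OF L])
  have *: "down_set I P A" if "down_set I Q A" for A
    using Pre_finite[OF L that] down_set_subset[OF that] by (auto simp: upper_apply split: if_splits)
  then have sub: "P \<subseteq> Q" by (rule preorder_subsetI[OF Pre_preorder[OF P] Q])
  have "down_set I Q X"
    if d: "down_set I P X" "down_set I P Y" "down_set I Q (X \<inter> Y)" "down_set I Q (X \<union> Y)" for X Y
    by (rule Pre_closed(1)[OF L u _ _ d(3,4)])
      (use d Pre_modular[OF P z d(1,2)] in \<open>simp_all add: upper_apply down_set_subset *\<close>)
  then show ?R using Q sub by blast
next
  note u = upper_modular[OF z P]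
  assume R: ?R
  then have d: "down_set I P A" if "down_set I Q A" for A using that by (auto intro: down_set_anti_mono)
  have fin: "upper I P z A < \<infinity>" if "down_set I Q A" for A
    using d[OF that] Pre_finite[OF P] by (simp add: upper_apply down_set_subset)
  show ?L
  proof (rule PreI[OF modular_imp_submodular[OF u]])
    fix X Y assume "down_set I Q X" "down_set I Q Y"
    then show "upper I P z X + upper I P z Y = upper I P z (X \<inter> Y) + upper I P z (X \<union> Y)"
      using modular_eq[OF u, of X Y] fin by (simp add: down_set_subset add.commute)
  next
    fix X Y assume X: "X \<subseteq> I" "Y \<subseteq> I" and dQ: "down_set I Q (X \<inter> Y)" "down_set I Q (X \<union> Y)"
      and eq: "upper I P z X + upper I P z Y = upper I P z (X \<inter> Y) + upper I P z (X \<union> Y)"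
    have "upper I P z (X \<inter> Y) + upper I P z (X \<union> Y) < \<infinity>"
      using fin[OF dQ(1)] fin[OF dQ(2)] by simp
    then have "upper I P z X < \<infinity>" "upper I P z Y < \<infinity>"
      unfolding eq[symmetric] using submodular_not_MInf[OF modular_imp_submodular[OF u] X(1)]
        submodular_not_MInf[OF modular_imp_submodular[OF u] X(2)] by auto
    then have "down_set I P X" "down_set I P Y" using X by (auto simp: upper_apply split: if_splits)
    then show "down_set I Q X" using R dQ by blast
  qed (use R fin in auto)
qed

section \<open>Splitting along a down-set\<close>

lemma preorder_on_Restr: "preorder_on I Q \<Longrightarrow> S \<subseteq> I \<Longrightarrow> preorder_on S (Restr Q S)"
  by (auto simp: preorder_on_def refl_on_def intro: trans_Restr)

lemma down_set_Restr_iff: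
  "down_set I Q S \<Longrightarrow> down_set S (Restr Q S) A \<longleftrightarrow> A \<subseteq> S \<and> down_set I Q A"
  unfolding down_set_def by blast

lemma down_set_Restr_complement_iff:
  "preorder_on I Q \<Longrightarrow> down_set I Q S \<Longrightarrow>
    down_set (I - S) (Restr Q (I - S)) A \<longleftrightarrow> A \<subseteq> I - S \<and> down_set I Q (S \<union> A)"
  using preorder_on_subset[of I Q] unfolding down_set_def by blast

lemma restriction_apply: "E \<subseteq> S \<Longrightarrow> restriction z S E = z E"
  by (simp add: restriction_def)

lemma Pre_Restr:
  assumes z: "z \<in> submodular_functions I" and Q: "Q \<in> Pre I z" and S: "down_set I Q S"
  shows "Restr Q S \<in> Pre S (restriction z S)"
proof (rule PreI)
  note sub = down_set_subset[OF S] and d = down_set_Restr_iff[OF S]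
  show "restriction z S \<in> submodular_functions S"
    using restriction_submodular[OF z sub Pre_finite[OF Q S]] .
  show "preorder_on S (Restr Q S)" using preorder_on_Restr[OF Pre_preorder[OF Q] sub] .
  fix X
  show "restriction z S X < \<infinity>" if "down_set S (Restr Q S) X"
    using that Pre_finite[OF Q, of X] unfolding d by (simp only: restriction_apply)
  fix Y
  show "restriction z S X + restriction z S Y = restriction z S (X \<inter> Y) + restriction z S (X \<union> Y)"
    if "down_set S (Restr Q S) X" "down_set S (Restr Q S) Y"
    using that Pre_modular[OF Q z, of X Y] unfolding d by (simp add: restriction_apply le_infI1)
  show "down_set S (Restr Q S) X"
    if "X \<subseteq> S" "Y \<subseteq> S" "down_set S (Restr Q S) (X \<inter> Y)" "down_set S (Restr Q S) (X \<union> Y)"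
      "restriction z S X + restriction z S Y = restriction z S (X \<inter> Y) + restriction z S (X \<union> Y)"
    using that Pre_closed(1)[OF Q z, of X Y] sub unfolding d
    by (simp add: restriction_apply le_infI1)
qed

text \<open>
  As for minors, the constant \<open>z S\<close> cancels on both sides.
\<close>

lemma contraction_additive:
  assumes z: "z \<in> submodular_functions I" and S: "S \<subseteq> I" "z S < \<infinity>"
    and XY: "X \<subseteq> I - S" "Y \<subseteq> I - S" "U \<subseteq> I - S" "V \<subseteq> I - S"
  shows "contraction I z S X + contraction I z S Y = contraction I z S U + contraction I z S V
    \<longleftrightarrow> z (S \<union> X) + z (S \<union> Y) = z (S \<union> U) + z (S \<union> V)"
proof -
  obtain r where r: "z S = ereal r" using submodular_real[OF z S] .
  have ni: "z (S \<union> D) \<noteq> - \<infinity>" if "D \<subseteq> I - S" for D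
    using submodular_not_MInf[OF z, of "S \<union> D"] that S(1) by blast
  show ?thesis
    using ni[OF XY(1)] ni[OF XY(2)] ni[OF XY(3)] ni[OF XY(4)]
    unfolding contraction_apply[OF XY(1)] contraction_apply[OF XY(2)] contraction_apply[OF XY(3)]
      contraction_apply[OF XY(4)] r
    by (cases "z (S \<union> X)"; cases "z (S \<union> Y)"; cases "z (S \<union> U)"; cases "z (S \<union> V)") auto
qed

lemma contraction_less_PInf_iff:
  assumes z: "z \<in> submodular_functions I" and S: "S \<subseteq> I" "z S < \<infinity>" and X: "X \<subseteq> I - S"
  shows "contraction I z S X < \<infinity> \<longleftrightarrow> z (S \<union> X) < \<infinity>"
proof -
  obtain r where r: "z S = ereal r" using submodular_real[OF z S] .
  show ?thesis unfolding contraction_apply[OF X] r by (cases "z (S \<union> X)") auto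
qed

lemma Pre_Restr_complement:
  assumes z: "z \<in> submodular_functions I" and Q: "Q \<in> Pre I z" and S: "down_set I Q S"
  shows "Restr Q (I - S) \<in> Pre (I - S) (contraction I z S)"
proof (rule PreI)
  note sub = down_set_subset[OF S] and d = down_set_Restr_complement_iff[OF Pre_preorder[OF Q] S]
  note fin = Pre_finite[OF Q S]
  show "contraction I z S \<in> submodular_functions (I - S)"
    using contraction_submodular[OF z sub fin] .
  show "preorder_on (I - S) (Restr Q (I - S))" using preorder_on_Restr[OF Pre_preorder[OF Q]] by blast
  fix X
  show "contraction I z S X < \<infinity>" if "down_set (I - S) (Restr Q (I - S)) X"
    using that Pre_finite[OF Q, of "S \<union> X"] contraction_less_PInf_iff[OF z sub fin] unfolding d by blast
  fix Y
  have un: "(S \<union> X) \<union> (S \<union> Y) = S \<union> (X \<union> Y)" and int: "(S \<union> X) \<inter> (S \<union> Y) = S \<union> (X \<inter> Y)" by auto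
  have iff: "contraction I z S X + contraction I z S Y = contraction I z S (X \<inter> Y) + contraction I z S (X \<union> Y)
    \<longleftrightarrow> z (S \<union> X) + z (S \<union> Y) = z (S \<union> (X \<inter> Y)) + z (S \<union> (X \<union> Y))"
    if "X \<subseteq> I - S" "Y \<subseteq> I - S"
    by (rule contraction_additive[OF z sub fin]) (use that in auto)
  show "contraction I z S X + contraction I z S Y = contraction I z S (X \<inter> Y) + contraction I z S (X \<union> Y)"
    if "down_set (I - S) (Restr Q (I - S)) X" "down_set (I - S) (Restr Q (I - S)) Y"
    using that Pre_modular[OF Q z, of "S \<union> X" "S \<union> Y"] iff unfolding d un int by blast
  show "down_set (I - S) (Restr Q (I - S)) X"
    if "X \<subseteq> I - S" "Y \<subseteq> I - S" "down_set (I - S) (Restr Q (I - S)) (X \<inter> Y)"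
      "down_set (I - S) (Restr Q (I - S)) (X \<union> Y)"
      "contraction I z S X + contraction I z S Y = contraction I z S (X \<inter> Y) + contraction I z S (X \<union> Y)"
    using that(3-5) Pre_closed(1)[OF Q z, of "S \<union> X" "S \<union> Y"] sub that(1,2)
    unfolding d un int iff[OF that(1,2)] by blast
qed

lemma set_prod_apply: "E \<subseteq> S \<union> T \<Longrightarrow> set_prod S T u v E = u (E \<inter> S) + v (E \<inter> T)"
  by (simp add: set_prod_def)

lemma trace_Un_Int: "(A \<union> B) \<inter> S = (A \<inter> S) \<union> (B \<inter> S)" "(A \<inter> B) \<inter> S = (A \<inter> S) \<inter> (B \<inter> S)"
  by auto

lemma set_prod_submodular:
  assumes u: "u \<in> submodular_functions S" and v: "v \<in> submodular_functions T"
  shows "set_prod S T u v \<in> submodular_functions (S \<union> T)"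
proof (rule submodular_functionsI)
  show "set_prod S T u v (S \<union> T) < \<infinity>"
    using submodular_full[OF u] submodular_full[OF v]
    by (simp add: set_prod_apply Int_absorb1)
  show "set_prod S T u v A \<noteq> - \<infinity>" if "A \<subseteq> S \<union> T" for A
    using submodular_not_MInf[OF u, of "A \<inter> S"] submodular_not_MInf[OF v, of "A \<inter> T"]
    by (simp add: set_prod_apply that)
  fix A B assume AB: "A \<subseteq> S \<union> T" "B \<subseteq> S \<union> T"
  have "u ((A \<union> B) \<inter> S) + u ((A \<inter> B) \<inter> S) \<le> u (A \<inter> S) + u (B \<inter> S)"
    unfolding trace_Un_Int[of A B S] by (rule submodular_ineq[OF u Int_lower2 Int_lower2])
  moreover have "v ((A \<union> B) \<inter> T) + v ((A \<inter> B) \<inter> T) \<le> v (A \<inter> T) + v (B \<inter> T)"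
    unfolding trace_Un_Int[of A B T] by (rule submodular_ineq[OF v Int_lower2 Int_lower2])
  ultimately have "(u ((A \<union> B) \<inter> S) + u ((A \<inter> B) \<inter> S)) + (v ((A \<union> B) \<inter> T) + v ((A \<inter> B) \<inter> T))
      \<le> (u (A \<inter> S) + u (B \<inter> S)) + (v (A \<inter> T) + v (B \<inter> T))"
    by (rule add_mono)
  moreover have "A \<union> B \<subseteq> S \<union> T" "A \<inter> B \<subseteq> S \<union> T" using AB by auto
  ultimately show "set_prod S T u v (A \<union> B) + set_prod S T u v (A \<inter> B) \<le> set_prod S T u v A + set_prod S T u v B"
    using AB by (simp add: set_prod_apply ac_simps)
qed (auto simp: set_prod_def submodular_empty[OF u] submodular_empty[OF v])

lemma set_prod_less_PInf_iff:
  assumes "u \<in> submodular_functions S" "v \<in> submodular_functions T" "A \<subseteq> S \<union> T"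
  shows "set_prod S T u v A < \<infinity> \<longleftrightarrow> u (A \<inter> S) < \<infinity> \<and> v (A \<inter> T) < \<infinity>"
  using submodular_not_MInf[OF assms(1), of "A \<inter> S"] submodular_not_MInf[OF assms(2), of "A \<inter> T"]
  by (simp add: set_prod_apply assms(3))

lemma set_prod_modular:
  assumes u: "u \<in> modular_functions S" and v: "v \<in> modular_functions T"
  shows "set_prod S T u v \<in> modular_functions (S \<union> T)"
proof (rule modular_functionsI)
  note us = modular_imp_submodular[OF u] and vs = modular_imp_submodular[OF v]
  show "set_prod S T u v \<in> submodular_functions (S \<union> T)" using set_prod_submodular[OF us vs] .
  fix A B assume AB: "A \<subseteq> S \<union> T" "B \<subseteq> S \<union> T" and fin: "set_prod S T u v A < \<infinity>" "set_prod S T u v B < \<infinity>"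
  note fin = fin[unfolded set_prod_less_PInf_iff[OF us vs AB(1)] set_prod_less_PInf_iff[OF us vs AB(2)]]
  have "u ((A \<union> B) \<inter> S) + u ((A \<inter> B) \<inter> S) = u (A \<inter> S) + u (B \<inter> S)"
    unfolding trace_Un_Int[of A B S] using modular_eq[OF u Int_lower2 Int_lower2] fin by blast
  moreover have "v ((A \<union> B) \<inter> T) + v ((A \<inter> B) \<inter> T) = v (A \<inter> T) + v (B \<inter> T)"
    unfolding trace_Un_Int[of A B T] using modular_eq[OF v Int_lower2 Int_lower2] fin by blast
  ultimately have "(u ((A \<union> B) \<inter> S) + u ((A \<inter> B) \<inter> S)) + (v ((A \<union> B) \<inter> T) + v ((A \<inter> B) \<inter> T))
      = (u (A \<inter> S) + u (B \<inter> S)) + (v (A \<inter> T) + v (B \<inter> T))"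
    by simp
  moreover have "A \<union> B \<subseteq> S \<union> T" "A \<inter> B \<subseteq> S \<union> T" using AB by auto
  ultimately show "set_prod S T u v (A \<union> B) + set_prod S T u v (A \<inter> B) = set_prod S T u v A + set_prod S T u v B"
    using AB by (simp add: set_prod_apply ac_simps)
qed

lemma submodular_finite_add:
  assumes "z \<in> submodular_functions I" "A \<subseteq> I" "B \<subseteq> I" "z A < \<infinity>" "z B < \<infinity>"
  shows "\<bar>z A + z B\<bar> \<noteq> \<infinity>"
  using assms(4,5) submodular_not_MInf[OF assms(1,2)] submodular_not_MInf[OF assms(1,3)]
  by (cases "z A"; cases "z B") auto

text \<open>
  Used to conclude that a sum of submodular inequalities is tight only if each of them is.
\<close>

lemma ereal_add_eq_imp_eq:
  fixes a b c d :: ereal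
  assumes "a \<le> c" "b \<le> d" "c + d = a + b" "\<bar>a\<bar> \<noteq> \<infinity>" "\<bar>b\<bar> \<noteq> \<infinity>"
  shows "c = a" "d = b"
proof -
  obtain r s where ab: "a = ereal r" "b = ereal s"
    using assms(4,5) by (cases a; cases b) auto
  obtain t u where cd: "c = ereal t" "d = ereal u"
    using assms(1-3) unfolding ab by (cases c; cases d; simp)
  have "r \<le> t" "s \<le> u" using assms(1,2) unfolding ab cd by simp_all
  moreover have "t + u = r + s" using assms(3) unfolding ab cd plus_ereal.simps ereal.inject .
  ultimately have "t = r" "u = s" by linarith+
  then show "c = a" "d = b" by (simp_all add: ab cd)
qed

lemma ereal_sum_eq_imp_eq:
  fixes f g :: "'a \<Rightarrow> ereal"
  assumes "finite A" "\<And>i. i \<in> A \<Longrightarrow> f i \<le> g i" "sum g A = sum f A" "\<And>i. i \<in> A \<Longrightarrow> \<bar>f i\<bar> \<noteq> \<infinity>" "i \<in> A"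
  shows "g i = f i"
proof -
  have "f i \<le> g i" "sum f (A - {i}) \<le> sum g (A - {i})" using assms(2,5) by (auto intro: sum_mono)
  moreover have "g i + sum g (A - {i}) = f i + sum f (A - {i})"
    using assms(3) unfolding sum.remove[OF assms(1,5)] .
  moreover have "\<bar>f i\<bar> \<noteq> \<infinity>" by (rule assms(4)[OF assms(5)])
  moreover have "\<bar>sum f (A - {i})\<bar> \<noteq> \<infinity>" using assms(4) by (simp add: sum_Inf)
  ultimately show ?thesis by (rule ereal_add_eq_imp_eq)
qed

lemma down_set_Un_disjoint:
  assumes "preorder_on S Q\<^sub>1" "preorder_on T Q\<^sub>2" "S \<inter> T = {}"
  shows "down_set (S \<union> T) (Q\<^sub>1 \<union> Q\<^sub>2) A \<longleftrightarrow>
    A \<subseteq> S \<union> T \<and> down_set S Q\<^sub>1 (A \<inter> S) \<and> down_set T Q\<^sub>2 (A \<inter> T)"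
  using preorder_on_subset[OF assms(1)] preorder_on_subset[OF assms(2)] assms(3)
  unfolding down_set_def by blast

lemma preorder_on_Un_disjoint:
  assumes "preorder_on S Q\<^sub>1" "preorder_on T Q\<^sub>2" "S \<inter> T = {}"
  shows "preorder_on (S \<union> T) (Q\<^sub>1 \<union> Q\<^sub>2)"
proof -
  have "(x, z) \<in> Q\<^sub>1 \<union> Q\<^sub>2" if "(x, y) \<in> Q\<^sub>1 \<union> Q\<^sub>2" "(y, z) \<in> Q\<^sub>1 \<union> Q\<^sub>2" for x y z
    using that preorder_on_trans[OF assms(1)] preorder_on_trans[OF assms(2)]
      preorder_on_subset[OF assms(1)] preorder_on_subset[OF assms(2)] assms(3) by blast
  then show ?thesis
    using assms(1,2) by (auto simp: preorder_on_def refl_on_def intro!: transI)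
qed

text \<open>
  The modular law for \<open>u \<cdot> v\<close> is the sum of the laws for \<open>u\<close> and \<open>v\<close> on the traces; as each of the two
  inequalities holds separately, equality of the sums forces both to be equalities.
\<close>

lemma Pre_set_prod:
  assumes u: "u \<in> submodular_functions S" and v: "v \<in> submodular_functions T" and ST: "S \<inter> T = {}"
    and Q: "Q\<^sub>1 \<in> Pre S u" "Q\<^sub>2 \<in> Pre T v"
  shows "Q\<^sub>1 \<union> Q\<^sub>2 \<in> Pre (S \<union> T) (set_prod S T u v)"
proof (rule PreI[OF set_prod_submodular[OF u v]])
  note pre = Pre_preorder[OF Q(1)] Pre_preorder[OF Q(2)]
  note d = down_set_Un_disjoint[OF pre ST]
  show "preorder_on (S \<union> T) (Q\<^sub>1 \<union> Q\<^sub>2)" using preorder_on_Un_disjoint[OF pre ST] .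
  fix X
  show "set_prod S T u v X < \<infinity>" if X: "down_set (S \<union> T) (Q\<^sub>1 \<union> Q\<^sub>2) X"
    unfolding set_prod_less_PInf_iff[OF u v down_set_subset[OF X]]
    using X Pre_finite[OF Q(1)] Pre_finite[OF Q(2)] unfolding d by blast
  fix Y
  note sets = trace_Un_Int[of X Y S] trace_Un_Int[of X Y T]
  have eq: "set_prod S T u v X + set_prod S T u v Y = (u (X \<inter> S) + u (Y \<inter> S)) + (v (X \<inter> T) + v (Y \<inter> T))"
    "set_prod S T u v (X \<inter> Y) + set_prod S T u v (X \<union> Y) =
       (u ((X \<inter> S) \<inter> (Y \<inter> S)) + u ((X \<inter> S) \<union> (Y \<inter> S))) + (v ((X \<inter> T) \<inter> (Y \<inter> T)) + v ((X \<inter> T) \<union> (Y \<inter> T)))"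
    if "X \<subseteq> S \<union> T" "Y \<subseteq> S \<union> T"
  proof -
    have "X \<union> Y \<subseteq> S \<union> T" "X \<inter> Y \<subseteq> S \<union> T" using that by auto
    with that show "set_prod S T u v X + set_prod S T u v Y = (u (X \<inter> S) + u (Y \<inter> S)) + (v (X \<inter> T) + v (Y \<inter> T))"
      "set_prod S T u v (X \<inter> Y) + set_prod S T u v (X \<union> Y) =
       (u ((X \<inter> S) \<inter> (Y \<inter> S)) + u ((X \<inter> S) \<union> (Y \<inter> S))) + (v ((X \<inter> T) \<inter> (Y \<inter> T)) + v ((X \<inter> T) \<union> (Y \<inter> T)))"
      unfolding sets[symmetric] by (simp_all add: set_prod_apply ac_simps)
  qed
  show "set_prod S T u v X + set_prod S T u v Y = set_prod S T u v (X \<inter> Y) + set_prod S T u v (X \<union> Y)"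
    if X: "down_set (S \<union> T) (Q\<^sub>1 \<union> Q\<^sub>2) X" and Y: "down_set (S \<union> T) (Q\<^sub>1 \<union> Q\<^sub>2) Y"
  proof -
    have "u (X \<inter> S) + u (Y \<inter> S) = u ((X \<inter> S) \<inter> (Y \<inter> S)) + u ((X \<inter> S) \<union> (Y \<inter> S))"
      using X Y unfolding d by (intro Pre_modular[OF Q(1) u]) auto
    moreover have "v (X \<inter> T) + v (Y \<inter> T) = v ((X \<inter> T) \<inter> (Y \<inter> T)) + v ((X \<inter> T) \<union> (Y \<inter> T))"
      using X Y unfolding d by (intro Pre_modular[OF Q(2) v]) auto
    ultimately show ?thesis
      by (simp only: eq[OF down_set_subset[OF X] down_set_subset[OF Y]])
  qed
  show "down_set (S \<union> T) (Q\<^sub>1 \<union> Q\<^sub>2) X"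
    if XY: "X \<subseteq> S \<union> T" "Y \<subseteq> S \<union> T"
      and dXY: "down_set (S \<union> T) (Q\<^sub>1 \<union> Q\<^sub>2) (X \<inter> Y)" "down_set (S \<union> T) (Q\<^sub>1 \<union> Q\<^sub>2) (X \<union> Y)"
      and tight: "set_prod S T u v X + set_prod S T u v Y = set_prod S T u v (X \<inter> Y) + set_prod S T u v (X \<union> Y)"
  proof -
    have dS: "down_set S Q\<^sub>1 ((X \<inter> S) \<inter> (Y \<inter> S))" "down_set S Q\<^sub>1 ((X \<inter> S) \<union> (Y \<inter> S))"
      and dT: "down_set T Q\<^sub>2 ((X \<inter> T) \<inter> (Y \<inter> T))" "down_set T Q\<^sub>2 ((X \<inter> T) \<union> (Y \<inter> T))"
      using dXY unfolding d sets by auto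
    let ?a = "u ((X \<inter> S) \<inter> (Y \<inter> S)) + u ((X \<inter> S) \<union> (Y \<inter> S))"
    let ?b = "v ((X \<inter> T) \<inter> (Y \<inter> T)) + v ((X \<inter> T) \<union> (Y \<inter> T))"
    have "?a \<le> u (X \<inter> S) + u (Y \<inter> S)" "?b \<le> v (X \<inter> T) + v (Y \<inter> T)"
      using submodular_ineq[OF u Int_lower2 Int_lower2] submodular_ineq[OF v Int_lower2 Int_lower2]
      by (simp_all only: add.commute)
    moreover have "(u (X \<inter> S) + u (Y \<inter> S)) + (v (X \<inter> T) + v (Y \<inter> T)) = ?a + ?b"
      using tight unfolding eq[OF XY] .
    moreover have "\<bar>?a\<bar> \<noteq> \<infinity>"
      by (rule submodular_finite_add[OF u dS[THEN down_set_subset] dS[THEN Pre_finite[OF Q(1)]]])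
    moreover have "\<bar>?b\<bar> \<noteq> \<infinity>"
      by (rule submodular_finite_add[OF v dT[THEN down_set_subset] dT[THEN Pre_finite[OF Q(2)]]])
    ultimately have "u (X \<inter> S) + u (Y \<inter> S) = ?a" "v (X \<inter> T) + v (Y \<inter> T) = ?b"
      by (rule ereal_add_eq_imp_eq)+
    then have "down_set S Q\<^sub>1 (X \<inter> S)" "down_set T Q\<^sub>2 (X \<inter> T)"
      using Pre_closed(1)[OF Q(1) u Int_lower2 Int_lower2 dS] Pre_closed(1)[OF Q(2) v Int_lower2 Int_lower2 dT]
      by blast+
    then show ?thesis unfolding d using XY by blast
  qed
qed

lemma set_prod_minors_eq:
  assumes E: "E \<subseteq> I" and S: "S \<subseteq> I"
  shows "set_prod S (I - S) (restriction z S) (contraction I z S) E = z (E \<inter> S) + (z (E \<union> S) - z S)"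
proof -
  have "S \<union> (E \<inter> (I - S)) = E \<union> S" "E \<subseteq> S \<union> (I - S)" using E by auto
  then show ?thesis
    unfolding set_prod_apply[OF \<open>E \<subseteq> S \<union> (I - S)\<close>]
    by (simp add: restriction_apply contraction_apply[OF Int_lower2])
qed

text \<open>
  The product of the minors along \<open>S\<close> is again at most \<open>z\<close>, so preorders on \<open>S\<close> and \<open>I - S\<close> are
  glued by applying \<open>lift_preorder\<close> to their disjoint union.
\<close>

definition glue_preorders :: "'i set \<Rightarrow> ('i set \<Rightarrow> ereal) \<Rightarrow> 'i set \<Rightarrow> 'i rel \<times> 'i rel \<Rightarrow> 'i rel" where
  "glue_preorders I z S = (\<lambda>(Q\<^sub>1, Q\<^sub>2).
     lift_preorder I z (set_prod S (I - S) (restriction z S) (contraction I z S)) (Q\<^sub>1 \<union> Q\<^sub>2))"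

lemma glue_preorders:
  assumes "finite I" and z: "z \<in> submodular_functions I" and S: "S \<subseteq> I" "z S < \<infinity>"
    and Q: "Q\<^sub>1 \<in> Pre S (restriction z S)" "Q\<^sub>2 \<in> Pre (I - S) (contraction I z S)"
  shows "glue_preorders I z S (Q\<^sub>1, Q\<^sub>2) \<in> Pre I z"
    and "down_set I (glue_preorders I z S (Q\<^sub>1, Q\<^sub>2)) A \<longleftrightarrow> A \<subseteq> I \<and>
      down_set S Q\<^sub>1 (A \<inter> S) \<and> down_set (I - S) Q\<^sub>2 (A \<inter> (I - S)) \<and> z A = z (A \<inter> S) + (z (A \<union> S) - z S)"
proof -
  define w where "w = set_prod S (I - S) (restriction z S) (contraction I z S)"
  have I: "S \<union> (I - S) = I" and dj: "S \<inter> (I - S) = {}" using S by auto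
  note m = restriction_submodular[OF z S] contraction_submodular[OF z S]
  obtain s where s: "z S = ereal s" using submodular_real[OF z S] .
  have w: "w \<in> submodular_functions I"
    using set_prod_submodular[OF m] unfolding w_def I .
  have le: "w A \<le> z A" if A: "A \<subseteq> I" for A
  proof -
    have "A \<union> S \<subseteq> I" "A \<inter> S \<subseteq> I" using A S by auto
    from this[THEN submodular_not_MInf[OF z]]
    show ?thesis
      using submodular_ineq[OF z A S(1)] unfolding w_def set_prod_minors_eq[OF A S(1)] s
      by (cases "z (A \<union> S)"; cases "z (A \<inter> S)"; cases "z A") auto
  qed
  have full: "w I = z I"
    using S submodular_full[OF z] unfolding w_def set_prod_minors_eq[OF subset_refl S(1)]
    by (cases "z I") (auto simp: Int_absorb1 Un_absorb2 s)
  have R: "Q\<^sub>1 \<union> Q\<^sub>2 \<in> Pre I w"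
    using Pre_set_prod[OF m dj Q] unfolding I w_def .
  note lift = lift_preorder[OF \<open>finite I\<close> z w le full R]
  show "glue_preorders I z S (Q\<^sub>1, Q\<^sub>2) \<in> Pre I z"
    using lift(1) by (simp add: glue_preorders_def w_def)
  have "down_set I (glue_preorders I z S (Q\<^sub>1, Q\<^sub>2)) A \<longleftrightarrow> down_set I (Q\<^sub>1 \<union> Q\<^sub>2) A \<and> z A = w A"
    using lift(2) by (simp add: glue_preorders_def w_def)
  also have "down_set I (Q\<^sub>1 \<union> Q\<^sub>2) A \<longleftrightarrow> A \<subseteq> I \<and> down_set S Q\<^sub>1 (A \<inter> S) \<and> down_set (I - S) Q\<^sub>2 (A \<inter> (I - S))"
    using down_set_Un_disjoint[OF Pre_preorder[OF Q(1)] Pre_preorder[OF Q(2)] dj] by (simp only: I)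
  finally show "down_set I (glue_preorders I z S (Q\<^sub>1, Q\<^sub>2)) A \<longleftrightarrow> A \<subseteq> I \<and>
      down_set S Q\<^sub>1 (A \<inter> S) \<and> down_set (I - S) Q\<^sub>2 (A \<inter> (I - S)) \<and> z A = z (A \<inter> S) + (z (A \<union> S) - z S)"
    unfolding w_def using set_prod_minors_eq[OF _ S(1)] by metis
qed

text \<open>
  Glueing inverts restriction: if \<open>S\<close> is a down-set of \<open>Q\<close>, the modular law for the pair \<open>A\<close>, \<open>S\<close> shows
  that every down-set \<open>A\<close> of \<open>Q\<close> is one of the glued preorder.  The latter is thus contained in \<open>Q\<close>,
  and it contains all bubbles of \<open>Q\<close>, none of which meets both \<open>S\<close> and its complement.
\<close>

lemma bij_betw_split_Pre:
  assumes "finite I" and z: "z \<in> submodular_functions I" and S: "S \<subseteq> I" "z S < \<infinity>"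
  shows "bij_betw (\<lambda>Q. (Restr Q S, Restr Q (I - S))) {Q \<in> Pre I z. down_set I Q S}
    (Pre S (restriction z S) \<times> Pre (I - S) (contraction I z S))"
proof (rule bij_betw_byWitness[where f' = "glue_preorders I z S"])
  obtain s where s: "z S = ereal s" using submodular_real[OF z S] .
  note glue = glue_preorders[OF \<open>finite I\<close> z S]
  have dS: "down_set I (glue_preorders I z S (Q\<^sub>1, Q\<^sub>2)) S"
    if Q: "Q\<^sub>1 \<in> Pre S (restriction z S)" "Q\<^sub>2 \<in> Pre (I - S) (contraction I z S)" for Q\<^sub>1 Q\<^sub>2
    unfolding glue(2)[OF Q] using S down_set_full[OF Pre_preorder[OF Q(1)]] by (simp add: s)
  show "\<forall>Q\<in>{Q \<in> Pre I z. down_set I Q S}. glue_preorders I z S (Restr Q S, Restr Q (I - S)) = Q"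
  proof
    fix Q assume "Q \<in> {Q \<in> Pre I z. down_set I Q S}"
    then have Q: "Q \<in> Pre I z" and SQ: "down_set I Q S" by auto
    note pre = Pre_preorder[OF Q] and r = Pre_Restr[OF z Q SQ] Pre_Restr_complement[OF z Q SQ]
    let ?G = "glue_preorders I z S (Restr Q S, Restr Q (I - S))"
    note preG = Pre_preorder[OF glue(1)[OF r]]
    show "?G = Q"
    proof (rule Pre_eq_if_same_bubbles[OF \<open>finite I\<close> z Q glue(1)[OF r]])
      show "?G \<subseteq> Q"
      proof (rule preorder_subsetI[OF preG pre])
        fix A assume A: "down_set I Q A"
        have "A \<inter> S \<subseteq> S" "A \<inter> (I - S) \<subseteq> I - S" "S \<union> (A \<inter> (I - S)) = A \<union> S"
          using down_set_subset[OF A] by auto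
        moreover have dd: "down_set I Q (A \<inter> S)" "down_set I Q (A \<union> S)"
          using A SQ by (auto intro: down_set_Un down_set_Int)
        moreover have "z A = z (A \<inter> S) + (z (A \<union> S) - z S)"
          using Pre_modular[OF Q z A SQ] submodular_real[OF z down_set_subset[OF A] Pre_finite[OF Q A]]
            submodular_real[OF z down_set_subset[OF dd(1)] Pre_finite[OF Q dd(1)]]
            submodular_real[OF z down_set_subset[OF dd(2)] Pre_finite[OF Q dd(2)]] s
          by (cases "z (A \<union> S)"; cases "z (A \<inter> S)"; cases "z A") auto
        ultimately show "down_set I ?G A"
          unfolding glue(2)[OF r] down_set_Restr_iff[OF SQ] down_set_Restr_complement_iff[OF pre SQ]
          using down_set_subset[OF A] by auto
      qed
      have "Restr Q S \<union> Restr Q (I - S) \<subseteq> ?G"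
      proof
        fix p assume p: "p \<in> Restr Q S \<union> Restr Q (I - S)"
        obtain x y where xy: "p = (x, y)" by (cases p)
        have "y \<in> I" using p S xy by auto
        have "x \<in> A" if A: "down_set I ?G A" "y \<in> A" for A
        proof -
          have "down_set S (Restr Q S) (A \<inter> S)" "down_set (I - S) (Restr Q (I - S)) (A \<inter> (I - S))"
            using A(1) unfolding glue(2)[OF r] by auto
          then show ?thesis
            using down_setD[of S _ "A \<inter> S" y x] down_setD[of "I - S" _ "A \<inter> (I - S)" y x] p A(2)
            unfolding xy by blast
        qed
        then show "p \<in> ?G"
          unfolding xy preorder_le_iff[OF preG \<open>y \<in> I\<close>] by blast
      qed
      moreover have "Q \<inter> Q\<inverse> \<subseteq> Restr Q S \<union> Restr Q (I - S)"
        using down_setD[OF SQ] preorder_on_subset[OF pre] by auto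
      ultimately show "Q \<inter> Q\<inverse> \<subseteq> ?G" by blast
    qed
  qed
  show "\<forall>p\<in>Pre S (restriction z S) \<times> Pre (I - S) (contraction I z S).
      (Restr (glue_preorders I z S p) S, Restr (glue_preorders I z S p) (I - S)) = p"
  proof
    fix p assume "p \<in> Pre S (restriction z S) \<times> Pre (I - S) (contraction I z S)"
    then obtain Q\<^sub>1 Q\<^sub>2 where p: "p = (Q\<^sub>1, Q\<^sub>2)"
      and Q: "Q\<^sub>1 \<in> Pre S (restriction z S)" "Q\<^sub>2 \<in> Pre (I - S) (contraction I z S)" by blast
    let ?G = "glue_preorders I z S (Q\<^sub>1, Q\<^sub>2)"
    note preG = Pre_preorder[OF glue(1)[OF Q]]
    have "Restr ?G S = Q\<^sub>1"
    proof (rule preorder_eqI[OF preorder_on_Restr[OF preG S(1)] Pre_preorder[OF Q(1)]])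
      fix A
      have "down_set I ?G A \<longleftrightarrow> down_set S Q\<^sub>1 A" if "A \<subseteq> S"
      proof -
        have "A \<inter> S = A" "A \<inter> (I - S) = {}" "A \<union> S = S" "A \<subseteq> I" using that S by auto
        then show ?thesis unfolding glue(2)[OF Q] by (simp add: s)
      qed
      then show "down_set S (Restr ?G S) A \<longleftrightarrow> down_set S Q\<^sub>1 A"
        unfolding down_set_Restr_iff[OF dS[OF Q]] using down_set_subset[of S Q\<^sub>1 A] by blast
    qed
    moreover have "Restr ?G (I - S) = Q\<^sub>2"
    proof (rule preorder_eqI[OF preorder_on_Restr[OF preG Diff_subset] Pre_preorder[OF Q(2)]])
      fix A
      have "down_set I ?G (S \<union> A) \<longleftrightarrow> down_set (I - S) Q\<^sub>2 A" if "A \<subseteq> I - S"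
      proof -
        have "(S \<union> A) \<inter> S = S" "(S \<union> A) \<inter> (I - S) = A" "(S \<union> A) \<union> S = S \<union> A" "S \<union> A \<subseteq> I"
          using that S by auto
        moreover have "z (S \<union> A) = z S + (z (S \<union> A) - z S)"
          unfolding s by (cases "z (S \<union> A)") auto
        ultimately show ?thesis
          unfolding glue(2)[OF Q] using down_set_full[OF Pre_preorder[OF Q(1)]] by metis
      qed
      then show "down_set (I - S) (Restr ?G (I - S)) A \<longleftrightarrow> down_set (I - S) Q\<^sub>2 A"
        unfolding down_set_Restr_complement_iff[OF preG dS[OF Q]]
        using down_set_subset[of "I - S" Q\<^sub>2 A] by blast
    qed
    ultimately show "(Restr (glue_preorders I z S p) S, Restr (glue_preorders I z S p) (I - S)) = p"
      by (simp only: p)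
  qed
  show "(\<lambda>Q. (Restr Q S, Restr Q (I - S))) ` {Q \<in> Pre I z. down_set I Q S} \<subseteq>
      Pre S (restriction z S) \<times> Pre (I - S) (contraction I z S)"
    using Pre_Restr[OF z] Pre_Restr_complement[OF z] by auto
  show "glue_preorders I z S ` (Pre S (restriction z S) \<times> Pre (I - S) (contraction I z S)) \<subseteq>
      {Q \<in> Pre I z. down_set I Q S}"
    using glue(1) dS by auto
qed

lemma bubbles_Restr:
  assumes P: "preorder_on I P" and S: "S \<subseteq> I"
    and sat: "\<And>x y. (x, y) \<in> P \<Longrightarrow> (y, x) \<in> P \<Longrightarrow> y \<in> S \<Longrightarrow> x \<in> S"
  shows "bubbles S (Restr P S) = {C \<in> bubbles I P. C \<subseteq> S}"
proof -
  have eq: "{x. (x, y) \<in> Restr P S \<and> (y, x) \<in> Restr P S} = {x. (x, y) \<in> P \<and> (y, x) \<in> P}" if "y \<in> S" for y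
    using sat that by blast
  show ?thesis
  proof (rule set_eqI)
    fix C
    have "C \<in> bubbles S (Restr P S) \<longleftrightarrow> (\<exists>y\<in>S. C = {x. (x, y) \<in> P \<and> (y, x) \<in> P})"
      by (simp only: bubbles_iff eq cong: bex_cong)
    also have "\<dots> \<longleftrightarrow> C \<in> bubbles I P \<and> C \<subseteq> S"
      unfolding bubbles_iff using S sat preorder_on_refl[OF P] by blast
    finally show "C \<in> bubbles S (Restr P S) \<longleftrightarrow> C \<in> {C \<in> bubbles I P. C \<subseteq> S}" by simp
  qed
qed

text \<open>
  A bubble of \<open>Q\<close> lies inside \<open>S\<close> or inside \<open>I - S\<close>; in the second case its minor is computed with a
  lower end that contains \<open>S\<close>, and \<open>z S\<close> cancels.
\<close>

lemma lower_split:
  assumes "finite I" and z: "z \<in> submodular_functions I" and Q: "Q \<in> Pre I z" and S: "down_set I Q S"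
  shows "lower I Q z = set_prod S (I - S) (lower S (Restr Q S) (restriction z S))
    (lower (I - S) (Restr Q (I - S)) (contraction I z S))"
proof (rule extensional_Pow_eqI)
  note pre = Pre_preorder[OF Q] and SI = down_set_subset[OF S]
  note r = Pre_Restr[OF z Q S] Pre_Restr_complement[OF z Q S]
  note m = restriction_submodular[OF z SI Pre_finite[OF Q S]] contraction_submodular[OF z SI Pre_finite[OF Q S]]
  have I: "S \<union> (I - S) = I" using SI by auto
  show "lower I Q z \<in> extensional (Pow I)" by (simp add: lower_def)
  show "set_prod S (I - S) (lower S (Restr Q S) (restriction z S))
    (lower (I - S) (Restr Q (I - S)) (contraction I z S)) \<in> extensional (Pow I)"
    unfolding set_prod_def I by simp
  have b1: "bubbles S (Restr Q S) = {C \<in> bubbles I Q. C \<subseteq> S}"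
    by (rule bubbles_Restr[OF pre SI]) (use down_setD[OF S] in blast)
  have b2: "bubbles (I - S) (Restr Q (I - S)) = {C \<in> bubbles I Q. C \<subseteq> I - S}"
    by (rule bubbles_Restr[OF pre Diff_subset]) (use down_setD[OF S] preorder_on_subset[OF pre] in blast)
  have bb: "bubbles I Q = bubbles S (Restr Q S) \<union> bubbles (I - S) (Restr Q (I - S))"
    unfolding b1 b2 using bubble_in_down_set[OF pre _ S] bubble_subset[OF pre] by blast
  have dj: "bubbles S (Restr Q S) \<inter> bubbles (I - S) (Restr Q (I - S)) = {}"
    unfolding b1 b2 using bubble_nonempty[OF pre] by blast
  have fin: "finite (bubbles S (Restr Q S))" "finite (bubbles (I - S) (Restr Q (I - S)))"
    using finite_bubbles[OF \<open>finite I\<close> pre] unfolding bb by auto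
  have cm1: "convex_minor I Q z C F = convex_minor S (Restr Q S) (restriction z S) C F"
    if C: "C \<in> bubbles S (Restr Q S)" and F: "F \<subseteq> C" for C F
  proof -
    let ?b = "base (Restr Q S) C"
    have d: "down_set S (Restr Q S) ?b" "down_set S (Restr Q S) (?b \<union> C)"
      using down_set_base[OF Pre_preorder[OF r(1)] C] by auto
    then have "down_set I Q ?b" "down_set I Q (?b \<union> C)" and "?b \<subseteq> S" "?b \<union> F \<subseteq> S"
      using F unfolding down_set_Restr_iff[OF S] by auto
    then show ?thesis
      using convex_minor_apply[OF z Q _ _ base_disjoint F, of "Restr Q S"]
        convex_minor_bubble[OF m(1) r(1) r(1) C r(1) C F] by (simp add: restriction_apply)
  qed
  have cm2: "convex_minor I Q z C F = convex_minor (I - S) (Restr Q (I - S)) (contraction I z S) C F"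
    if C: "C \<in> bubbles (I - S) (Restr Q (I - S))" and F: "F \<subseteq> C" for C F
  proof -
    let ?b = "base (Restr Q (I - S)) C"
    have "down_set (I - S) (Restr Q (I - S)) ?b" "down_set (I - S) (Restr Q (I - S)) (?b \<union> C)"
      using down_set_base[OF Pre_preorder[OF r(2)] C] by auto
    then have d: "down_set I Q (S \<union> ?b)" "down_set I Q (S \<union> ?b \<union> C)"
      and sub: "?b \<subseteq> I - S" "C \<subseteq> I - S" "?b \<union> F \<subseteq> I - S"
      using F unfolding down_set_Restr_complement_iff[OF pre S] by (auto simp: Un_assoc)
    obtain s where s: "z S = ereal s" using submodular_real[OF z SI Pre_finite[OF Q S]] .
    obtain b where b: "z (S \<union> ?b) = ereal b"
      using submodular_real[OF z down_set_subset[OF d(1)] Pre_finite[OF Q d(1)]] .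
    have "(S \<union> ?b) \<inter> C = {}" using sub base_disjoint[of "Restr Q (I - S)" C] by blast
    then have "convex_minor I Q z C F = z (S \<union> ?b \<union> F) - z (S \<union> ?b)"
      using convex_minor_apply[OF z Q d _ F] by blast
    moreover have "convex_minor (I - S) (Restr Q (I - S)) (contraction I z S) C F =
        (z (S \<union> (?b \<union> F)) - z S) - (z (S \<union> ?b) - z S)"
      using convex_minor_bubble[OF m(2) r(2) r(2) C r(2) C F] sub by (simp add: contraction_apply)
    moreover have "S \<union> (?b \<union> F) = S \<union> ?b \<union> F" by blast
    ultimately show ?thesis unfolding s b by (cases "z (S \<union> ?b \<union> F)") auto
  qed
  fix E assume E: "E \<subseteq> I"
  have "lower I Q z E = (\<Sum>C\<in>bubbles S (Restr Q S). convex_minor I Q z C (E \<inter> C)) +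
      (\<Sum>C\<in>bubbles (I - S) (Restr Q (I - S)). convex_minor I Q z C (E \<inter> C))"
    unfolding lower_apply[OF E] bb using fin dj by (rule sum.union_disjoint)
  also have "(\<Sum>C\<in>bubbles S (Restr Q S). convex_minor I Q z C (E \<inter> C)) =
      lower S (Restr Q S) (restriction z S) (E \<inter> S)"
    unfolding lower_apply[OF Int_lower2]
  proof (rule sum.cong[OF refl])
    fix C assume C: "C \<in> bubbles S (Restr Q S)"
    then have "(E \<inter> S) \<inter> C = E \<inter> C" unfolding b1 by blast
    then show "convex_minor I Q z C (E \<inter> C) = convex_minor S (Restr Q S) (restriction z S) C (E \<inter> S \<inter> C)"
      using cm1[OF C Int_lower2] by simp
  qed
  also have "(\<Sum>C\<in>bubbles (I - S) (Restr Q (I - S)). convex_minor I Q z C (E \<inter> C)) =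
      lower (I - S) (Restr Q (I - S)) (contraction I z S) (E \<inter> (I - S))"
    unfolding lower_apply[OF Int_lower2]
  proof (rule sum.cong[OF refl])
    fix C assume C: "C \<in> bubbles (I - S) (Restr Q (I - S))"
    then have "(E \<inter> (I - S)) \<inter> C = E \<inter> C" unfolding b2 by blast
    then show "convex_minor I Q z C (E \<inter> C) =
        convex_minor (I - S) (Restr Q (I - S)) (contraction I z S) C (E \<inter> (I - S) \<inter> C)"
      using cm2[OF C Int_lower2] by simp
  qed
  finally show "lower I Q z E = set_prod S (I - S) (lower S (Restr Q S) (restriction z S))
    (lower (I - S) (Restr Q (I - S)) (contraction I z S)) E"
    using E set_prod_apply[of E S "I - S"] unfolding I by simp
qed

lemma restriction_upper:
  assumes "down_set I Q S"
  shows "restriction (upper I Q z) S = upper S (Restr Q S) (restriction z S)"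
  using down_set_subset[OF assms]
  by (intro extensional_Pow_eqI[of _ S])
    (auto simp: restriction_def upper_def down_set_Restr_iff[OF assms])

lemma contraction_upper:
  assumes z: "z \<in> submodular_functions I" and Q: "Q \<in> Pre I z" and S: "down_set I Q S"
  shows "contraction I (upper I Q z) S = upper (I - S) (Restr Q (I - S)) (contraction I z S)"
proof (rule extensional_Pow_eqI[of _ "I - S"])
  obtain s where s: "z S = ereal s" using submodular_real[OF z down_set_subset[OF S] Pre_finite[OF Q S]] .
  fix E assume E: "E \<subseteq> I - S"
  then have "S \<union> E \<subseteq> I" using down_set_subset[OF S] by auto
  then show "contraction I (upper I Q z) S E = upper (I - S) (Restr Q (I - S)) (contraction I z S) E"
    using E S s down_set_subset[OF S] down_set_Restr_complement_iff[OF Pre_preorder[OF Q] S, of E]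
    by (auto simp: contraction_apply upper_apply)
qed (auto simp: contraction_def upper_def)

lemma restriction_set_prod:
  assumes u: "u \<in> submodular_functions S" and v: "v \<in> submodular_functions T" and ST: "S \<inter> T = {}"
  shows "restriction (set_prod S T u v) S = u"
proof (rule extensional_Pow_eqI[of _ S])
  fix E assume E: "E \<subseteq> S"
  then have "E \<subseteq> S \<union> T" "E \<inter> S = E" "E \<inter> T = {}" using ST by auto
  then show "restriction (set_prod S T u v) S E = u E"
    using submodular_empty[OF v] E by (simp add: restriction_apply set_prod_apply)
qed (auto simp: restriction_def submodular_extensional[OF u])

lemma contraction_set_prod:
  assumes u: "u \<in> submodular_functions S" and v: "v \<in> submodular_functions T" and ST: "S \<inter> T = {}"
  shows "contraction (S \<union> T) (set_prod S T u v) S = v"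
proof (rule extensional_Pow_eqI[of _ T])
  have T: "S \<union> T - S = T" using ST by auto
  show "contraction (S \<union> T) (set_prod S T u v) S \<in> extensional (Pow T)"
    by (simp add: contraction_def T)
  fix E assume E: "E \<subseteq> T"
  then have "S \<union> E \<subseteq> S \<union> T" "(S \<union> E) \<inter> S = S" "(S \<union> E) \<inter> T = E" using ST by auto
  moreover obtain s where "u S = ereal s" using submodular_real[OF u subset_refl submodular_full[OF u]] .
  ultimately show "contraction (S \<union> T) (set_prod S T u v) S E = v E"
    using submodular_empty[OF v] E T ST
    by (cases "v E") (simp_all add: contraction_apply set_prod_apply)
qed (simp add: submodular_extensional[OF v])

text \<open>
  A product satisfies the modular law at \<open>S\<close>, \<open>T\<close>, whose union and intersection are always down-sets.
\<close>

lemma down_set_Pre_set_prod: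
  assumes u: "u \<in> submodular_functions S" and v: "v \<in> submodular_functions T" and ST: "S \<inter> T = {}"
    and Q: "Q \<in> Pre (S \<union> T) (set_prod S T u v)"
  shows "down_set (S \<union> T) Q S" "down_set (S \<union> T) Q T"
proof -
  have "T \<inter> S = {}" using ST by auto
  then have "set_prod S T u v S + set_prod S T u v T = set_prod S T u v (S \<inter> T) + set_prod S T u v (S \<union> T)"
    using ST submodular_empty[OF u] submodular_empty[OF v] by (simp add: set_prod_apply Int_absorb1)
  then show "down_set (S \<union> T) Q S" "down_set (S \<union> T) Q T"
    using Pre_closed[OF Q set_prod_submodular[OF u v], of S T] down_set_full[OF Pre_preorder[OF Q]]
    by (simp_all add: ST)
qed

lemma upper_set_prod:
  assumes u: "u \<in> submodular_functions S" and v: "v \<in> submodular_functions T" and ST: "S \<inter> T = {}"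
    and Q: "Q \<in> Pre (S \<union> T) (set_prod S T u v)"
  shows "upper (S \<union> T) Q (set_prod S T u v) = set_prod S T (upper S (Restr Q S) u) (upper T (Restr Q T) v)"
proof (rule extensional_Pow_eqI[of _ "S \<union> T"])
  note d = down_set_Pre_set_prod[OF assms]
  fix E assume E: "E \<subseteq> S \<union> T"
  have "down_set (S \<union> T) Q E \<longleftrightarrow> down_set (S \<union> T) Q (E \<inter> S) \<and> down_set (S \<union> T) Q (E \<inter> T)"
  proof
    assume "down_set (S \<union> T) Q E"
    then show "down_set (S \<union> T) Q (E \<inter> S) \<and> down_set (S \<union> T) Q (E \<inter> T)"
      using d by (auto intro: down_set_Int)
  next
    assume "down_set (S \<union> T) Q (E \<inter> S) \<and> down_set (S \<union> T) Q (E \<inter> T)"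
    then have "down_set (S \<union> T) Q ((E \<inter> S) \<union> (E \<inter> T))" by (auto intro: down_set_Un)
    moreover have "(E \<inter> S) \<union> (E \<inter> T) = E" using E by auto
    ultimately show "down_set (S \<union> T) Q E" by simp
  qed
  then show "upper (S \<union> T) Q (set_prod S T u v) E =
      set_prod S T (upper S (Restr Q S) u) (upper T (Restr Q T) v) E"
    using submodular_not_MInf[OF u, of "E \<inter> S"] submodular_not_MInf[OF v, of "E \<inter> T"]
    by (auto simp: upper_apply E set_prod_apply down_set_Restr_iff[OF d(1)] down_set_Restr_iff[OF d(2)])
qed (auto simp: upper_def set_prod_def)

section \<open>Iterating the coaction\<close>

lemma preorder_on_Int_converse:
  assumes P: "preorder_on I P" and Q: "preorder_on I Q"
  shows "preorder_on I (P \<inter> Q\<inverse>)"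
  using assms preorder_on_trans[OF P] preorder_on_trans[OF Q]
  by (auto simp: preorder_on_def refl_on_def intro!: transI)

text \<open>
  The preorder \<open>P \<inter> Q\<inverse>\<close> keeps the relations of \<open>P\<close> inside each bubble of \<open>Q\<close> and forgets the others.
  A trace on a bubble is closed downwards inside the bubble iff adding everything strictly below the
  bubble in \<open>Q\<close> makes it a down-set of \<open>P\<close>.
\<close>

lemma down_set_Int_converse_iff:
  assumes P: "preorder_on I P" and Q: "preorder_on I Q" "P \<subseteq> Q"
  shows "down_set I (P \<inter> Q\<inverse>) A \<longleftrightarrow>
    A \<subseteq> I \<and> (\<forall>C\<in>bubbles I Q. down_set I P (base Q C \<union> (A \<inter> C)))"
proof (intro iffI conjI ballI)
  assume A: "down_set I (P \<inter> Q\<inverse>) A"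
  show "A \<subseteq> I" using down_set_subset[OF A] .
  fix C assume C: "C \<in> bubbles I Q"
  note b = down_set_base[OF Q(1) C]
  have "x \<in> base Q C \<union> (A \<inter> C)" if y: "y \<in> base Q C \<union> (A \<inter> C)" and xy: "(x, y) \<in> P" for x y
  proof (cases "y \<in> base Q C")
    case True
    then show ?thesis using down_setD[OF b(1)] xy Q(2) by blast
  next
    case False
    then have y: "y \<in> A" "y \<in> C" using y by auto
    have xyQ: "(x, y) \<in> Q" using xy Q(2) by blast
    show ?thesis
    proof (cases "(y, x) \<in> Q")
      case True
      then show ?thesis using bubble_closed[OF Q(1) C y(2) xyQ] down_setD[OF A y(1), of x] xy by blast
    next
      case False
      then show ?thesis using bubble_le[OF Q(1) C y(2), of x] y xyQ by (auto simp: base_def)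
    qed
  qed
  then show "down_set I P (base Q C \<union> (A \<inter> C))"
    using down_set_subset[OF b(1)] \<open>A \<subseteq> I\<close> by (auto simp: down_set_def)
next
  assume *: "A \<subseteq> I \<and> (\<forall>C\<in>bubbles I Q. down_set I P (base Q C \<union> (A \<inter> C)))"
  have "x \<in> A" if y: "y \<in> A" and xy: "(x, y) \<in> P" "(y, x) \<in> Q" for x y
  proof -
    have "y \<in> I" using * y by blast
    obtain C where C: "C \<in> bubbles I Q" "y \<in> C" using bubble_exists[OF Q(1) \<open>y \<in> I\<close>] .
    have "x \<in> C" using bubble_closed[OF Q(1) C] xy Q(2) by blast
    moreover have "x \<in> base Q C \<union> (A \<inter> C)"
      using * C y xy(1) down_setD[of I P "base Q C \<union> (A \<inter> C)" y x] by blast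
    ultimately show ?thesis using base_disjoint[of Q C] by blast
  qed
  with * show "down_set I (P \<inter> Q\<inverse>) A" unfolding down_set_def by blast
qed

lemma lower_of_bubble_part:
  assumes "finite I" and z: "z \<in> submodular_functions I" and Q: "Q \<in> Pre I z"
    and C: "C \<in> bubbles I Q" and A: "A \<subseteq> C"
  shows "lower I Q z A = z (base Q C \<union> A) - z (base Q C)"
proof -
  note pre = Pre_preorder[OF Q]
  note cm = convex_minor_submodular[OF z Q]
  have AI: "A \<subseteq> I" using A bubble_subset[OF pre C] by blast
  have "lower I Q z A = (\<Sum>D\<in>{C}. convex_minor I Q z D (A \<inter> D))"
    unfolding lower_apply[OF AI]
  proof (rule sum.mono_neutral_right[OF finite_bubbles[OF \<open>finite I\<close> pre]])
    show "\<forall>D\<in>bubbles I Q - {C}. convex_minor I Q z D (A \<inter> D) = 0"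
    proof
      fix D assume D: "D \<in> bubbles I Q - {C}"
      then have "A \<inter> D = {}" using bubbles_disjoint[OF pre C, of D] A by blast
      then show "convex_minor I Q z D (A \<inter> D) = 0" using submodular_empty[OF cm] D by auto
    qed
  qed (use C in auto)
  also have "\<dots> = z (base Q C \<union> A) - z (base Q C)"
    using A convex_minor_bubble[OF z Q Q C Q C A] by (simp add: Int_absorb2)
  finally show ?thesis .
qed

context
  fixes I :: "'i set" and z :: "'i set \<Rightarrow> ereal" and P Q :: "'i rel"
  assumes fin: "finite I" and z: "z \<in> submodular_functions I"
    and P: "P \<in> Pre I z" and Q: "Q \<in> Pre I (upper I P z)"
begin

lemma Pre_upper_subset: "P \<subseteq> Q"
  using Q Pre_upper_iff[OF z P] by blast

lemma Pre_upper_preorder: "preorder_on I Q"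
  using Q Pre_upper_iff[OF z P] by blast

lemma Pre_upper_down_set: "down_set I Q A \<Longrightarrow> down_set I P A"
  using Pre_upper_subset by (rule down_set_anti_mono)

lemma Pre_of_Pre_upper: "Q \<in> Pre I z"
proof (rule PreI[OF z Pre_upper_preorder])
  fix X assume "down_set I Q X"
  then show "z X < \<infinity>" using Pre_finite[OF P Pre_upper_down_set] by blast
next
  fix X Y assume "down_set I Q X" "down_set I Q Y"
  then show "z X + z Y = z (X \<inter> Y) + z (X \<union> Y)"
    using Pre_modular[OF P z Pre_upper_down_set Pre_upper_down_set] by blast
next
  fix X Y assume XY: "X \<subseteq> I" "Y \<subseteq> I" and d: "down_set I Q (X \<inter> Y)" "down_set I Q (X \<union> Y)"
    and eq: "z X + z Y = z (X \<inter> Y) + z (X \<union> Y)"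
  have "down_set I P X" "down_set I P Y"
    using Pre_closed[OF P z XY d[THEN Pre_upper_down_set] eq] by auto
  then show "down_set I Q X" using Q d unfolding Pre_upper_iff[OF z P] by blast
qed

lemma down_set_inner_iff:
  "down_set I (P \<inter> Q\<inverse>) A \<longleftrightarrow> A \<subseteq> I \<and> (\<forall>C\<in>bubbles I Q. down_set I P (base Q C \<union> (A \<inter> C)))"
  by (rule down_set_Int_converse_iff[OF Pre_preorder[OF P] Pre_upper_preorder Pre_upper_subset])

text \<open>
  All conditions are checked bubble by bubble, where \<open>z\<^sub>Q\<close> is a minor of \<open>z\<close> and those of \<open>P\<close> apply.
  A modular law for \<open>z\<^sub>Q\<close> is a sum over the bubbles of submodular inequalities with finite smaller side,
  so it holds at every bubble.
\<close>

lemma inner_Pre: "P \<inter> Q\<inverse> \<in> Pre I (lower I Q z)"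
proof (rule PreI)
  note Qz = Pre_of_Pre_upper
  note pre = Pre_upper_preorder
  show "lower I Q z \<in> submodular_functions I" by (rule lower_submodular[OF fin z Qz])
  show "preorder_on I (P \<inter> Q\<inverse>)" by (rule preorder_on_Int_converse[OF Pre_preorder[OF P] pre])
  fix X
  show "lower I Q z X < \<infinity>" if X: "down_set I (P \<inter> Q\<inverse>) X"
    unfolding lower_less_PInf_iff[OF fin pre down_set_subset[OF X]]
  proof
    fix C assume C: "C \<in> bubbles I Q"
    show "convex_minor I Q z C (X \<inter> C) < \<infinity>"
      unfolding convex_minor_less_PInf_iff[OF z Qz C Int_lower2]
      by (rule Pre_finite[OF P]) (use X C in \<open>auto simp: down_set_inner_iff\<close>)
  qed
  fix Y
  have un: "(base Q C \<union> (X \<inter> C)) \<union> (base Q C \<union> (Y \<inter> C)) = base Q C \<union> ((X \<union> Y) \<inter> C)"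
    and int: "(base Q C \<union> (X \<inter> C)) \<inter> (base Q C \<union> (Y \<inter> C)) = base Q C \<union> ((X \<inter> Y) \<inter> C)" for C
    by auto
  have sums: "lower I Q z X + lower I Q z Y =
      (\<Sum>C\<in>bubbles I Q. convex_minor I Q z C (X \<inter> C) + convex_minor I Q z C (Y \<inter> C))"
    "lower I Q z (X \<inter> Y) + lower I Q z (X \<union> Y) =
      (\<Sum>C\<in>bubbles I Q. convex_minor I Q z C ((X \<inter> Y) \<inter> C) + convex_minor I Q z C ((X \<union> Y) \<inter> C))"
    if "X \<subseteq> I" "Y \<subseteq> I"
  proof -
    have "X \<union> Y \<subseteq> I" "X \<inter> Y \<subseteq> I" using that by auto
    with that show "lower I Q z X + lower I Q z Y =
      (\<Sum>C\<in>bubbles I Q. convex_minor I Q z C (X \<inter> C) + convex_minor I Q z C (Y \<inter> C))"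
    "lower I Q z (X \<inter> Y) + lower I Q z (X \<union> Y) =
      (\<Sum>C\<in>bubbles I Q. convex_minor I Q z C ((X \<inter> Y) \<inter> C) + convex_minor I Q z C ((X \<union> Y) \<inter> C))"
      by (simp_all add: lower_apply sum.distrib)
  qed
  show "lower I Q z X + lower I Q z Y = lower I Q z (X \<inter> Y) + lower I Q z (X \<union> Y)"
    if X: "down_set I (P \<inter> Q\<inverse>) X" and Y: "down_set I (P \<inter> Q\<inverse>) Y"
    unfolding sums[OF down_set_subset[OF X] down_set_subset[OF Y]]
  proof (rule sum.cong[OF refl])
    fix C assume C: "C \<in> bubbles I Q"
    have "down_set I P (base Q C \<union> (X \<inter> C))" "down_set I P (base Q C \<union> (Y \<inter> C))"
      using X Y C unfolding down_set_inner_iff by auto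
    from Pre_modular[OF P z this]
    show "convex_minor I Q z C (X \<inter> C) + convex_minor I Q z C (Y \<inter> C) =
        convex_minor I Q z C ((X \<inter> Y) \<inter> C) + convex_minor I Q z C ((X \<union> Y) \<inter> C)"
      unfolding un int convex_minor_additive[OF z Qz C Int_lower2 Int_lower2 Int_lower2 Int_lower2] .
  qed
  show "down_set I (P \<inter> Q\<inverse>) X"
    if XY: "X \<subseteq> I" "Y \<subseteq> I" and d: "down_set I (P \<inter> Q\<inverse>) (X \<inter> Y)" "down_set I (P \<inter> Q\<inverse>) (X \<union> Y)"
      and eq: "lower I Q z X + lower I Q z Y = lower I Q z (X \<inter> Y) + lower I Q z (X \<union> Y)"
    unfolding down_set_inner_iff
  proof (intro conjI ballI XY(1))
    fix C assume C: "C \<in> bubbles I Q"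
    have dP: "down_set I P (base Q D \<union> ((X \<inter> Y) \<inter> D))" "down_set I P (base Q D \<union> ((X \<union> Y) \<inter> D))"
      if "D \<in> bubbles I Q" for D
      using d that unfolding down_set_inner_iff by auto
    have "convex_minor I Q z C (X \<inter> C) + convex_minor I Q z C (Y \<inter> C) =
        convex_minor I Q z C ((X \<inter> Y) \<inter> C) + convex_minor I Q z C ((X \<union> Y) \<inter> C)"
    proof (rule ereal_sum_eq_imp_eq[OF finite_bubbles[OF fin pre] _ _ _ C,
          where f = "\<lambda>C. convex_minor I Q z C ((X \<inter> Y) \<inter> C) + convex_minor I Q z C ((X \<union> Y) \<inter> C)"])
      show "(\<Sum>C\<in>bubbles I Q. convex_minor I Q z C (X \<inter> C) + convex_minor I Q z C (Y \<inter> C)) =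
        (\<Sum>C\<in>bubbles I Q. convex_minor I Q z C ((X \<inter> Y) \<inter> C) + convex_minor I Q z C ((X \<union> Y) \<inter> C))"
        using eq unfolding sums[OF XY] .
      fix D assume D: "D \<in> bubbles I Q"
      note cm = convex_minor_submodular[OF z Qz D]
      show "convex_minor I Q z D ((X \<inter> Y) \<inter> D) + convex_minor I Q z D ((X \<union> Y) \<inter> D)
          \<le> convex_minor I Q z D (X \<inter> D) + convex_minor I Q z D (Y \<inter> D)"
        unfolding trace_Un_Int[of X Y D]
        using submodular_ineq[OF cm Int_lower2 Int_lower2] by (simp only: add.commute)
      show "\<bar>convex_minor I Q z D ((X \<inter> Y) \<inter> D) + convex_minor I Q z D ((X \<union> Y) \<inter> D)\<bar> \<noteq> \<infinity>"
        by (rule submodular_finite_add[OF cm Int_lower2 Int_lower2])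
          (simp_all only: convex_minor_less_PInf_iff[OF z Qz D Int_lower2] dP[OF D, THEN Pre_finite[OF P]])
    qed
    then have tight: "z (base Q C \<union> (X \<inter> C)) + z (base Q C \<union> (Y \<inter> C)) =
        z (base Q C \<union> ((X \<inter> Y) \<inter> C)) + z (base Q C \<union> ((X \<union> Y) \<inter> C))"
      unfolding convex_minor_additive[OF z Qz C Int_lower2 Int_lower2 Int_lower2 Int_lower2] .
    have "base Q C \<subseteq> I" using down_set_base[OF pre C] by (blast dest: down_set_subset)
    then have "base Q C \<union> (X \<inter> C) \<subseteq> I" "base Q C \<union> (Y \<inter> C) \<subseteq> I" using XY by auto
    from Pre_closed(1)[OF P z this] show "down_set I P (base Q C \<union> (X \<inter> C))"
      unfolding un int using dP[OF C] tight by blast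
  qed
qed

lemma bubbles_inner: "bubbles I (P \<inter> Q\<inverse>) = bubbles I P"
proof -
  have "P \<inter> Q\<inverse> \<inter> (P \<inter> Q\<inverse>)\<inverse> = P \<inter> P\<inverse>" using Pre_upper_subset by auto
  then show ?thesis by (simp only: bubbles_def)
qed

text \<open>
  \<open>P\<close> and \<open>P \<inter> Q\<inverse>\<close> have the same bubbles.  For a bubble \<open>K\<close> of \<open>P\<close> inside a bubble \<open>C\<close> of \<open>Q\<close>, its
  minor in \<open>z\<close> is computed with the lower end \<open>base Q C \<union> base P K\<close> and its minor in \<open>z\<^sub>Q\<close> with the trace
  of that set on \<open>C\<close>.
\<close>

lemma lower_inner: "lower I (P \<inter> Q\<inverse>) (lower I Q z) = lower I P z"
proof -
  note Qz = Pre_of_Pre_upper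
  note pre = Pre_upper_preorder and preP = Pre_preorder[OF P]
  note w = lower_submodular[OF fin z Qz]
  have "convex_minor I (P \<inter> Q\<inverse>) (lower I Q z) K E = convex_minor I P z K E"
    if K: "K \<in> bubbles I P" and E: "E \<subseteq> K" for K E
  proof -
    obtain y where y: "y \<in> K" using bubble_nonempty[OF preP K] by blast
    then have "y \<in> I" using bubble_subset[OF preP K] by blast
    obtain C where C: "C \<in> bubbles I Q" "y \<in> C" using bubble_exists[OF pre \<open>y \<in> I\<close>] .
    note bQ = down_set_base[OF pre C(1)] and bP = down_set_base[OF preP K]
    have KC: "K \<subseteq> C"
      using bubble_le[OF preP K] y Pre_upper_subset bubble_closed[OF pre C] by blast
    \<comment> \<open>Adding \<open>base Q C\<close> makes the lower end of \<open>K\<close> comparable with the one of \<open>C\<close>.\<close>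
    let ?A = "base Q C \<union> base P K"
    have dA: "down_set I P ?A" "down_set I P (?A \<union> K)"
      using bP Pre_upper_down_set[OF bQ(1)] by (auto simp: Un_assoc intro: down_set_Un)
    have sub: "?A \<union> K \<subseteq> base Q C \<union> C"
    proof -
      have "base P K \<subseteq> base Q C \<union> C"
      proof
        fix x assume "x \<in> base P K"
        then obtain k where "k \<in> K" "(x, k) \<in> P" by (auto simp: base_def)
        then show "x \<in> base Q C \<union> C"
          using KC Pre_upper_subset down_setD[OF bQ(2), of k x] by blast
      qed
      then show ?thesis using KC by blast
    qed
    have dj: "?A \<inter> K = {}" using base_disjoint[of P K] base_disjoint[of Q C] KC by blast
    have tr: "base Q C \<union> ((base P K \<inter> C) \<inter> C) = ?A" "base Q C \<union> ((base P K \<inter> C \<union> K) \<inter> C) = ?A \<union> K"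
      "base Q C \<union> (base P K \<inter> C) = ?A" "base Q C \<union> ((base P K \<inter> C) \<union> E) = ?A \<union> E"
      using sub KC E by blast+
    have dR: "down_set I (P \<inter> Q\<inverse>) D"
      if D: "D \<subseteq> C" and d: "down_set I P (base Q C \<union> (D \<inter> C))" for D
      unfolding down_set_inner_iff
    proof (intro conjI ballI)
      show "D \<subseteq> I" using D bubble_subset[OF pre C(1)] by blast
      fix C' assume C': "C' \<in> bubbles I Q"
      show "down_set I P (base Q C' \<union> (D \<inter> C'))"
      proof (cases "C' = C")
        case False
        then have "D \<inter> C' = {}" using D bubbles_disjoint[OF pre C(1) C'] by blast
        then show ?thesis using Pre_upper_down_set[OF down_set_base(1)[OF pre C']] by simp
      qed (use d in simp)
    qed
    have "down_set I (P \<inter> Q\<inverse>) (base P K \<inter> C)" "down_set I (P \<inter> Q\<inverse>) ((base P K \<inter> C) \<union> K)"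
      by (rule dR; use KC dA tr in auto)+
    moreover have "(base P K \<inter> C) \<inter> K = {}" using base_disjoint[of P K] by blast
    ultimately have "convex_minor I (P \<inter> Q\<inverse>) (lower I Q z) K E =
        lower I Q z ((base P K \<inter> C) \<union> E) - lower I Q z (base P K \<inter> C)"
      using convex_minor_apply[OF w inner_Pre _ _ _ E] by blast
    also have "\<dots> = (z (?A \<union> E) - z (base Q C)) - (z ?A - z (base Q C))"
    proof -
      have "base P K \<inter> C \<union> E \<subseteq> C" using KC E by blast
      then show ?thesis
        using lower_of_bubble_part[OF fin z Qz C(1)] by (simp add: tr)
    qed
    also have "\<dots> = z (?A \<union> E) - z ?A"
    proof -
      obtain b where b: "z (base Q C) = ereal b"
        using submodular_real[OF z down_set_subset[OF bQ(1)] Pre_finite[OF Qz bQ(1)]] .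
      obtain a where a: "z ?A = ereal a"
        using submodular_real[OF z down_set_subset[OF dA(1)] Pre_finite[OF P dA(1)]] .
      show ?thesis unfolding a b by (cases "z (?A \<union> E)") auto
    qed
    also have "\<dots> = convex_minor I P z K E"
      using convex_minor_apply[OF z P dA dj E] by simp
    finally show ?thesis .
  qed
  then show ?thesis
    unfolding lower_def bubbles_inner by (intro restrict_ext sum.cong) auto
qed

lemma upper_inner: "upper I (P \<inter> Q\<inverse>) (lower I Q z) = lower I Q (upper I P z)"
proof (rule extensional_Pow_eqI[of _ I])
  note Qz = Pre_of_Pre_upper
  note pre = Pre_upper_preorder
  note u = modular_imp_submodular[OF upper_modular[OF z P]]
  fix E assume E: "E \<subseteq> I"
  have cm: "convex_minor I Q (upper I P z) C (E \<inter> C) =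
      (if down_set I P (base Q C \<union> (E \<inter> C)) then convex_minor I Q z C (E \<inter> C) else \<infinity>)"
    if C: "C \<in> bubbles I Q" for C
  proof -
    note b = down_set_base[OF pre C]
    obtain r where r: "z (base Q C) = ereal r"
      using submodular_real[OF z down_set_subset[OF b(1)] Pre_finite[OF Qz b(1)]] .
    have "base Q C \<union> (E \<inter> C) \<subseteq> I" using E down_set_subset[OF b(1)] by blast
    then show ?thesis
      unfolding convex_minor_bubble[OF u Q Q C Q C Int_lower2] convex_minor_bubble[OF z Qz Qz C Qz C Int_lower2]
      using Pre_upper_down_set[OF b(1)] r by (simp add: upper_apply down_set_subset[OF b(1)])
  qed
  show "upper I (P \<inter> Q\<inverse>) (lower I Q z) E = lower I Q (upper I P z) E"
  proof (cases "down_set I (P \<inter> Q\<inverse>) E")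
    case True
    then have "convex_minor I Q (upper I P z) C (E \<inter> C) = convex_minor I Q z C (E \<inter> C)"
      if "C \<in> bubbles I Q" for C
      using cm[OF that] that unfolding down_set_inner_iff by auto
    then show ?thesis using True E by (simp add: upper_apply lower_apply)
  next
    case False
    then obtain C where "C \<in> bubbles I Q" "\<not> down_set I P (base Q C \<union> (E \<inter> C))"
      using E unfolding down_set_inner_iff by blast
    then have "\<exists>C\<in>bubbles I Q. convex_minor I Q (upper I P z) C (E \<inter> C) = \<infinity>"
      using cm by auto
    then have "lower I Q (upper I P z) E = \<infinity>"
      using finite_bubbles[OF fin pre] unfolding lower_apply[OF E] sum_Pinfty by blast
    then show ?thesis using False E by (simp add: upper_apply)
  qed
qed (auto simp: upper_def lower_def)

lemma upper_upper: "upper I Q (upper I P z) = upper I Q z"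
  using Pre_upper_down_set by (intro extensional_Pow_eqI[of _ I]) (auto simp: upper_def)

lemma lower_eq_on_finer_down_set: "down_set I P A \<Longrightarrow> lower I Q z A = z A"
  using lower_eq_on_down_set[OF fin z Pre_of_Pre_upper P Pre_upper_subset] .

end

text \<open>
  Each bubble of \<open>Q\<close> splits off as a factor of \<open>z\<^sub>Q\<close>, so no conforming preorder relates two bubbles.
\<close>

lemma Pre_lower_subset:
  assumes "finite I" and z: "z \<in> submodular_functions I" and Q: "Q \<in> Pre I z" and R: "R \<in> Pre I (lower I Q z)"
  shows "R \<subseteq> Q \<inter> Q\<inverse>"
proof -
  note pre = Pre_preorder[OF Q] and w = lower_submodular[OF assms(1-3)]
  have d: "down_set I R C" if C: "C \<in> bubbles I Q" for C
  proof (rule Pre_closed(1)[OF R w bubble_subset[OF pre C] Diff_subset])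
    have CI: "C \<inter> (I - C) = {}" "C \<union> (I - C) = I" using bubble_subset[OF pre C] by auto
    then show "down_set I R (C \<inter> (I - C))" "down_set I R (C \<union> (I - C))"
      using down_set_full[OF Pre_preorder[OF R]] by simp_all
    have "(\<Sum>D\<in>bubbles I Q. convex_minor I Q z D (C \<inter> D) + convex_minor I Q z D ((I - C) \<inter> D)) =
        (\<Sum>D\<in>bubbles I Q. convex_minor I Q z D (I \<inter> D))"
    proof (rule sum.cong[OF refl])
      fix D assume D: "D \<in> bubbles I Q"
      note cm0 = submodular_empty[OF convex_minor_submodular[OF z Q D]]
      show "convex_minor I Q z D (C \<inter> D) + convex_minor I Q z D ((I - C) \<inter> D) = convex_minor I Q z D (I \<inter> D)"
      proof (cases "D = C")
        case True
        then have "C \<inter> D = I \<inter> D" "(I - C) \<inter> D = {}" using bubble_subset[OF pre C] by auto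
        then show ?thesis by (simp add: cm0)
      next
        case False
        then have "C \<inter> D = {}" "(I - C) \<inter> D = I \<inter> D" using bubbles_disjoint[OF pre C D] by auto
        then show ?thesis by (simp add: cm0)
      qed
    qed
    then have "lower I Q z C + lower I Q z (I - C) = lower I Q z I"
      using bubble_subset[OF pre C] by (simp add: lower_apply sum.distrib)
    then show "lower I Q z C + lower I Q z (I - C) = lower I Q z (C \<inter> (I - C)) + lower I Q z (C \<union> (I - C))"
      unfolding CI submodular_empty[OF w] by simp
  qed
  show ?thesis
  proof
    fix p assume p: "p \<in> R"
    obtain x y where xy: "p = (x, y)" by (cases p)
    have "y \<in> I" using p preorder_on_subset[OF Pre_preorder[OF R]] xy by blast
    obtain C where C: "C \<in> bubbles I Q" "y \<in> C" using bubble_exists[OF pre \<open>y \<in> I\<close>] .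
    have "x \<in> C" using down_setD[OF d[OF C(1)] C(2)] p xy by blast
    then show "p \<in> Q \<inter> Q\<inverse>" using bubble_le[OF pre C(1)] C(2) xy by blast
  qed
qed

text \<open>
  A down-set of \<open>R\<close> need not be one of \<open>P\<close>, but its trace on a bubble of \<open>Q\<close> becomes one after adding
  everything strictly below the bubble, because there \<open>z\<^sub>Q\<close> is given by \<open>z\<close>.  This recovers \<open>R\<close> from
  \<open>P\<close> and \<open>Q\<close>.
\<close>

lemma lift_of_inner:
  assumes "finite I" and z: "z \<in> submodular_functions I" and Q: "Q \<in> Pre I z" and R: "R \<in> Pre I (lower I Q z)"
  defines "P \<equiv> lift_preorder I z (lower I Q z) R"
  shows "P \<in> Pre I z" "Q \<in> Pre I (upper I P z)" "P \<inter> Q\<inverse> = R"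
    "down_set I P A \<longleftrightarrow> down_set I R A \<and> z A = lower I Q z A"
proof -
  note pre = Pre_preorder[OF Q] and w = lower_submodular[OF assms(1-3)]
  note preR = Pre_preorder[OF R]
  note lift = lift_preorder[OF \<open>finite I\<close> z w lower_le[OF assms(1-3)] lower_full[OF assms(1-3)] R, folded P_def]
  show P: "P \<in> Pre I z" and ds: "down_set I P A \<longleftrightarrow> down_set I R A \<and> z A = lower I Q z A" for A
    using lift by auto
  note preP = Pre_preorder[OF P]
  note RQ = Pre_lower_subset[OF assms(1-4)]
  have QP: "down_set I P A" if A: "down_set I Q A" for A
    unfolding ds using A RQ down_set_anti_mono[of R Q I A] lower_eq_on_down_set[OF assms(1-3) Q _ A] by auto
  then have PQ: "P \<subseteq> Q" by (rule preorder_subsetI[OF preP pre])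
  show QPre: "Q \<in> Pre I (upper I P z)"
    unfolding Pre_upper_iff[OF z P]
  proof (intro conjI allI impI pre PQ)
    fix X Y assume d: "down_set I P X" "down_set I P Y" "down_set I Q (X \<inter> Y)" "down_set I Q (X \<union> Y)"
    show "down_set I Q X"
      using Pre_closed(1)[OF Q z _ _ d(3,4) Pre_modular[OF P z d(1,2)]] d by (simp add: down_set_subset)
  qed
  note inner = down_set_Int_converse_iff[OF preP pre PQ]
  show "P \<inter> Q\<inverse> = R"
  proof (rule preorder_eqI[OF preorder_on_Int_converse[OF preP pre] preR])
    fix A
    have "R \<subseteq> P" by (rule preorder_subsetI[OF preR preP]) (simp add: ds)
    then have "R \<subseteq> P \<inter> Q\<inverse>" using RQ by blast
    moreover have "down_set I (P \<inter> Q\<inverse>) A" if A: "down_set I R A"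
      unfolding inner
    proof (intro conjI ballI down_set_subset[OF A])
      fix C assume C: "C \<in> bubbles I Q"
      note b = down_set_base[OF pre C]
      let ?A = "base Q C \<union> (A \<inter> C)"
      have "R \<subseteq> Q" "R \<subseteq> Q\<inverse>" using RQ by auto
      have sub: "base Q C \<subseteq> I" "A \<subseteq> I" "?A \<subseteq> I"
        using down_set_subset[OF b(1)] down_set_subset[OF A] by auto
      have dC: "down_set I R C"
        using RQ bubble_closed[OF pre C] bubble_subset[OF pre C] unfolding down_set_def by blast
      have db: "down_set I R (base Q C)" using down_set_anti_mono[OF \<open>R \<subseteq> Q\<close> b(1)] .
      have dAC: "down_set I R (A \<inter> C)" using A dC by (rule down_set_Int)
      have int: "base Q C \<inter> (A \<inter> C) = {}" using base_disjoint[of Q C] by blast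
      have "lower I Q z (base Q C) + lower I Q z (A \<inter> C) = lower I Q z ?A"
        using Pre_modular[OF R w db dAC] unfolding int submodular_empty[OF w] by simp
      moreover have "lower I Q z (base Q C) = z (base Q C)"
        using lower_eq_on_down_set[OF assms(1-3) Q _ b(1)] by blast
      moreover have "lower I Q z (A \<inter> C) = z ?A - z (base Q C)"
        by (rule lower_of_bubble_part[OF assms(1-3) C]) blast
      moreover obtain r where "z (base Q C) = ereal r"
        using submodular_real[OF z sub(1) Pre_finite[OF Q b(1)]] .
      ultimately have "lower I Q z ?A = z ?A" by (cases "z ?A") auto
      then show "down_set I P ?A" unfolding ds using db dAC by (auto intro: down_set_Un)
    qed
    ultimately show "down_set I (P \<inter> Q\<inverse>) A \<longleftrightarrow> down_set I R A"
      using down_set_anti_mono by blast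
  qed
qed

text \<open>
  A face of a face is a face: a conforming \<open>Q\<close> together with a preorder conforming to \<open>z\<^sub>Q\<close> is the
  same as a conforming \<open>P\<close> together with a preorder conforming to \<open>z\<^sup>P\<close>.
\<close>

lemma bij_betw_iterated_Pre:
  assumes "finite I" and z: "z \<in> submodular_functions I"
  shows "bij_betw (\<lambda>(P, Q). (Q, P \<inter> Q\<inverse>)) (SIGMA P:Pre I z. Pre I (upper I P z))
    (SIGMA Q:Pre I z. Pre I (lower I Q z))"
proof (rule bij_betw_byWitness[where f' = "\<lambda>(Q, R). (lift_preorder I z (lower I Q z) R, Q)"])
  show "\<forall>a\<in>(SIGMA P:Pre I z. Pre I (upper I P z)).
      (case case a of (P, Q) \<Rightarrow> (Q, P \<inter> Q\<inverse>) of (Q, R) \<Rightarrow> (lift_preorder I z (lower I Q z) R, Q)) = a"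
  proof
    fix a assume "a \<in> (SIGMA P:Pre I z. Pre I (upper I P z))"
    then obtain P Q where a: "a = (P, Q)" and P: "P \<in> Pre I z" and Q: "Q \<in> Pre I (upper I P z)" by blast
    let ?L = "lift_preorder I z (lower I Q z) (P \<inter> Q\<inverse>)"
    note pq = \<open>finite I\<close> z P Q
    note L = lift_of_inner[OF \<open>finite I\<close> z Pre_of_Pre_upper[OF pq] inner_Pre[OF pq]]
    have "?L = P"
    proof (rule Pre_eq_if_same_bubbles[OF \<open>finite I\<close> z P L(1)])
      show "?L \<subseteq> P"
        by (rule preorder_subsetI[OF Pre_preorder[OF L(1)] Pre_preorder[OF P]])
          (use lower_eq_on_finer_down_set[OF pq] down_set_anti_mono[of "P \<inter> Q\<inverse>" P] in \<open>auto simp: L(4)\<close>)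
      have "P \<inter> P\<inverse> \<subseteq> P \<inter> Q\<inverse>" using Pre_upper_subset[OF pq] by auto
      then show "P \<inter> P\<inverse> \<subseteq> ?L" using L(3) by blast
    qed
    then show "(case case a of (P, Q) \<Rightarrow> (Q, P \<inter> Q\<inverse>) of
        (Q, R) \<Rightarrow> (lift_preorder I z (lower I Q z) R, Q)) = a"
      by (simp add: a)
  qed
  show "\<forall>a'\<in>(SIGMA Q:Pre I z. Pre I (lower I Q z)).
      (case case a' of (Q, R) \<Rightarrow> (lift_preorder I z (lower I Q z) R, Q) of (P, Q) \<Rightarrow> (Q, P \<inter> Q\<inverse>)) = a'"
    using lift_of_inner(3)[OF assms] by auto
  show "(\<lambda>(P, Q). (Q, P \<inter> Q\<inverse>)) ` (SIGMA P:Pre I z. Pre I (upper I P z))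
      \<subseteq> (SIGMA Q:Pre I z. Pre I (lower I Q z))"
    using Pre_of_Pre_upper[OF assms] inner_Pre[OF assms] by auto
  show "(\<lambda>(Q, R). (lift_preorder I z (lower I Q z) R, Q)) ` (SIGMA Q:Pre I z. Pre I (lower I Q z))
      \<subseteq> (SIGMA P:Pre I z. Pre I (upper I P z))"
    using lift_of_inner(1,2)[OF assms] by auto
qed

section \<open>The preorder of finite values and the counit\<close>

lemma pre_unique:
  assumes "preorder_on I P" "\<And>A. A \<subseteq> I \<Longrightarrow> down_set I P A \<longleftrightarrow> z A < \<infinity>"
  shows "pre I z = P"
  unfolding pre_def
proof (rule the_equality)
  show "preorder_on I P \<and> (\<forall>A\<subseteq>I. down_set I P A \<longleftrightarrow> z A < \<infinity>)" using assms by blast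
  fix Q assume "preorder_on I Q \<and> (\<forall>A\<subseteq>I. down_set I Q A \<longleftrightarrow> z A < \<infinity>)"
  then show "Q = P" using assms by (intro preorder_eqI[of I]) (auto dest: down_set_subset)
qed

lemma pre_props:
  assumes "finite I" and z: "z \<in> submodular_functions I"
  shows preorder_on_pre: "preorder_on I (pre I z)"
    and down_set_pre_iff: "down_set I (pre I z) A \<longleftrightarrow> A \<subseteq> I \<and> z A < \<infinity>"
proof -
  let ?L = "{A. A \<subseteq> I \<and> z A < \<infinity>}"
  have d: "down_set I (preorder_of_ring I ?L) A \<longleftrightarrow> A \<in> ?L" for A
    by (rule down_set_preorder_of_ring[OF \<open>finite I\<close>])
      (use submodular_finite_Un_Int[OF z] submodular_full[OF z] submodular_empty[OF z] in auto)
  have "pre I z = preorder_of_ring I ?L"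
    by (rule pre_unique[OF preorder_on_preorder_of_ring]) (simp only: d mem_Collect_eq simp_thms)
  then show "preorder_on I (pre I z)" "down_set I (pre I z) A \<longleftrightarrow> A \<subseteq> I \<and> z A < \<infinity>"
    using preorder_on_preorder_of_ring d by (simp_all only: mem_Collect_eq)
qed

text \<open>
  In this form total disconnectedness is easily compared under relabelling and products.
\<close>

lemma equiv_pre_iff:
  assumes "finite I" "z \<in> submodular_functions I"
  shows "equiv I (pre I z) \<longleftrightarrow> (\<forall>A\<subseteq>I. z A < \<infinity> \<longrightarrow> z (I - A) < \<infinity>)"
  unfolding equiv_iff_down_sets_complement[OF preorder_on_pre[OF assms]] down_set_pre_iff[OF assms] by blast

lemma pre_Pre:
  assumes "finite I" and z: "z \<in> modular_functions I"
  shows "pre I z \<in> Pre I z"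
proof (rule PreI)
  note s = modular_imp_submodular[OF z]
  note d = down_set_pre_iff[OF \<open>finite I\<close> s]
  show "z \<in> submodular_functions I" by (rule s)
  show "preorder_on I (pre I z)" by (rule preorder_on_pre[OF \<open>finite I\<close> s])
  fix X
  show "z X < \<infinity>" if "down_set I (pre I z) X" using that unfolding d by blast
  fix Y
  show "z X + z Y = z (X \<inter> Y) + z (X \<union> Y)" if "down_set I (pre I z) X" "down_set I (pre I z) Y"
    using that modular_eq[OF z, of X Y] unfolding d by (simp add: add.commute)
  show "down_set I (pre I z) X"
    if XY: "X \<subseteq> I" "Y \<subseteq> I" and "down_set I (pre I z) (X \<inter> Y)" "down_set I (pre I z) (X \<union> Y)"
      and eq: "z X + z Y = z (X \<inter> Y) + z (X \<union> Y)"
  proof -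
    have "z (X \<inter> Y) + z (X \<union> Y) < \<infinity>" using that unfolding d by simp
    then have "z X + z Y < \<infinity>" using eq by simp
    then show ?thesis
      unfolding d using XY submodular_not_MInf[OF s XY(2)] by auto
  qed
qed

lemma upper_pre:
  assumes "finite I" and z: "z \<in> modular_functions I"
  shows "upper I (pre I z) z = z"
proof (rule extensional_Pow_eqI[of _ I])
  note s = modular_imp_submodular[OF z]
  show "z \<in> extensional (Pow I)" by (rule submodular_extensional[OF s])
  fix E assume "E \<subseteq> I"
  then show "upper I (pre I z) z E = z E"
    by (cases "z E < \<infinity>") (auto simp: upper_apply down_set_pre_iff[OF \<open>finite I\<close> s])
qed (simp add: upper_def)

lemma pre_upper:
  assumes z: "z \<in> submodular_functions I" and Q: "Q \<in> Pre I z"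
  shows "pre I (upper I Q z) = Q"
  by (rule pre_unique[OF Pre_preorder[OF Q]]) (use Pre_finite[OF Q] in \<open>auto simp: upper_apply\<close>)

text \<open>
  An equivalence relation is a preorder whose down-sets are closed under complements.  If it conforms
  to \<open>z\<close>, its down-sets must therefore be the blocks of the decompositions of \<open>z\<close> into two factors;
  its classes are the connected components of \<open>z\<close>.
\<close>

definition decomposition_relation :: "'i set \<Rightarrow> ('i set \<Rightarrow> ereal) \<Rightarrow> 'i rel" where
  "decomposition_relation I z = preorder_of_ring I {A. A \<subseteq> I \<and> z A + z (I - A) = z I}"

lemma additive_split:
  assumes z: "z \<in> submodular_functions I" and A: "A \<subseteq> I" "z A + z (I - A) = z I" and E: "E \<subseteq> I"
  shows "z E = z (E \<inter> A) + z (E - A)"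
proof -
  have "decomposes z I A (I - A)"
    unfolding decomposes_iff_additive[OF z] using A by auto
  then have "z E = z (E \<inter> A) + z (E \<inter> (I - A))" using E unfolding decomposes_def by blast
  moreover have "E \<inter> (I - A) = E - A" using E by blast
  ultimately show ?thesis by simp
qed

text \<open>
  For conformity: if \<open>z\<close> decomposes along \<open>X \<inter> Y\<close> and along \<open>X \<union> Y\<close>, it is the product of its parts on
  \<open>X \<inter> Y\<close>, on the symmetric difference of \<open>X\<close> and \<open>Y\<close> and on the complement of \<open>X \<union> Y\<close>; the modular
  law at \<open>X\<close>, \<open>Y\<close> splits the middle factor further into \<open>X - Y\<close> and \<open>Y - X\<close>.
\<close>

lemma decomposition_relation:
  assumes "finite I" and z: "z \<in> submodular_functions I"
  shows "decomposition_relation I z \<in> Pre I z" "equiv I (decomposition_relation I z)"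
    and "down_set I (decomposition_relation I z) A \<longleftrightarrow> A \<subseteq> I \<and> z A + z (I - A) = z I"
proof -
  let ?L = "{A. A \<subseteq> I \<and> z A + z (I - A) = z I}"
  let ?Q = "decomposition_relation I z"
  obtain r where r: "z I = ereal r" using submodular_real[OF z subset_refl submodular_full[OF z]] .
  note ni = submodular_not_MInf[OF z]
  have fin: "z A < \<infinity>" if "A \<in> ?L" for A
    using that r ni[of "I - A"] by (cases "z A"; cases "z (I - A)") auto
  have compl: "I - A \<in> ?L" if "A \<in> ?L" for A
    using that by (auto simp: double_diff add.commute)
  \<comment> \<open>First split \<open>A \<union> B\<close> and \<open>I - A\<close> along \<open>A\<close> and \<open>B\<close>; the term \<open>z (B - A)\<close> occurs in both.\<close>
  have un: "A \<union> B \<in> ?L" if A: "A \<in> ?L" and B: "B \<in> ?L" for A B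
  proof -
    have s: "(A \<union> B) \<inter> A = A" "(A \<union> B) - A = B - A" "(I - A) \<inter> B = B - A" "(I - A) - B = I - (A \<union> B)"
      using A B by auto
    have "z (A \<union> B) = z A + z (B - A)"
      using additive_split[OF z, of A "A \<union> B"] A B by (simp add: s)
    moreover have "z (I - A) = z (B - A) + z (I - (A \<union> B))"
      using additive_split[OF z, of B "I - A"] B by (simp only: s mem_Collect_eq Diff_subset simp_thms)
    ultimately show ?thesis using A B by (auto simp: add.assoc)
  qed
  have int: "A \<inter> B \<in> ?L" if A: "A \<in> ?L" and B: "B \<in> ?L" for A B
  proof -
    have "I - ((I - A) \<union> (I - B)) = A \<inter> B" using A B by auto
    then show ?thesis using compl[OF un[OF compl[OF A] compl[OF B]]] by simp
  qed
  have ds: "down_set I ?Q A \<longleftrightarrow> A \<in> ?L" for A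
    unfolding decomposition_relation_def
    by (rule down_set_preorder_of_ring[OF \<open>finite I\<close> _ _ _ un int]) (auto simp: submodular_empty[OF z])
  have pre: "preorder_on I ?Q" by (simp add: decomposition_relation_def preorder_on_preorder_of_ring)
  show "down_set I ?Q A \<longleftrightarrow> A \<subseteq> I \<and> z A + z (I - A) = z I" unfolding ds by simp
  show "equiv I ?Q"
    unfolding equiv_iff_down_sets_complement[OF pre] ds using compl by blast
  show "?Q \<in> Pre I z"
  proof (rule PreI[OF z pre])
    fix X
    show "z X < \<infinity>" if "down_set I ?Q X" using that fin ds by blast
    fix Y
    show "z X + z Y = z (X \<inter> Y) + z (X \<union> Y)" if "down_set I ?Q X" "down_set I ?Q Y"
    proof -
      have X: "X \<in> ?L" and Y: "Y \<in> ?L" using that ds by auto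
      have "z Y = z (Y \<inter> X) + z (Y - X)" using additive_split[OF z, of X Y] X Y by blast
      moreover have "z (X \<union> Y) = z X + z (Y - X)"
      proof -
        have "(X \<union> Y) \<inter> X = X" "(X \<union> Y) - X = Y - X" by auto
        then show ?thesis using additive_split[OF z, of X "X \<union> Y"] X Y by simp
      qed
      ultimately show ?thesis by (simp add: ac_simps Int_commute)
    qed
    show "down_set I ?Q X"
      if XY: "X \<subseteq> I" "Y \<subseteq> I" and d: "down_set I ?Q (X \<inter> Y)" "down_set I ?Q (X \<union> Y)"
        and eq: "z X + z Y = z (X \<inter> Y) + z (X \<union> Y)"
    proof -
      have L: "X \<inter> Y \<in> ?L" "X \<union> Y \<in> ?L" using d ds by auto
      note A = additive_split[OF z, of "X \<inter> Y"] and B = additive_split[OF z, of "X \<union> Y"]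
      have s: "X \<inter> (X \<inter> Y) = X \<inter> Y" "X - X \<inter> Y = X - Y" "Y \<inter> (X \<inter> Y) = X \<inter> Y" "Y - X \<inter> Y = Y - X"
        "(I - X) \<inter> (X \<union> Y) = Y - X" "(I - X) - (X \<union> Y) = I - (X \<union> Y)" using XY by auto
      have "z X = z (X \<inter> Y) + z (X - Y)" using A[of X] L XY by (simp only: s mem_Collect_eq simp_thms)
      moreover have "z Y = z (X \<inter> Y) + z (Y - X)" using A[of Y] L XY by (simp only: s mem_Collect_eq simp_thms)
      moreover have "z (I - X) = z (Y - X) + z (I - (X \<union> Y))"
        using B[of "I - X"] L by (simp only: s mem_Collect_eq simp_thms Diff_subset)
      moreover have "z (X \<union> Y) + z (I - (X \<union> Y)) = z I" using L by blast
      moreover obtain a where "z (X \<inter> Y) = ereal a"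
        using submodular_real[OF z _ fin[OF L(1)]] L by blast
      moreover obtain b where "z (X \<union> Y) = ereal b"
        using submodular_real[OF z _ fin[OF L(2)]] L by blast
      moreover have "z (X - Y) \<noteq> - \<infinity>" "z (Y - X) \<noteq> - \<infinity>" "z (I - (X \<union> Y)) \<noteq> - \<infinity>"
        using ni[of "X - Y"] ni[of "Y - X"] ni[of "I - (X \<union> Y)"] XY by auto
      ultimately have "z X + z (I - X) = z I"
        using eq r by (cases "z (X - Y)"; cases "z (Y - X)"; cases "z (I - (X \<union> Y))") auto
      then show ?thesis unfolding ds using XY by blast
    qed
  qed
qed

lemma equiv_Pre_unique:
  assumes "finite I" and z: "z \<in> submodular_functions I" and Q: "Q \<in> Pre I z" and eq: "equiv I Q"
  shows "Q = decomposition_relation I z"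
proof (rule preorder_eqI[OF Pre_preorder[OF Q] Pre_preorder[OF decomposition_relation(1)[OF assms(1,2)]]])
  fix A
  have "A \<inter> (I - A) = {}" and un: "A \<subseteq> I \<Longrightarrow> A \<union> (I - A) = I" by auto
  note full = down_set_full[OF Pre_preorder[OF Q]]
  show "down_set I Q A \<longleftrightarrow> down_set I (decomposition_relation I z) A"
    unfolding decomposition_relation(3)[OF assms(1,2)]
  proof
    assume A: "down_set I Q A"
    then have "down_set I Q (I - A)"
      using eq equiv_iff_down_sets_complement[OF Pre_preorder[OF Q]] by blast
    from Pre_modular[OF Q z A this] show "A \<subseteq> I \<and> z A + z (I - A) = z I"
      using down_set_subset[OF A] un submodular_empty[OF z] by simp
  next
    assume A: "A \<subseteq> I \<and> z A + z (I - A) = z I"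
    show "down_set I Q A"
      by (rule Pre_closed(1)[OF Q z _ Diff_subset[of I A]])
        (use A un full submodular_empty[OF z] in simp_all)
  qed
qed

lemma lower_decomposition_relation:
  assumes "finite I" and z: "z \<in> submodular_functions I"
  shows "lower I (decomposition_relation I z) z = z"
proof (rule extensional_Pow_eqI[OF _ submodular_extensional[OF z]])
  let ?Q = "decomposition_relation I z"
  note Q = decomposition_relation(1,2)[OF assms]
  note pre = Pre_preorder[OF Q(1)]
  show "lower I ?Q z \<in> extensional (Pow I)" by (simp add: lower_def)
  have sym: "(y, x) \<in> ?Q" if "(x, y) \<in> ?Q" for x y using Q(2) that by (auto simp: equiv_def dest: symD)
  have base: "base ?Q C = {}" if C: "C \<in> bubbles I ?Q" for C
    using bubble_closed[OF pre C] sym by (auto simp: base_def)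
  fix E assume E: "E \<subseteq> I"
  have "lower I ?Q z E = (\<Sum>C\<in>bubbles I ?Q. z (E \<inter> C))"
    unfolding lower_apply[OF E]
  proof (rule sum.cong[OF refl])
    fix C assume C: "C \<in> bubbles I ?Q"
    show "convex_minor I ?Q z C (E \<inter> C) = z (E \<inter> C)"
      unfolding convex_minor_bubble[OF z Q(1) Q(1) C Q(1) C Int_lower2] base[OF C] submodular_empty[OF z] by simp
  qed
  also have "(\<Sum>C\<in>F. z (E \<inter> C)) = z (E \<inter> \<Union> F)" if "finite F" "F \<subseteq> bubbles I ?Q" for F
    using that
  proof (induction F rule: finite_induct)
    case empty
    then show ?case by (simp add: submodular_empty[OF z])
  next
    case (insert C F)
    have C: "C \<in> bubbles I ?Q" using insert.prems by blast
    have dC: "down_set I ?Q C" using down_set_base(2)[OF pre C] by (simp add: base[OF C])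
    have dj: "C \<inter> \<Union> F = {}" using bubbles_disjoint[OF pre C] insert.hyps(2) insert.prems by blast
    have s: "(E \<inter> \<Union> (insert C F)) \<inter> C = E \<inter> C" "(E \<inter> \<Union> (insert C F)) - C = E \<inter> \<Union> F" using dj by auto
    have "E \<inter> \<Union> (insert C F) \<subseteq> I" using E by blast
    then have "z (E \<inter> \<Union> (insert C F)) = z (E \<inter> C) + z (E \<inter> \<Union> F)"
      using additive_split[OF z, of C "E \<inter> \<Union> (insert C F)"] dC
      unfolding s decomposition_relation(3)[OF assms] by blast
    then show ?case using insert by simp
  qed
  then have "(\<Sum>C\<in>bubbles I ?Q. z (E \<inter> C)) = z (E \<inter> \<Union> (bubbles I ?Q))"
    using finite_bubbles[OF \<open>finite I\<close> pre] by blast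
  also have "E \<inter> \<Union> (bubbles I ?Q) = E" using E bubble_exists[OF pre] by blast
  finally show "lower I ?Q z E = z E" .
qed

text \<open>
  With \<open>P = pre z\<close> one has \<open>z = z\<^sup>P\<close> and \<open>pre z\<^sub>Q = P \<inter> Q\<inverse>\<close>.  If this is symmetric, then the part
  of a bubble of \<open>Q\<close> equivalent to one of its elements splits off as a \<open>P\<close>-disconnected block.  As
  \<open>Q\<close> conforms to \<open>z\<^sup>P\<close> the block is the whole bubble, so \<open>P\<close> and \<open>Q\<close> have the same bubbles.
\<close>

lemma equiv_pre_lower_iff:
  assumes "finite I" and z: "z \<in> modular_functions I" and Q: "Q \<in> Pre I z"
  shows "equiv I (pre I (lower I Q z)) \<longleftrightarrow> Q = pre I z"
proof -
  note s = modular_imp_submodular[OF z]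
  define P where "P = pre I z"
  have P: "P \<in> Pre I z" using pre_Pre[OF assms(1,2)] by (simp add: P_def)
  have up: "upper I P z = z" using upper_pre[OF assms(1,2)] by (simp add: P_def)
  have Q': "Q \<in> Pre I (upper I P z)" using Q by (simp add: up)
  note pq = \<open>finite I\<close> s P Q'
  define R where "R = P \<inter> Q\<inverse>"
  have R: "R \<in> Pre I (lower I Q z)" using inner_Pre[OF pq] by (simp add: R_def)
  have "upper I R (lower I Q z) = lower I Q z" using upper_inner[OF pq] by (simp add: R_def up)
  then have pre_R: "pre I (lower I Q z) = R"
    using pre_upper[OF lower_submodular[OF \<open>finite I\<close> s Q] R] by simp
  note preP = Pre_preorder[OF P] and preQ = Pre_preorder[OF Q] and preR = Pre_preorder[OF R]
  show ?thesis unfolding pre_R P_def[symmetric]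
  proof
    assume "Q = P"
    then have "R = P \<inter> P\<inverse>" by (simp add: R_def)
    then show "equiv I R" using preR by (auto simp: equiv_def preorder_on_def sym_def)
  next
    assume eqR: "equiv I R"
    have "Q \<inter> Q\<inverse> \<subseteq> P"
    proof
      fix p assume p: "p \<in> Q \<inter> Q\<inverse>"
      obtain x y where xy: "p = (x, y)" "(x, y) \<in> Q" "(y, x) \<in> Q" using p by (cases p) auto
      then have I: "x \<in> I" "y \<in> I" using preorder_on_subset[OF preQ] by auto
      obtain C where C: "C \<in> bubbles I Q" "y \<in> C" using bubble_exists[OF preQ I(2)] .
      have "x \<in> C" using bubble_closed[OF preQ C xy(2,3)] .
      define D where "D = {u. (u, y) \<in> R}"
      have "down_set I R D" "down_set I R (I - D)"
        using down_set_below[OF preR] equiv_iff_down_sets_complement[OF preR] eqR by (auto simp: D_def)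
      then have d: "down_set I P (base Q C \<union> (D \<inter> C))" "down_set I P (base Q C \<union> ((I - D) \<inter> C))"
        using C(1) unfolding R_def down_set_inner_iff[OF pq] by blast+
      have "(base Q C \<union> (D \<inter> C)) \<inter> (base Q C \<union> ((I - D) \<inter> C)) = base Q C"
        "(base Q C \<union> (D \<inter> C)) \<union> (base Q C \<union> ((I - D) \<inter> C)) = base Q C \<union> C"
        using bubble_subset[OF preQ C(1)] by auto
      then have "down_set I Q (base Q C \<union> (D \<inter> C))"
        using Pre_closed(1)[OF Q s _ _ _ _ Pre_modular[OF P s d]] down_set_base[OF preQ C(1)]
          d[THEN down_set_subset] by simp
      moreover have "y \<in> base Q C \<union> (D \<inter> C)"
        using C(2) preorder_on_refl[OF preR I(2)] by (simp add: D_def)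
      ultimately have "C \<subseteq> base Q C \<union> (D \<inter> C)"
        using bubble_in_down_set[OF preQ C(1) _ C(2)] by blast
      then have "x \<in> D" using \<open>x \<in> C\<close> base_disjoint[of Q C] by blast
      then show "p \<in> P" by (simp add: D_def R_def xy(1))
    qed
    then have "P = Q" by (rule Pre_eq_if_same_bubbles[OF \<open>finite I\<close> s Q P Pre_upper_subset[OF pq]])
    then show "Q = P" by simp
  qed
qed

section \<open>Relabelling\<close>

text \<open>
  The action of \<open>\<sigma>\<close> on basis elements in \<open>SM_map\<close>; on images it is characterised by \<open>relabel_image\<close>.
\<close>

definition relabel :: "('i \<Rightarrow> 'i) \<Rightarrow> 'i set \<Rightarrow> ('i set \<Rightarrow> ereal) \<Rightarrow> 'i set \<Rightarrow> ereal" where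
  "relabel \<sigma> I z = (\<lambda>B\<in>Pow (\<sigma> ` I). z (\<sigma> -` B \<inter> I))"

lemma vimage_image_on: "inj_on \<sigma> I \<Longrightarrow> E \<subseteq> I \<Longrightarrow> \<sigma> -` (\<sigma> ` E) \<inter> I = E"
  by (auto dest: inj_onD)

lemma relabel_image: "inj_on \<sigma> I \<Longrightarrow> E \<subseteq> I \<Longrightarrow> relabel \<sigma> I z (\<sigma> ` E) = z E"
  by (simp add: relabel_def vimage_image_on image_mono)

lemma relabel_extensional [simp]: "relabel \<sigma> I z \<in> extensional (Pow (\<sigma> ` I))"
  by (simp add: relabel_def)

lemma relabel_eqI:
  assumes "v \<in> extensional (Pow (\<sigma> ` I))" "inj_on \<sigma> I" "\<And>E. E \<subseteq> I \<Longrightarrow> v (\<sigma> ` E) = z E"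
  shows "v = relabel \<sigma> I z"
proof (rule extensional_Pow_eqI[OF assms(1) relabel_extensional])
  fix B assume "B \<subseteq> \<sigma> ` I"
  then obtain E where "E \<subseteq> I" "B = \<sigma> ` E" by (auto simp: subset_image_iff)
  then show "v B = relabel \<sigma> I z B" using assms(2,3) by (simp add: relabel_image)
qed

lemma relabel_submodular:
  assumes z: "z \<in> submodular_functions I" and inj: "inj_on \<sigma> I"
  shows "relabel \<sigma> I z \<in> submodular_functions (\<sigma> ` I)"
proof (rule submodular_functionsI)
  show "relabel \<sigma> I z {} = 0" using relabel_image[OF inj, of "{}"] submodular_empty[OF z] by simp
  show "relabel \<sigma> I z (\<sigma> ` I) < \<infinity>" using relabel_image[OF inj subset_refl] submodular_full[OF z] by simp
  fix A assume "A \<subseteq> \<sigma> ` I"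
  then obtain A' where A: "A' \<subseteq> I" "A = \<sigma> ` A'" by (auto simp: subset_image_iff)
  then show "relabel \<sigma> I z A \<noteq> - \<infinity>" using submodular_not_MInf[OF z] by (simp add: relabel_image[OF inj])
  fix B assume "B \<subseteq> \<sigma> ` I"
  then obtain B' where B: "B' \<subseteq> I" "B = \<sigma> ` B'" by (auto simp: subset_image_iff)
  have "A' \<union> B' \<subseteq> I" "A' \<inter> B' \<subseteq> I" using A B by auto
  then show "relabel \<sigma> I z (A \<union> B) + relabel \<sigma> I z (A \<inter> B) \<le> relabel \<sigma> I z A + relabel \<sigma> I z B"
    using submodular_ineq[OF z A(1) B(1)]
    by (simp add: A B inj_on_image_Int[OF inj A(1) B(1), symmetric] image_Un[symmetric] relabel_image[OF inj])
qed simp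

lemma relabel_modular:
  assumes z: "z \<in> modular_functions I" and inj: "inj_on \<sigma> I"
  shows "relabel \<sigma> I z \<in> modular_functions (\<sigma> ` I)"
proof (rule modular_functionsI[OF relabel_submodular[OF modular_imp_submodular[OF z] inj]])
  fix A B assume "A \<subseteq> \<sigma> ` I" "B \<subseteq> \<sigma> ` I" and fin: "relabel \<sigma> I z A < \<infinity>" "relabel \<sigma> I z B < \<infinity>"
  then obtain A' B' where A: "A' \<subseteq> I" "A = \<sigma> ` A'" and B: "B' \<subseteq> I" "B = \<sigma> ` B'"
    by (auto simp: subset_image_iff)
  have "A' \<union> B' \<subseteq> I" "A' \<inter> B' \<subseteq> I" using A B by auto
  then show "relabel \<sigma> I z (A \<union> B) + relabel \<sigma> I z (A \<inter> B) = relabel \<sigma> I z A + relabel \<sigma> I z B"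
    using modular_eq[OF z A(1) B(1)] fin
    by (simp add: A B inj_on_image_Int[OF inj A(1) B(1), symmetric] image_Un[symmetric] relabel_image[OF inj])
qed

lemma relabel_id: "z \<in> submodular_functions I \<Longrightarrow> relabel id I z = z"
  by (rule extensional_Pow_eqI[of _ I, OF _ submodular_extensional])
    (auto simp: relabel_def Int_absorb2)

lemma relabel_comp:
  assumes "inj_on \<sigma> I" "inj_on \<sigma>' (\<sigma> ` I)"
  shows "relabel \<sigma>' (\<sigma> ` I) (relabel \<sigma> I z) = relabel (\<sigma>' \<circ> \<sigma>) I z"
proof (rule relabel_eqI)
  show "relabel \<sigma>' (\<sigma> ` I) (relabel \<sigma> I z) \<in> extensional (Pow ((\<sigma>' \<circ> \<sigma>) ` I))"
    unfolding image_comp[symmetric] by (rule relabel_extensional)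
  show "inj_on (\<sigma>' \<circ> \<sigma>) I" by (rule comp_inj_on[OF assms])
  fix E assume "E \<subseteq> I"
  then have "\<sigma> ` E \<subseteq> \<sigma> ` I" by blast
  show "relabel \<sigma>' (\<sigma> ` I) (relabel \<sigma> I z) ((\<sigma>' \<circ> \<sigma>) ` E) = z E"
    unfolding image_comp[symmetric] relabel_image[OF assms(2) \<open>\<sigma> ` E \<subseteq> \<sigma> ` I\<close>]
    by (rule relabel_image[OF assms(1) \<open>E \<subseteq> I\<close>])
qed

lemma relabel_cong: "(\<And>i. i \<in> I \<Longrightarrow> \<sigma> i = \<sigma>' i) \<Longrightarrow> relabel \<sigma> I z = relabel \<sigma>' I z"
proof -
  assume eq: "\<And>i. i \<in> I \<Longrightarrow> \<sigma> i = \<sigma>' i"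
  then have "\<sigma> ` I = \<sigma>' ` I" "\<And>B. \<sigma> -` B \<inter> I = \<sigma>' -` B \<inter> I" by auto
  then show ?thesis by (simp add: relabel_def)
qed

lemma restriction_relabel:
  assumes "inj_on \<sigma> I" "S \<subseteq> I"
  shows "restriction (relabel \<sigma> I z) (\<sigma> ` S) = relabel \<sigma> S (restriction z S)"
proof (rule relabel_eqI)
  show "inj_on \<sigma> S" using assms inj_on_subset by blast
  fix E assume "E \<subseteq> S"
  moreover from this have "\<sigma> ` E \<subseteq> \<sigma> ` S" "E \<subseteq> I" using assms(2) by auto
  ultimately show "restriction (relabel \<sigma> I z) (\<sigma> ` S) (\<sigma> ` E) = restriction z S E"
    by (simp add: restriction_apply relabel_image[OF assms(1)])
qed (simp add: restriction_def)

lemma contraction_relabel: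
  assumes "inj_on \<sigma> I" "S \<subseteq> I"
  shows "contraction (\<sigma> ` I) (relabel \<sigma> I z) (\<sigma> ` S) = relabel \<sigma> (I - S) (contraction I z S)"
proof (rule relabel_eqI)
  have d: "\<sigma> ` I - \<sigma> ` S = \<sigma> ` (I - S)" using inj_on_image_set_diff[OF assms(1) Diff_subset assms(2)] by blast
  show "contraction (\<sigma> ` I) (relabel \<sigma> I z) (\<sigma> ` S) \<in> extensional (Pow (\<sigma> ` (I - S)))"
    by (simp add: contraction_def d)
  show "inj_on \<sigma> (I - S)" using assms inj_on_subset by blast
  fix E assume E: "E \<subseteq> I - S"
  then have "\<sigma> ` E \<subseteq> \<sigma> ` I - \<sigma> ` S" "S \<union> E \<subseteq> I" unfolding d using assms(2) by auto
  then show "contraction (\<sigma> ` I) (relabel \<sigma> I z) (\<sigma> ` S) (\<sigma> ` E) = contraction I z S E"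
    using E assms(2) by (simp add: contraction_apply image_Un[symmetric] relabel_image[OF assms(1)])
qed

lemma set_prod_relabel:
  assumes inj: "inj_on \<sigma> (S \<union> T)"
  shows "set_prod (\<sigma> ` S) (\<sigma> ` T) (relabel \<sigma> S u) (relabel \<sigma> T v) = relabel \<sigma> (S \<union> T) (set_prod S T u v)"
proof (rule relabel_eqI[OF _ inj])
  show "set_prod (\<sigma> ` S) (\<sigma> ` T) (relabel \<sigma> S u) (relabel \<sigma> T v) \<in> extensional (Pow (\<sigma> ` (S \<union> T)))"
    by (simp add: set_prod_def image_Un)
  fix E assume E: "E \<subseteq> S \<union> T"
  have "inj_on \<sigma> S" "inj_on \<sigma> T" using inj by (auto simp: inj_on_Un)
  moreover have "\<sigma> ` E \<subseteq> \<sigma> ` S \<union> \<sigma> ` T" using E by auto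
  moreover have "\<sigma> ` E \<inter> \<sigma> ` S = \<sigma> ` (E \<inter> S)" "\<sigma> ` E \<inter> \<sigma> ` T = \<sigma> ` (E \<inter> T)"
    using inj_on_image_Int[OF inj E, symmetric] by auto
  ultimately show "set_prod (\<sigma> ` S) (\<sigma> ` T) (relabel \<sigma> S u) (relabel \<sigma> T v) (\<sigma> ` E) = set_prod S T u v E"
    using E by (simp add: set_prod_apply relabel_image)
qed

abbreviation image_rel :: "('i \<Rightarrow> 'i) \<Rightarrow> 'i rel \<Rightarrow> 'i rel" where
  "image_rel \<sigma> P \<equiv> map_prod \<sigma> \<sigma> ` P"

lemma image_rel_iff:
  assumes "inj_on \<sigma> I" "preorder_on I P" "x \<in> I" "y \<in> I"
  shows "(\<sigma> x, \<sigma> y) \<in> image_rel \<sigma> P \<longleftrightarrow> (x, y) \<in> P"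
proof
  assume "(\<sigma> x, \<sigma> y) \<in> image_rel \<sigma> P"
  then obtain a b where "(a, b) \<in> P" "\<sigma> x = \<sigma> a" "\<sigma> y = \<sigma> b" by auto
  moreover from this have "a \<in> I" "b \<in> I" using preorder_on_subset[OF assms(2)] by auto
  ultimately show "(x, y) \<in> P" using assms by (metis inj_onD)
qed force

lemma preorder_on_image_rel:
  assumes inj: "inj_on \<sigma> I" and P: "preorder_on I P"
  shows "preorder_on (\<sigma> ` I) (image_rel \<sigma> P)"
  unfolding preorder_on_def
proof (intro conjI)
  show "image_rel \<sigma> P \<subseteq> \<sigma> ` I \<times> \<sigma> ` I" using preorder_on_subset[OF P] by auto
  show "refl_on (\<sigma> ` I) (image_rel \<sigma> P)"
    unfolding refl_on_def using preorder_on_refl[OF P] by force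
  show "trans (image_rel \<sigma> P)"
  proof (rule transI)
    fix a b c assume "(a, b) \<in> image_rel \<sigma> P" "(b, c) \<in> image_rel \<sigma> P"
    then obtain x y y' w where *: "(x, y) \<in> P" "(y', w) \<in> P" "a = \<sigma> x" "b = \<sigma> y" "b = \<sigma> y'" "c = \<sigma> w" by auto
    then have "y = y'" using preorder_on_subset[OF P] inj by (metis inj_onD)
    then have "(x, w) \<in> P" using * preorder_on_trans[OF P] by blast
    then show "(a, c) \<in> image_rel \<sigma> P" using * by force
  qed
qed

lemma down_set_image_rel:
  assumes inj: "inj_on \<sigma> I" and P: "preorder_on I P" and A: "A \<subseteq> I"
  shows "down_set (\<sigma> ` I) (image_rel \<sigma> P) (\<sigma> ` A) \<longleftrightarrow> down_set I P A"
proof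
  assume d: "down_set (\<sigma> ` I) (image_rel \<sigma> P) (\<sigma> ` A)"
  have "x \<in> A" if "y \<in> A" "(x, y) \<in> P" for x y
  proof -
    have "\<sigma> x \<in> \<sigma> ` A" using down_setD[OF d, of "\<sigma> y" "\<sigma> x"] that by force
    then show ?thesis using inj A preorder_on_subset[OF P that(2)] by (auto dest: inj_onD)
  qed
  with A show "down_set I P A" by (auto simp: down_set_def)
next
  assume d: "down_set I P A"
  have "a \<in> \<sigma> ` A" if ab: "b \<in> \<sigma> ` A" "(a, b) \<in> image_rel \<sigma> P" for a b
  proof -
    obtain x y where xy: "(x, y) \<in> P" "a = \<sigma> x" "b = \<sigma> y" using ab by auto
    then have "y \<in> A" using ab(1) inj A preorder_on_subset[OF P xy(1)] by (auto dest: inj_onD)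
    then show ?thesis using down_setD[OF d _ xy(1)] xy by blast
  qed
  with A show "down_set (\<sigma> ` I) (image_rel \<sigma> P) (\<sigma> ` A)" by (auto simp: down_set_def)
qed

lemma image_rel_Pre:
  assumes z: "z \<in> submodular_functions I" and inj: "inj_on \<sigma> I" and P: "P \<in> Pre I z"
  shows "image_rel \<sigma> P \<in> Pre (\<sigma> ` I) (relabel \<sigma> I z)"
proof (rule PreI[OF relabel_submodular[OF z inj]])
  note pre = Pre_preorder[OF P]
  note d = down_set_image_rel[OF inj pre] and r = relabel_image[OF inj]
  show "preorder_on (\<sigma> ` I) (image_rel \<sigma> P)" by (rule preorder_on_image_rel[OF inj pre])
  fix X
  show "relabel \<sigma> I z X < \<infinity>" if X: "down_set (\<sigma> ` I) (image_rel \<sigma> P) X"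
  proof -
    obtain X' where X': "X' \<subseteq> I" "X = \<sigma> ` X'" using down_set_subset[OF X] by (auto simp: subset_image_iff)
    then show ?thesis using X Pre_finite[OF P, of X'] d[OF X'(1)] r[OF X'(1)] by metis
  qed
  fix Y
  show "relabel \<sigma> I z X + relabel \<sigma> I z Y = relabel \<sigma> I z (X \<inter> Y) + relabel \<sigma> I z (X \<union> Y)"
    if XY: "down_set (\<sigma> ` I) (image_rel \<sigma> P) X" "down_set (\<sigma> ` I) (image_rel \<sigma> P) Y"
  proof -
    obtain X' Y' where *: "X' \<subseteq> I" "X = \<sigma> ` X'" "Y' \<subseteq> I" "Y = \<sigma> ` Y'"
      using XY[THEN down_set_subset] by (auto simp: subset_image_iff)
    have "X' \<inter> Y' \<subseteq> I" "X' \<union> Y' \<subseteq> I" using * by auto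
    moreover have "X \<inter> Y = \<sigma> ` (X' \<inter> Y')" "X \<union> Y = \<sigma> ` (X' \<union> Y')"
      using * inj_on_image_Int[OF inj *(1,3), symmetric] by (auto simp: image_Un)
    moreover have "z X' + z Y' = z (X' \<inter> Y') + z (X' \<union> Y')"
      using Pre_modular[OF P z] XY d[OF *(1)] d[OF *(3)] * by blast
    ultimately show ?thesis using r * by simp
  qed
  show "down_set (\<sigma> ` I) (image_rel \<sigma> P) X"
    if XY: "X \<subseteq> \<sigma> ` I" "Y \<subseteq> \<sigma> ` I" and dXY: "down_set (\<sigma> ` I) (image_rel \<sigma> P) (X \<inter> Y)"
      "down_set (\<sigma> ` I) (image_rel \<sigma> P) (X \<union> Y)"
      and eq: "relabel \<sigma> I z X + relabel \<sigma> I z Y = relabel \<sigma> I z (X \<inter> Y) + relabel \<sigma> I z (X \<union> Y)"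
  proof -
    obtain X' Y' where *: "X' \<subseteq> I" "X = \<sigma> ` X'" "Y' \<subseteq> I" "Y = \<sigma> ` Y'"
      using XY by (auto simp: subset_image_iff)
    have s: "X' \<inter> Y' \<subseteq> I" "X' \<union> Y' \<subseteq> I" using * by auto
    have i: "X \<inter> Y = \<sigma> ` (X' \<inter> Y')" "X \<union> Y = \<sigma> ` (X' \<union> Y')"
      using * inj_on_image_Int[OF inj *(1,3), symmetric] by (auto simp: image_Un)
    have "down_set I P (X' \<inter> Y')" "down_set I P (X' \<union> Y')" using dXY d[OF s(1)] d[OF s(2)] unfolding i by auto
    moreover have "z X' + z Y' = z (X' \<inter> Y') + z (X' \<union> Y')"
      using eq unfolding i unfolding *(2,4) r[OF *(1)] r[OF *(3)] r[OF s(1)] r[OF s(2)] .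
    ultimately have "down_set I P X'" using Pre_closed(1)[OF P z *(1,3)] by blast
    then show ?thesis using d[OF *(1)] *(2) by simp
  qed
qed

text \<open>
  The inverse bijection is transport along the inverse of \<open>\<sigma>\<close>, which undoes the relabelling of \<open>z\<close>.
\<close>

lemma bij_betw_image_rel_Pre:
  assumes z: "z \<in> submodular_functions I" and inj: "inj_on \<sigma> I"
  shows "bij_betw (image_rel \<sigma>) (Pre I z) (Pre (\<sigma> ` I) (relabel \<sigma> I z))"
proof (rule bij_betw_byWitness[where f' = "image_rel (inv_into I \<sigma>)"])
  define \<tau> where "\<tau> = inv_into I \<sigma>"
  have inj': "inj_on \<tau> (\<sigma> ` I)" and im: "\<tau> ` \<sigma> ` I = I"
    using inj by (auto simp: \<tau>_def inj_on_inv_into)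
  have ts: "\<tau> (\<sigma> x) = x" if "x \<in> I" for x using inj that by (simp add: \<tau>_def)
  have st: "\<sigma> (\<tau> y) = y" if "y \<in> \<sigma> ` I" for y using that by (simp add: \<tau>_def f_inv_into_f)
  have "relabel \<tau> (\<sigma> ` I) (relabel \<sigma> I z) = relabel id I z"
    unfolding relabel_comp[OF inj inj'] by (rule relabel_cong) (simp add: ts)
  then have inverse: "relabel \<tau> (\<sigma> ` I) (relabel \<sigma> I z) = z" by (simp add: relabel_id[OF z])
  show "\<forall>P\<in>Pre I z. image_rel (inv_into I \<sigma>) (image_rel \<sigma> P) = P"
  proof
    fix P assume "P \<in> Pre I z"
    note sub = preorder_on_subset[OF Pre_preorder[OF this]]
    have "image_rel \<tau> (image_rel \<sigma> P) = (\<lambda>p. p) ` P"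
      unfolding image_image by (rule image_cong) (use sub ts in auto)
    then show "image_rel (inv_into I \<sigma>) (image_rel \<sigma> P) = P" by (simp add: \<tau>_def)
  qed
  show "\<forall>P\<in>Pre (\<sigma> ` I) (relabel \<sigma> I z). image_rel \<sigma> (image_rel (inv_into I \<sigma>) P) = P"
  proof
    fix P assume "P \<in> Pre (\<sigma> ` I) (relabel \<sigma> I z)"
    note sub = preorder_on_subset[OF Pre_preorder[OF this]]
    have "image_rel \<sigma> (image_rel \<tau> P) = (\<lambda>p. p) ` P"
      unfolding image_image
    proof (rule image_cong[OF refl])
      fix p assume "p \<in> P"
      then have "fst p \<in> \<sigma> ` I" "snd p \<in> \<sigma> ` I" using sub[of "fst p" "snd p"] by auto
      then show "map_prod \<sigma> \<sigma> (map_prod \<tau> \<tau> p) = p" by (simp add: map_prod_def split_beta st)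
    qed
    then show "image_rel \<sigma> (image_rel (inv_into I \<sigma>) P) = P" by (simp add: \<tau>_def)
  qed
  show "image_rel \<sigma> ` Pre I z \<subseteq> Pre (\<sigma> ` I) (relabel \<sigma> I z)"
    using image_rel_Pre[OF z inj] by blast
  have "image_rel \<tau> P \<in> Pre I z" if "P \<in> Pre (\<sigma> ` I) (relabel \<sigma> I z)" for P
    using image_rel_Pre[OF relabel_submodular[OF z inj] inj' that] unfolding inverse im .
  then show "image_rel (inv_into I \<sigma>) ` Pre (\<sigma> ` I) (relabel \<sigma> I z) \<subseteq> Pre I z"
    unfolding \<tau>_def by (rule image_subsetI)
qed

lemma bubbles_image_rel:
  assumes inj: "inj_on \<sigma> I" and P: "preorder_on I P"
  shows "bubbles (\<sigma> ` I) (image_rel \<sigma> P) = (`) \<sigma> ` bubbles I P"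
proof -
  note iff = image_rel_iff[OF inj P] and sub = preorder_on_subset[OF P]
    and sub' = preorder_on_subset[OF preorder_on_image_rel[OF inj P]]
  have eq: "{a. (a, \<sigma> y) \<in> image_rel \<sigma> P \<and> (\<sigma> y, a) \<in> image_rel \<sigma> P} = \<sigma> ` {x. (x, y) \<in> P \<and> (y, x) \<in> P}"
    if y: "y \<in> I" for y
  proof (rule set_eqI)
    fix a
    show "a \<in> {a. (a, \<sigma> y) \<in> image_rel \<sigma> P \<and> (\<sigma> y, a) \<in> image_rel \<sigma> P} \<longleftrightarrow>
        a \<in> \<sigma> ` {x. (x, y) \<in> P \<and> (y, x) \<in> P}"
    proof (cases "a \<in> \<sigma> ` I")
      case True
      then obtain x where x: "x \<in> I" "a = \<sigma> x" by blast
      have "\<sigma> x \<in> \<sigma> ` {x. (x, y) \<in> P \<and> (y, x) \<in> P} \<longleftrightarrow> (x, y) \<in> P \<and> (y, x) \<in> P"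
        using inj x sub by (auto dest: inj_onD)
      then show ?thesis using iff[OF x(1) y] iff[OF y x(1)] by (simp add: x(2))
    next
      case False
      then show ?thesis using sub' sub by blast
    qed
  qed
  show ?thesis
  proof (rule set_eqI)
    fix C
    have "C \<in> bubbles (\<sigma> ` I) (image_rel \<sigma> P) \<longleftrightarrow>
        (\<exists>y\<in>I. C = {a. (a, \<sigma> y) \<in> image_rel \<sigma> P \<and> (\<sigma> y, a) \<in> image_rel \<sigma> P})"
      unfolding bubbles_iff by blast
    also have "\<dots> \<longleftrightarrow> (\<exists>y\<in>I. C = \<sigma> ` {x. (x, y) \<in> P \<and> (y, x) \<in> P})"
      by (simp only: eq cong: bex_cong)
    also have "\<dots> \<longleftrightarrow> C \<in> (`) \<sigma> ` bubbles I P"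
      by (simp only: image_iff Bex_def bubbles_iff) blast
    finally show "C \<in> bubbles (\<sigma> ` I) (image_rel \<sigma> P) \<longleftrightarrow> C \<in> (`) \<sigma> ` bubbles I P" .
  qed
qed

lemma lower_relabel:
  assumes z: "z \<in> submodular_functions I" and inj: "inj_on \<sigma> I" and P: "P \<in> Pre I z"
  shows "lower (\<sigma> ` I) (image_rel \<sigma> P) (relabel \<sigma> I z) = relabel \<sigma> I (lower I P z)"
proof (rule relabel_eqI[OF _ inj])
  note pre = Pre_preorder[OF P] and P' = image_rel_Pre[OF z inj P]
  note z' = relabel_submodular[OF z inj]
  show "lower (\<sigma> ` I) (image_rel \<sigma> P) (relabel \<sigma> I z) \<in> extensional (Pow (\<sigma> ` I))"
    by (simp add: lower_def)
  fix E assume E: "E \<subseteq> I"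
  then have E': "\<sigma> ` E \<subseteq> \<sigma> ` I" by blast
  have inj_b: "inj_on ((`) \<sigma>) (bubbles I P)"
  proof (rule inj_onI)
    fix C D assume "C \<in> bubbles I P" "D \<in> bubbles I P" and eq: "\<sigma> ` C = \<sigma> ` D"
    then have "C \<subseteq> I" "D \<subseteq> I" using bubble_subset[OF pre] by auto
    then show "C = D" using eq inj by (simp add: inj_on_image_eq_iff)
  qed
  have "lower (\<sigma> ` I) (image_rel \<sigma> P) (relabel \<sigma> I z) (\<sigma> ` E) =
      (\<Sum>C\<in>bubbles I P. convex_minor (\<sigma> ` I) (image_rel \<sigma> P) (relabel \<sigma> I z) (\<sigma> ` C) (\<sigma> ` E \<inter> \<sigma> ` C))"
    unfolding lower_apply[OF E'] bubbles_image_rel[OF inj pre] by (simp add: sum.reindex[OF inj_b])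
  also have "\<dots> = (\<Sum>C\<in>bubbles I P. convex_minor I P z C (E \<inter> C))"
  proof (rule sum.cong[OF refl])
    fix C assume C: "C \<in> bubbles I P"
    note b = down_set_base[OF pre C]
    have s: "base P C \<subseteq> I" "base P C \<union> C \<subseteq> I" "C \<subseteq> I" "base P C \<union> (E \<inter> C) \<subseteq> I"
      using b[THEN down_set_subset] by auto
    have EC: "\<sigma> ` E \<inter> \<sigma> ` C = \<sigma> ` (E \<inter> C)" by (rule inj_on_image_Int[OF inj E s(3), symmetric])
    have d: "down_set (\<sigma> ` I) (image_rel \<sigma> P) (\<sigma> ` base P C)"
      "down_set (\<sigma> ` I) (image_rel \<sigma> P) (\<sigma> ` base P C \<union> \<sigma> ` C)"
      using b down_set_image_rel[OF inj pre] s unfolding image_Un[symmetric] by auto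
    have "\<sigma> ` base P C \<inter> \<sigma> ` C = {}"
      using inj_on_image_Int[OF inj s(1,3), symmetric] base_disjoint[of P C] by simp
    then have "convex_minor (\<sigma> ` I) (image_rel \<sigma> P) (relabel \<sigma> I z) (\<sigma> ` C) (\<sigma> ` (E \<inter> C)) =
        relabel \<sigma> I z (\<sigma> ` base P C \<union> \<sigma> ` (E \<inter> C)) - relabel \<sigma> I z (\<sigma> ` base P C)"
      by (intro convex_minor_apply[OF z' P' d]) auto
    also have "\<dots> = convex_minor I P z C (E \<inter> C)"
      unfolding convex_minor_bubble[OF z P P C P C Int_lower2] image_Un[symmetric]
      by (simp only: relabel_image[OF inj s(4)] relabel_image[OF inj s(1)])
    finally show "convex_minor (\<sigma> ` I) (image_rel \<sigma> P) (relabel \<sigma> I z) (\<sigma> ` C) (\<sigma> ` E \<inter> \<sigma> ` C) =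
        convex_minor I P z C (E \<inter> C)"
      unfolding EC .
  qed
  finally show "lower (\<sigma> ` I) (image_rel \<sigma> P) (relabel \<sigma> I z) (\<sigma> ` E) = lower I P z E"
    by (simp only: lower_apply[OF E])
qed

lemma upper_relabel:
  assumes inj: "inj_on \<sigma> I" and P: "preorder_on I P"
  shows "upper (\<sigma> ` I) (image_rel \<sigma> P) (relabel \<sigma> I z) = relabel \<sigma> I (upper I P z)"
proof (rule relabel_eqI[OF _ inj])
  fix E assume E: "E \<subseteq> I"
  then have "\<sigma> ` E \<subseteq> \<sigma> ` I" by blast
  with E show "upper (\<sigma> ` I) (image_rel \<sigma> P) (relabel \<sigma> I z) (\<sigma> ` E) = upper I P z E"
    by (simp add: upper_apply relabel_image[OF inj] down_set_image_rel[OF inj P])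
qed (simp add: upper_def)

lemma equiv_pre_relabel:
  assumes "finite I" and z: "z \<in> submodular_functions I" and inj: "inj_on \<sigma> I"
  shows "equiv (\<sigma> ` I) (pre (\<sigma> ` I) (relabel \<sigma> I z)) \<longleftrightarrow> equiv I (pre I z)"
proof -
  have compl: "\<sigma> ` I - \<sigma> ` A = \<sigma> ` (I - A)" if "A \<subseteq> I" for A
    using inj_on_image_set_diff[OF inj Diff_subset that] by blast
  have "equiv (\<sigma> ` I) (pre (\<sigma> ` I) (relabel \<sigma> I z)) \<longleftrightarrow>
      (\<forall>A\<subseteq>\<sigma> ` I. relabel \<sigma> I z A < \<infinity> \<longrightarrow> relabel \<sigma> I z (\<sigma> ` I - A) < \<infinity>)"
    by (rule equiv_pre_iff[OF finite_imageI[OF \<open>finite I\<close>] relabel_submodular[OF z inj]])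
  also have "\<dots> \<longleftrightarrow> (\<forall>A\<subseteq>I. relabel \<sigma> I z (\<sigma> ` A) < \<infinity> \<longrightarrow> relabel \<sigma> I z (\<sigma> ` I - \<sigma> ` A) < \<infinity>)"
    by (rule all_subset_image)
  also have "\<dots> \<longleftrightarrow> (\<forall>A\<subseteq>I. z A < \<infinity> \<longrightarrow> z (I - A) < \<infinity>)"
    by (intro all_cong) (simp only: compl relabel_image[OF inj] Diff_subset)
  also have "\<dots> \<longleftrightarrow> equiv I (pre I z)" by (rule equiv_pre_iff[OF assms(1,2), symmetric])
  finally show ?thesis .
qed

lemma equiv_pre_set_prod:
  assumes "finite S" "finite T" and ST: "S \<inter> T = {}"
    and u: "u \<in> submodular_functions S" and v: "v \<in> submodular_functions T"
  shows "equiv (S \<union> T) (pre (S \<union> T) (set_prod S T u v)) \<longleftrightarrow> equiv S (pre S u) \<and> equiv T (pre T v)"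
proof -
  note iff = equiv_pre_iff[OF finite_UnI[OF assms(1,2)] set_prod_submodular[OF u v]]
    equiv_pre_iff[OF assms(1) u] equiv_pre_iff[OF assms(2) v]
  note fin = set_prod_less_PInf_iff[OF u v]
  show ?thesis
    unfolding iff
  proof (intro iffI conjI allI impI)
    fix A assume *: "\<forall>A\<subseteq>S \<union> T. set_prod S T u v A < \<infinity> \<longrightarrow> set_prod S T u v (S \<union> T - A) < \<infinity>" and A: "A \<subseteq> S" "u A < \<infinity>"
    have s: "A \<subseteq> S \<union> T" "A \<inter> S = A" "A \<inter> T = {}" "(S \<union> T - A) \<inter> S = S - A" "S \<union> T - A \<subseteq> S \<union> T"
      using A ST by auto
    have "set_prod S T u v A < \<infinity>" unfolding fin[OF s(1)] s using A submodular_empty[OF v] by simp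
    then have "set_prod S T u v (S \<union> T - A) < \<infinity>" using * s(1) by blast
    then show "u (S - A) < \<infinity>" unfolding fin[OF s(5)] s by blast
  next
    fix A assume *: "\<forall>A\<subseteq>S \<union> T. set_prod S T u v A < \<infinity> \<longrightarrow> set_prod S T u v (S \<union> T - A) < \<infinity>" and A: "A \<subseteq> T" "v A < \<infinity>"
    have s: "A \<subseteq> S \<union> T" "A \<inter> S = {}" "A \<inter> T = A" "(S \<union> T - A) \<inter> T = T - A" "S \<union> T - A \<subseteq> S \<union> T"
      using A ST by auto
    have "set_prod S T u v A < \<infinity>" unfolding fin[OF s(1)] s using A submodular_empty[OF u] by simp
    then have "set_prod S T u v (S \<union> T - A) < \<infinity>" using * s(1) by blast
    then show "v (T - A) < \<infinity>" unfolding fin[OF s(5)] s by blast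
  next
    fix A assume *: "(\<forall>A\<subseteq>S. u A < \<infinity> \<longrightarrow> u (S - A) < \<infinity>) \<and> (\<forall>A\<subseteq>T. v A < \<infinity> \<longrightarrow> v (T - A) < \<infinity>)"
      and A: "A \<subseteq> S \<union> T" "set_prod S T u v A < \<infinity>"
    have s: "(S \<union> T - A) \<inter> S = S - A \<inter> S" "(S \<union> T - A) \<inter> T = T - A \<inter> T" "S \<union> T - A \<subseteq> S \<union> T" by auto
    show "set_prod S T u v (S \<union> T - A) < \<infinity>"
      unfolding fin[OF s(3)] s
      using A(2)[unfolded fin[OF A(1)]] *[THEN conjunct1, rule_format, OF Int_lower2]
        *[THEN conjunct2, rule_format, OF Int_lower2] by (intro conjI) auto
  qed
qed

section \<open>Linear maps determined by their values on bases\<close>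

text \<open>
  In this form linear maps on free spaces and on their tensor products are compared by
  \<open>linear_eq_on_span\<close>.
\<close>

lemma free_space_eq_span: "free_space X = span (basis ` X)"
proof
  show "free_space X \<subseteq> span (basis ` X)"
  proof
    fix p :: "'a \<Rightarrow>\<^sub>0 real" assume "p \<in> free_space X"
    then have keys: "Poly_Mapping.keys p \<subseteq> X" by (simp add: free_space_def)
    have "p = lin_ext basis p" using linear_eq_lin_ext[OF linear_id, of p] by simp
    also have "\<dots> \<in> span (basis ` X)"
      unfolding lin_ext_def using keys by (intro span_sum span_scale span_base) auto
    finally show "p \<in> span (basis ` X)" .
  qed
  show "span (basis ` X) \<subseteq> free_space X"
  proof (rule span_minimal)
    show "basis ` X \<subseteq> free_space X" by (auto simp: free_space_def basis_def)
    show "subspace (free_space X)"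
      unfolding subspace_def free_space_def
      by (auto simp: in_keys_iff dest!: subsetD[OF Poly_Mapping.keys_add] simp del: not_in_keys_iff_lookup_eq_zero)
  qed
qed

lemma tensor_space_memI: "v \<in> V \<Longrightarrow> w \<in> W \<Longrightarrow> v \<otimes> w \<in> V \<otimes>\<^sub>s W"
  unfolding tensor_space_def by (rule span_base) blast

lemma linear_pure_right: "linear ((\<otimes>) a)"
  and linear_pure_left: "linear (\<lambda>a. a \<otimes> b)"
  using bilinear_pure_tensor by (auto simp: bilinear_def)

lemma tensor_space_span: "span A \<otimes>\<^sub>s span B = span {a \<otimes> b | a b. a \<in> A \<and> b \<in> B}"
proof
  let ?T = "{a \<otimes> b | a b. a \<in> A \<and> b \<in> B}"
  have 1: "a \<otimes> w \<in> span ?T" if "a \<in> A" "w \<in> span B" for a w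
    using that(2)
  proof (induction rule: span_induct_alt)
    case base
    then show ?case by (simp add: linear_0[OF linear_pure_right] span_zero)
  next
    case (step c x y)
    have "a \<otimes> x \<in> span ?T" using that(1) step.hyps by (intro span_base) blast
    then show ?case unfolding tensor_bilin by (intro span_add span_scale step.IH)
  qed
  have 2: "v \<otimes> w \<in> span ?T" if "v \<in> span A" "w \<in> span B" for v w
    using that(1)
  proof (induction rule: span_induct_alt)
    case base
    then show ?case by (simp add: linear_0[OF linear_pure_left] span_zero)
  next
    case (step c x y)
    show ?case unfolding tensor_bilin by (intro span_add span_scale step.IH 1[OF step.hyps that(2)])
  qed
  show "span A \<otimes>\<^sub>s span B \<subseteq> span ?T"
    unfolding tensor_space_def by (rule span_minimal) (auto intro: 2 subspace_span)
  show "span ?T \<subseteq> span A \<otimes>\<^sub>s span B"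
    unfolding tensor_space_def by (rule span_mono) (auto intro: span_base)
qed

lemma lin_maps_spanI:
  "linear f \<Longrightarrow> subspace W \<Longrightarrow> (\<And>a. a \<in> A \<Longrightarrow> f a \<in> W) \<Longrightarrow> f \<in> lin_maps (span A) W"
  unfolding lin_maps_def
proof safe
  fix x assume f: "linear f" "subspace W" "\<And>a. a \<in> A \<Longrightarrow> f a \<in> W" and "x \<in> span A"
  from this(4) show "f x \<in> W"
  proof (induction rule: span_induct_alt)
    case base
    show ?case by (simp add: linear_0[OF f(1)] subspace_0[OF f(2)])
  next
    case (step c x y)
    show ?case
      unfolding linear_add[OF f(1)] linear_cmul[OF f(1)]
      by (intro subspace_add[OF f(2)] subspace_scale[OF f(2)] f(3) step)
  qed
qed

lemma subspace_tensor_space: "subspace (V \<otimes>\<^sub>s W)"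
  by (simp add: tensor_space_def)

lemma tensor_map_lin_maps:
  assumes "f \<in> lin_maps V V'" "g \<in> lin_maps W W'"
  shows "f \<otimes>\<^sub>m g \<in> lin_maps (V \<otimes>\<^sub>s W) (V' \<otimes>\<^sub>s W')"
proof -
  have l: "linear f" "linear g" using assms by (auto simp: lin_maps_def)
  show ?thesis
    unfolding tensor_space_def[of V W]
    by (rule lin_maps_spanI[OF linear_tensor_map[OF l] subspace_tensor_space])
      (use assms in \<open>auto simp: tensor_map_pure[OF l] lin_maps_def image_subset_iff intro!: tensor_space_memI\<close>)
qed

lemma lin_maps_comp: "f \<in> lin_maps U V \<Longrightarrow> g \<in> lin_maps V W \<Longrightarrow> g \<circ> f \<in> lin_maps U W"
  by (auto simp: lin_maps_def intro: linear_compose)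

lemma id_lin_maps: "id \<in> lin_maps V V"
  by (simp add: lin_maps_def linear_id)

lemma tensor_sum_left: "(\<Sum>i\<in>A. f i) \<otimes> b = (\<Sum>i\<in>A. f i \<otimes> b)"
  by (rule linear_sum[OF linear_pure_left])

lemma tensor_sum_right: "a \<otimes> (\<Sum>i\<in>A. f i) = (\<Sum>i\<in>A. a \<otimes> f i)"
  by (rule linear_sum[OF linear_pure_right])

lemma bilinear_scaleR_left: "bilinear (\<lambda>r a. r *\<^sub>R a)"
  by (auto intro!: bilinear_tensorI linearI simp: scaleR_add_left scaleR_add_right)

lemma bilinear_scaleR_right: "bilinear (\<lambda>a r. r *\<^sub>R a)"
  by (auto intro!: bilinear_tensorI linearI simp: scaleR_add_left scaleR_add_right)

lemma tensor_lunit_pure [simp]: "tensor_lunit (r \<otimes> a) = r *\<^sub>R a"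
  by (simp add: tensor_lunit_def bilinear_scaleR_left)

lemma tensor_runit_pure [simp]: "tensor_runit (a \<otimes> r) = r *\<^sub>R a"
  by (simp add: tensor_runit_def bilinear_scaleR_right)

lemma linear_tensor_lunit: "linear tensor_lunit"
  unfolding tensor_lunit_def by (rule linear_tensor_lift[OF bilinear_scaleR_left])

lemma linear_tensor_runit: "linear tensor_runit"
  unfolding tensor_runit_def by (rule linear_tensor_lift[OF bilinear_scaleR_right])

lemma bilinear_mult_linear:
  fixes f :: "'a::real_vector \<Rightarrow> real" and g :: "'b::real_vector \<Rightarrow> real"
  assumes "linear f" "linear g"
  shows "bilinear (\<lambda>a b. f a * g b)"
  by (auto intro!: bilinear_tensorI linearI simp: linear_add[OF assms(1)] linear_add[OF assms(2)]
      linear_cmul[OF assms(1)] linear_cmul[OF assms(2)] algebra_simps)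

section \<open>The structure maps on basis elements\<close>

lemma SM_eq_span: "SM I = span (basis ` submodular_functions I)"
  by (simp add: SM_def free_space_eq_span)

lemma MOD_eq_span: "MOD I = span (basis ` modular_functions I)"
  by (simp add: MOD_def free_space_eq_span)

lemma MOD_subset_SM: "MOD I \<subseteq> SM I"
  unfolding MOD_eq_span SM_eq_span using modular_imp_submodular by (intro span_mono) auto

lemma basis_SM: "z \<in> submodular_functions I \<Longrightarrow> basis z \<in> SM I"
  unfolding SM_eq_span by (intro span_base) auto

lemma basis_MOD: "z \<in> modular_functions I \<Longrightarrow> basis z \<in> MOD I"
  unfolding MOD_eq_span by (intro span_base) auto

lemma subspace_SM: "subspace (SM I)" and subspace_MOD: "subspace (MOD I)"
  by (simp_all add: SM_eq_span MOD_eq_span)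

lemma linear_eq_on_SM:
  assumes "linear f" "linear g" "\<And>z. z \<in> submodular_functions I \<Longrightarrow> f (basis z) = g (basis z)" "x \<in> SM I"
  shows "f x = g x"
  by (rule linear_eq_on_span[OF assms(1,2) _ assms(4)[unfolded SM_eq_span]]) (elim imageE, simp only: assms(3))

lemma linear_eq_on_MOD:
  assumes "linear f" "linear g" "\<And>z. z \<in> modular_functions I \<Longrightarrow> f (basis z) = g (basis z)" "x \<in> MOD I"
  shows "f x = g x"
  by (rule linear_eq_on_span[OF assms(1,2) _ assms(4)[unfolded MOD_eq_span]]) (elim imageE, simp only: assms(3))

text \<open>
  All structure maps are linear extensions, so identities between them are checked on basis elements.
\<close>

lemma linear_eq_on_MOD_tensor:
  assumes "linear f" "linear g"
    and "\<And>u v. u \<in> modular_functions S \<Longrightarrow> v \<in> modular_functions T \<Longrightarrow> f (basis u \<otimes> basis v) = g (basis u \<otimes> basis v)"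
    and "t \<in> MOD S \<otimes>\<^sub>s MOD T"
  shows "f t = g t"
  by (rule linear_eq_on_span[OF assms(1,2) _ assms(4)[unfolded MOD_eq_span tensor_space_span]])
    (elim imageE CollectE exE conjE, simp only: assms(3))

lemma linear_eq_on_MOD_tensor3:
  assumes "linear f" "linear g"
    and "\<And>r u v. r \<in> modular_functions R \<Longrightarrow> u \<in> modular_functions S \<Longrightarrow> v \<in> modular_functions T \<Longrightarrow>
      f ((basis r \<otimes> basis u) \<otimes> basis v) = g ((basis r \<otimes> basis u) \<otimes> basis v)"
    and "t \<in> (MOD R \<otimes>\<^sub>s MOD S) \<otimes>\<^sub>s MOD T"
  shows "f t = g t"
  by (rule linear_eq_on_span[OF assms(1,2) _ assms(4)[unfolded MOD_eq_span tensor_space_span]])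
    (elim imageE CollectE exE conjE, simp only: assms(3))

lemma linear_SM_map: "linear (SM_map \<sigma> I)"
  by (simp add: SM_map_def linear_lin_ext)

lemma linear_SM_mu: "linear (SM_mu S T)"
  unfolding SM_mu_def by (rule linear_tensor_lift[OF linear_tensor_lift_lin_ext])

lemma linear_SM_Delta: "linear (SM_Delta S T)"
  by (simp add: SM_Delta_def linear_lin_ext)

lemma linear_SM_eps: "linear (SM_eps I)"
  by (simp add: SM_eps_def linear_lin_ext)

lemma linear_SM_delta: "linear (SM_delta I)"
  by (simp add: SM_delta_def linear_lin_ext)

lemma linear_MOD_eps: "linear (MOD_eps I)"
  by (simp add: MOD_eps_def linear_lin_ext)

lemma linear_SM_eta: "linear (SM_eta I)"
  by (rule linearI) (simp_all add: SM_eta_def scaleR_add_left)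

lemmas linear_structure_maps = linear_SM_map linear_SM_mu linear_SM_Delta linear_SM_eps linear_SM_delta
  linear_MOD_eps linear_SM_eta linear_tensor_assoc linear_swap23 linear_tensor_lunit linear_tensor_runit
  linear_id linear_compose linear_tensor_map linear_pure_left linear_pure_right

lemma SM_map_basis: "SM_map \<sigma> I (basis z) = basis (relabel \<sigma> I z)"
  by (simp add: SM_map_def relabel_def)

lemma SM_Delta_basis: "SM_Delta S T (basis z) =
    (if z S < \<infinity> then basis (restriction z S) \<otimes> basis (contraction (S \<union> T) z S) else 0)"
  by (simp add: SM_Delta_def)

lemma SM_eps_basis: "SM_eps I (basis z) = (if I = {} then 1 else 0)"
  by (simp add: SM_eps_def)

lemma SM_delta_basis: "SM_delta I (basis z) = (\<Sum>Q\<in>Pre I z. basis (lower I Q z) \<otimes> basis (upper I Q z))"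
  by (simp add: SM_delta_def)

lemma MOD_eps_basis: "MOD_eps I (basis z) = (if equiv I (pre I z) then 1 else 0)"
  by (simp add: MOD_eps_def)

lemma SM_mu_lin: "SM_mu S T \<in> lin_maps (SM S \<otimes>\<^sub>s SM T) (SM (S \<union> T))"
  unfolding SM_eq_span[of S] SM_eq_span[of T] tensor_space_span
  by (rule lin_maps_spanI[OF linear_SM_mu subspace_SM])
    (auto simp: SM_mu_basis intro!: basis_SM set_prod_submodular)

lemma MOD_mu_lin: "SM_mu S T \<in> lin_maps (MOD S \<otimes>\<^sub>s MOD T) (MOD (S \<union> T))"
  unfolding MOD_eq_span[of S] MOD_eq_span[of T] tensor_space_span
  by (rule lin_maps_spanI[OF linear_SM_mu subspace_MOD])
    (auto simp: SM_mu_basis intro!: basis_MOD set_prod_modular)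

lemma restriction_modular:
  assumes z: "z \<in> modular_functions I" and S: "S \<subseteq> I" "z S < \<infinity>"
  shows "restriction z S \<in> modular_functions S"
proof (rule modular_functionsI[OF restriction_submodular[OF modular_imp_submodular[OF z] S]])
  fix A B assume "A \<subseteq> S" "B \<subseteq> S" "restriction z S A < \<infinity>" "restriction z S B < \<infinity>"
  moreover from this have "A \<union> B \<subseteq> S" "A \<inter> B \<subseteq> S" by auto
  ultimately show "restriction z S (A \<union> B) + restriction z S (A \<inter> B) = restriction z S A + restriction z S B"
    using modular_eq[OF z, of A B] S by (simp add: restriction_apply)
qed

lemma contraction_modular:
  assumes z: "z \<in> modular_functions I" and S: "S \<subseteq> I" "z S < \<infinity>"
  shows "contraction I z S \<in> modular_functions (I - S)"
proof -
  note s = modular_imp_submodular[OF z]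
  show ?thesis
  proof (rule modular_functionsI[OF contraction_submodular[OF s S]])
    fix A B assume A: "A \<subseteq> I - S" and B: "B \<subseteq> I - S"
      and fin: "contraction I z S A < \<infinity>" "contraction I z S B < \<infinity>"
    note fin = fin[unfolded contraction_less_PInf_iff[OF s S A] contraction_less_PInf_iff[OF s S B]]
    have sub: "A \<union> B \<subseteq> I - S" "A \<inter> B \<subseteq> I - S" using A B by auto
    have "z ((S \<union> A) \<union> (S \<union> B)) + z ((S \<union> A) \<inter> (S \<union> B)) = z (S \<union> A) + z (S \<union> B)"
      by (rule modular_eq[OF z _ _ fin]) (use A B S in auto)
    moreover have "(S \<union> A) \<union> (S \<union> B) = S \<union> (A \<union> B)" "(S \<union> A) \<inter> (S \<union> B) = S \<union> (A \<inter> B)" by auto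
    ultimately show "contraction I z S (A \<union> B) + contraction I z S (A \<inter> B) = contraction I z S A + contraction I z S B"
      unfolding contraction_additive[OF s S sub A B] by simp
  qed
qed

lemma SM_Delta_lin:
  assumes ST: "S \<inter> T = {}"
  shows "SM_Delta S T \<in> lin_maps (SM (S \<union> T)) (SM S \<otimes>\<^sub>s SM T)"
  unfolding SM_eq_span[of "S \<union> T"]
proof (rule lin_maps_spanI[OF linear_SM_Delta subspace_tensor_space])
  fix a :: "('a set \<Rightarrow> ereal) \<Rightarrow>\<^sub>0 real" assume "a \<in> basis ` submodular_functions (S \<union> T)"
  then obtain z where z: "z \<in> submodular_functions (S \<union> T)" "a = basis z" by blast
  have "S \<union> T - S = T" using ST by auto
  then show "SM_Delta S T a \<in> SM S \<otimes>\<^sub>s SM T"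
    using restriction_submodular[OF z(1), of S] contraction_submodular[OF z(1), of S]
    by (auto simp: z(2) SM_Delta_basis intro!: tensor_space_memI basis_SM subspace_0[OF subspace_tensor_space])
qed

lemma MOD_Delta_lin:
  assumes ST: "S \<inter> T = {}"
  shows "SM_Delta S T \<in> lin_maps (MOD (S \<union> T)) (MOD S \<otimes>\<^sub>s MOD T)"
  unfolding MOD_eq_span[of "S \<union> T"]
proof (rule lin_maps_spanI[OF linear_SM_Delta subspace_tensor_space])
  fix a :: "('a set \<Rightarrow> ereal) \<Rightarrow>\<^sub>0 real" assume "a \<in> basis ` modular_functions (S \<union> T)"
  then obtain z where z: "z \<in> modular_functions (S \<union> T)" "a = basis z" by blast
  have "S \<union> T - S = T" using ST by auto
  then show "SM_Delta S T a \<in> MOD S \<otimes>\<^sub>s MOD T"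
    using restriction_modular[OF z(1), of S] contraction_modular[OF z(1), of S]
    by (auto simp: z(2) SM_Delta_basis intro!: tensor_space_memI basis_MOD subspace_0[OF subspace_tensor_space])
qed

lemma SM_delta_lin:
  assumes "finite I"
  shows "SM_delta I \<in> lin_maps (SM I) (SM I \<otimes>\<^sub>s MOD I)"
proof -
  have "SM_delta I \<in> lin_maps (span (basis ` submodular_functions I)) (SM I \<otimes>\<^sub>s MOD I)"
  proof (rule lin_maps_spanI[OF linear_SM_delta subspace_tensor_space])
    fix a assume "a \<in> basis ` submodular_functions I"
    then obtain z where z: "z \<in> submodular_functions I" "a = basis z" by blast
    show "SM_delta I a \<in> SM I \<otimes>\<^sub>s MOD I"
      unfolding z(2) SM_delta_basis
      by (intro subspace_sum[OF subspace_tensor_space] tensor_space_memI basis_SM basis_MOD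
          lower_submodular[OF assms z(1)] upper_modular[OF z(1)])
  qed
  then show ?thesis by (simp add: SM_eq_span)
qed

lemma MOD_delta_lin:
  assumes "finite I"
  shows "SM_delta I \<in> lin_maps (MOD I) (MOD I \<otimes>\<^sub>s MOD I)"
proof -
  have "SM_delta I \<in> lin_maps (span (basis ` modular_functions I)) (MOD I \<otimes>\<^sub>s MOD I)"
  proof (rule lin_maps_spanI[OF linear_SM_delta subspace_tensor_space])
    fix a assume "a \<in> basis ` modular_functions I"
    then obtain z where z: "z \<in> modular_functions I" "a = basis z" by blast
    show "SM_delta I a \<in> MOD I \<otimes>\<^sub>s MOD I"
      unfolding z(2) SM_delta_basis
      by (intro subspace_sum[OF subspace_tensor_space] tensor_space_memI basis_MOD
          lower_modular[OF assms z(1)] upper_modular[OF modular_imp_submodular[OF z(1)]])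
  qed
  then show ?thesis by (simp add: MOD_eq_span)
qed

section \<open>The species and its bimonoid structure\<close>

lemma species_MOD: "species (MOD :: 'i set \<Rightarrow> _) SM_map"
proof
  fix I :: "'i set" and \<sigma> \<sigma>' :: "'i \<Rightarrow> 'i"
  show "subspace (MOD I)" by (rule subspace_MOD)
  show "SM_map \<sigma> I \<in> lin_maps (MOD I) (MOD (\<sigma> ` I))" if "inj_on \<sigma> I"
    unfolding MOD_eq_span[of I]
    by (rule lin_maps_spanI[OF linear_SM_map subspace_MOD])
      (auto simp: SM_map_basis intro!: basis_MOD relabel_modular that)
  show "SM_map \<sigma> I x = SM_map \<sigma>' I x" if "\<And>i. i \<in> I \<Longrightarrow> \<sigma> i = \<sigma>' i" "x \<in> MOD I" for x
    by (rule linear_eq_on_MOD[OF linear_SM_map linear_SM_map _ that(2)])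
      (simp add: SM_map_basis relabel_cong[OF that(1)])
  show "SM_map id I x = x" if "x \<in> MOD I" for x
  proof -
    have "SM_map id I x = id x"
      by (rule linear_eq_on_MOD[OF linear_SM_map linear_id _ that])
        (simp add: SM_map_basis relabel_id modular_imp_submodular)
    then show ?thesis by simp
  qed
  show "SM_map (\<sigma>' \<circ> \<sigma>) I x = SM_map \<sigma>' (\<sigma> ` I) (SM_map \<sigma> I x)"
    if "inj_on \<sigma> I" "inj_on \<sigma>' (\<sigma> ` I)" "x \<in> MOD I" for x
  proof -
    have "SM_map (\<sigma>' \<circ> \<sigma>) I x = (SM_map \<sigma>' (\<sigma> ` I) \<circ> SM_map \<sigma> I) x"
      by (rule linear_eq_on_MOD[OF _ _ _ that(3)])
        ((intro linear_structure_maps)+, subst o_apply, simp only: SM_map_basis relabel_comp[OF that(1,2)])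
    then show ?thesis by simp
  qed
qed

lemma set_prod_assoc:
  assumes "R \<inter> S = {}" "R \<inter> T = {}" "S \<inter> T = {}"
  shows "set_prod (R \<union> S) T (set_prod R S r u) v = set_prod R (S \<union> T) r (set_prod S T u v)"
proof (rule extensional_Pow_eqI[of _ "R \<union> S \<union> T"])
  fix E assume "E \<subseteq> R \<union> S \<union> T"
  moreover have "(E \<inter> (R \<union> S)) \<inter> R = E \<inter> R" "(E \<inter> (R \<union> S)) \<inter> S = E \<inter> S"
    "(E \<inter> (S \<union> T)) \<inter> S = E \<inter> S" "(E \<inter> (S \<union> T)) \<inter> T = E \<inter> T" by auto
  ultimately show "set_prod (R \<union> S) T (set_prod R S r u) v E = set_prod R (S \<union> T) r (set_prod S T u v) E"
    by (simp add: set_prod_apply[OF Int_lower2] set_prod_apply Un_assoc add.assoc)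
qed (simp_all add: set_prod_def Un_assoc)

lemma set_prod_empty_left:
  assumes "z \<in> submodular_functions I"
  shows "set_prod {} I (\<lambda>E\<in>Pow {}. 0) z = z"
  by (rule extensional_Pow_eqI[OF _ submodular_extensional[OF assms]])
    (auto simp: set_prod_def Int_absorb2)

lemma set_prod_empty_right:
  assumes "z \<in> submodular_functions I"
  shows "set_prod I {} z (\<lambda>E\<in>Pow {}. 0) = z"
  by (rule extensional_Pow_eqI[OF _ submodular_extensional[OF assms]])
    (auto simp: set_prod_def Int_absorb2)

lemma submodular_on_empty: "z \<in> submodular_functions {} \<longleftrightarrow> z = (\<lambda>E\<in>Pow {}. 0)"
proof
  assume "z \<in> submodular_functions {}"
  then show "z = (\<lambda>E\<in>Pow {}. 0)"
    by (intro extensional_Pow_eqI[of _ "{}"]) (auto simp: submodular_empty dest: submodular_extensional)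
qed (auto intro!: submodular_functionsI)

text \<open>
  Hence \<open>MOD {}\<close> is the line spanned by \<open>\<eta> 1\<close>.
\<close>

lemma modular_on_empty: "z \<in> modular_functions {} \<longleftrightarrow> z = (\<lambda>E\<in>Pow {}. 0)"
  using modular_imp_submodular[of z "{}"] submodular_on_empty[of z]
  by (auto intro!: modular_functionsI)

lemma mu_natural_MOD:
  assumes "inj_on \<sigma> (S \<union> T)" "t \<in> MOD S \<otimes>\<^sub>s MOD T"
  shows "SM_map \<sigma> (S \<union> T) (SM_mu S T t) = SM_mu (\<sigma> ` S) (\<sigma> ` T) ((SM_map \<sigma> S \<otimes>\<^sub>m SM_map \<sigma> T) t)"
proof -
  have "(SM_map \<sigma> (S \<union> T) \<circ> SM_mu S T) t = (SM_mu (\<sigma> ` S) (\<sigma> ` T) \<circ> (SM_map \<sigma> S \<otimes>\<^sub>m SM_map \<sigma> T)) t"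
    by (rule linear_eq_on_MOD_tensor[OF _ _ _ assms(2)])
      ((intro linear_structure_maps)+, simp add: SM_mu_basis SM_map_basis tensor_map_pure linear_SM_map set_prod_relabel[OF assms(1)])
  then show ?thesis by simp
qed

lemma Delta_natural_MOD:
  assumes ST: "S \<inter> T = {}" and inj: "inj_on \<sigma> (S \<union> T)" and x: "x \<in> MOD (S \<union> T)"
  shows "SM_Delta (\<sigma> ` S) (\<sigma> ` T) (SM_map \<sigma> (S \<union> T) x) = (SM_map \<sigma> S \<otimes>\<^sub>m SM_map \<sigma> T) (SM_Delta S T x)"
proof -
  have "(SM_Delta (\<sigma> ` S) (\<sigma> ` T) \<circ> SM_map \<sigma> (S \<union> T)) x = ((SM_map \<sigma> S \<otimes>\<^sub>m SM_map \<sigma> T) \<circ> SM_Delta S T) x"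
  proof (rule linear_eq_on_MOD[OF _ _ _ x])
    fix z assume "z \<in> modular_functions (S \<union> T)"
    have "S \<union> T - S = T" using ST by auto
    then show "(SM_Delta (\<sigma> ` S) (\<sigma> ` T) \<circ> SM_map \<sigma> (S \<union> T)) (basis z) =
        ((SM_map \<sigma> S \<otimes>\<^sub>m SM_map \<sigma> T) \<circ> SM_Delta S T) (basis z)"
      using relabel_image[OF inj, of S z] restriction_relabel[OF inj, of S z] contraction_relabel[OF inj, of S z]
      by (simp add: SM_map_basis SM_Delta_basis tensor_map_pure linear_SM_map linear_0[OF linear_tensor_map]
          image_Un)
  qed (intro linear_structure_maps)+
  then show ?thesis by simp
qed

lemma mu_assoc_MOD:
  assumes "R \<inter> S = {}" "R \<inter> T = {}" "S \<inter> T = {}" "w \<in> (MOD R \<otimes>\<^sub>s MOD S) \<otimes>\<^sub>s MOD T"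
  shows "SM_mu (R \<union> S) T ((SM_mu R S \<otimes>\<^sub>m id) w) = SM_mu R (S \<union> T) ((id \<otimes>\<^sub>m SM_mu S T) (tensor_assoc w))"
proof -
  have "(SM_mu (R \<union> S) T \<circ> (SM_mu R S \<otimes>\<^sub>m id)) w = (SM_mu R (S \<union> T) \<circ> (id \<otimes>\<^sub>m SM_mu S T) \<circ> tensor_assoc) w"
    by (rule linear_eq_on_MOD_tensor3[OF _ _ _ assms(4)])
      ((intro linear_structure_maps)+, simp only: o_apply id_apply[of "basis z" for z] tensor_map_pure linear_SM_mu linear_id tensor_assoc_pure
        SM_mu_basis set_prod_assoc[OF assms(1-3)])
  then show ?thesis by simp
qed

lemma mu_unit_MOD:
  assumes x: "x \<in> MOD I"
  shows "SM_mu {} I (SM_eta {} 1 \<otimes> x) = x" "SM_mu I {} (x \<otimes> SM_eta {} 1) = x"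
proof -
  have "(SM_mu {} I \<circ> (\<otimes>) (SM_eta {} 1)) x = id x"
    by (rule linear_eq_on_MOD[OF _ _ _ x])
      ((intro linear_structure_maps)+, simp add: SM_eta_def SM_mu_basis set_prod_empty_left[OF modular_imp_submodular] del: Pow_empty)
  then show "SM_mu {} I (SM_eta {} 1 \<otimes> x) = x" by simp
  have "(SM_mu I {} \<circ> (\<lambda>x. x \<otimes> SM_eta {} 1)) x = id x"
    by (rule linear_eq_on_MOD[OF _ _ _ x])
      ((intro linear_structure_maps)+, simp add: SM_eta_def SM_mu_basis set_prod_empty_right[OF modular_imp_submodular] del: Pow_empty)
  then show "SM_mu I {} (x \<otimes> SM_eta {} 1) = x" by simp
qed

text \<open>
  Both sides vanish unless \<open>z R\<close> and \<open>z (R \<union> S)\<close> are finite, since finiteness of \<open>z\<^bsub>/R\<^esub> S\<close> means that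
  of \<open>z (R \<union> S)\<close>; otherwise the three pairs of minors agree.
\<close>

lemma Delta_coassoc_MOD:
  assumes dj: "R \<inter> S = {}" "R \<inter> T = {}" "S \<inter> T = {}" and x: "x \<in> MOD (R \<union> S \<union> T)"
  shows "tensor_assoc ((SM_Delta R S \<otimes>\<^sub>m id) (SM_Delta (R \<union> S) T x)) = (id \<otimes>\<^sub>m SM_Delta S T) (SM_Delta R (S \<union> T) x)"
proof -
  have "(tensor_assoc \<circ> (SM_Delta R S \<otimes>\<^sub>m id) \<circ> SM_Delta (R \<union> S) T) x = ((id \<otimes>\<^sub>m SM_Delta S T) \<circ> SM_Delta R (S \<union> T)) x"
  proof (rule linear_eq_on_MOD[OF _ _ _ x])
    fix z assume "z \<in> modular_functions (R \<union> S \<union> T)"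
    then have z: "z \<in> submodular_functions (R \<union> S \<union> T)" by (rule modular_imp_submodular)
    let ?I = "R \<union> S \<union> T"
    have sets: "?I - R = S \<union> T" "?I - (R \<union> S) = T" "R \<union> S - R = S" "S \<union> T - S = T" "R \<union> (S \<union> T) = ?I"
      using dj by auto
    have "R \<subseteq> ?I" "R \<union> S \<subseteq> ?I" by auto
    note ni = this[THEN submodular_not_MInf[OF z]]
    have rr: "restriction (restriction z (R \<union> S)) R = restriction z R"
      by (auto simp: restriction_def restrict_def fun_eq_iff)
    have rc: "contraction (R \<union> S) (restriction z (R \<union> S)) R = restriction (contraction ?I z R) S"
      by (rule extensional_Pow_eqI[of _ S])
        (auto simp: contraction_def restriction_def sets extensional_def)
    have cc: "contraction (S \<union> T) (contraction ?I z R) S = contraction ?I z (R \<union> S)"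
      if R: "z R < \<infinity>" "z (R \<union> S) < \<infinity>"
    proof (rule extensional_Pow_eqI[of _ T])
      obtain a b where ab: "z R = ereal a" "z (R \<union> S) = ereal b"
        using ni R by (cases "z R"; cases "z (R \<union> S)") auto
      fix E assume E: "E \<subseteq> T"
      then have "S \<union> E \<subseteq> ?I - R" "S \<subseteq> ?I - R" "E \<subseteq> S \<union> T - S" "E \<subseteq> ?I - (R \<union> S)" unfolding sets by auto
      then show "contraction (S \<union> T) (contraction ?I z R) S E = contraction ?I z (R \<union> S) E"
        by (cases "z (R \<union> S \<union> E)") (simp_all add: contraction_apply ab Un_assoc[symmetric])
    qed (simp_all add: contraction_def sets)
    have fin: "contraction ?I z R S < \<infinity> \<longleftrightarrow> z (R \<union> S) < \<infinity>" if "z R < \<infinity>"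
      by (rule contraction_less_PInf_iff[OF z _ that]) (auto simp: sets)
    show "(tensor_assoc \<circ> (SM_Delta R S \<otimes>\<^sub>m id) \<circ> SM_Delta (R \<union> S) T) (basis z) =
        ((id \<otimes>\<^sub>m SM_Delta S T) \<circ> SM_Delta R (S \<union> T)) (basis z)"
    proof (cases "z R < \<infinity>")
      case True
      then show ?thesis
      proof (cases "z (R \<union> S) < \<infinity>")
        case RS: True
        then show ?thesis
          using True fin[OF True]
          by (simp only: o_apply SM_Delta_basis if_True sets tensor_map_pure linear_SM_Delta linear_id id_apply
              restriction_apply Un_upper1 tensor_assoc_pure rr rc cc)
      next
        case RS: False
        then show ?thesis
          using True fin[OF True]
          by (simp only: o_apply SM_Delta_basis if_True if_False sets tensor_map_pure linear_SM_Delta linear_id id_apply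
              linear_0[OF linear_tensor_map] linear_0[OF linear_tensor_assoc] linear_0[OF linear_pure_right])
      qed
    next
      case False
      then show ?thesis
        by (cases "z (R \<union> S) < \<infinity>")
          (simp_all only: o_apply SM_Delta_basis if_True if_False sets tensor_map_pure linear_SM_Delta linear_id id_apply
              restriction_apply Un_upper1 linear_0[OF linear_tensor_map] linear_0[OF linear_tensor_assoc] linear_0[OF linear_pure_left])
    qed
  qed (intro linear_structure_maps)+
  then show ?thesis by simp
qed

lemma Delta_counit_MOD:
  assumes x: "x \<in> MOD I"
  shows "tensor_lunit ((SM_eps {} \<otimes>\<^sub>m id) (SM_Delta {} I x)) = x"
    "tensor_runit ((id \<otimes>\<^sub>m SM_eps {}) (SM_Delta I {} x)) = x"
proof -
  have "(tensor_lunit \<circ> (SM_eps {} \<otimes>\<^sub>m id) \<circ> SM_Delta {} I) x = id x"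
  proof (rule linear_eq_on_MOD[OF _ _ _ x])
    fix z assume z: "z \<in> modular_functions I"
    note s = modular_imp_submodular[OF z]
    have "contraction I z {} = z"
      by (rule extensional_Pow_eqI[OF _ submodular_extensional[OF s]])
        (auto simp: contraction_def submodular_empty[OF s])
    then show "(tensor_lunit \<circ> (SM_eps {} \<otimes>\<^sub>m id) \<circ> SM_Delta {} I) (basis z) = id (basis z)"
      by (simp add: SM_Delta_basis submodular_empty[OF s] tensor_map_pure linear_SM_eps linear_id SM_eps_basis)
  qed (intro linear_structure_maps)+
  then show "tensor_lunit ((SM_eps {} \<otimes>\<^sub>m id) (SM_Delta {} I x)) = x" by simp
  have "(tensor_runit \<circ> (id \<otimes>\<^sub>m SM_eps {}) \<circ> SM_Delta I {}) x = id x"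
  proof (rule linear_eq_on_MOD[OF _ _ _ x])
    fix z assume z: "z \<in> modular_functions I"
    note s = modular_imp_submodular[OF z]
    have "restriction z I = z"
      by (rule extensional_Pow_eqI[OF _ submodular_extensional[OF s]]) (auto simp: restriction_def)
    then show "(tensor_runit \<circ> (id \<otimes>\<^sub>m SM_eps {}) \<circ> SM_Delta I {}) (basis z) = id (basis z)"
      using submodular_full[OF s]
      by (simp add: SM_Delta_basis tensor_map_pure linear_SM_eps linear_id SM_eps_basis)
  qed (intro linear_structure_maps)+
  then show "tensor_runit ((id \<otimes>\<^sub>m SM_eps {}) (SM_Delta I {} x)) = x" by simp
qed

text \<open>
  Restriction and contraction of a product along \<open>S'\<close> are the products of those of the factors along
  their traces, and \<open>(u \<cdot> v) S'\<close> is finite iff both factors are finite on theirs.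
\<close>

lemma Delta_mu_MOD:
  assumes ST: "S \<inter> T = {}" and ST': "S' \<inter> T' = {}" "S' \<union> T' = S \<union> T" and t: "t \<in> MOD S \<otimes>\<^sub>s MOD T"
  shows "SM_Delta S' T' (SM_mu S T t) =
    (SM_mu (S \<inter> S') (T \<inter> S') \<otimes>\<^sub>m SM_mu (S \<inter> T') (T \<inter> T'))
      (swap23 ((SM_Delta (S \<inter> S') (S \<inter> T') \<otimes>\<^sub>m SM_Delta (T \<inter> S') (T \<inter> T')) t))"
proof -
  have "(SM_Delta S' T' \<circ> SM_mu S T) t =
    ((SM_mu (S \<inter> S') (T \<inter> S') \<otimes>\<^sub>m SM_mu (S \<inter> T') (T \<inter> T')) \<circ>
      swap23 \<circ> (SM_Delta (S \<inter> S') (S \<inter> T') \<otimes>\<^sub>m SM_Delta (T \<inter> S') (T \<inter> T'))) t"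
  proof (rule linear_eq_on_MOD_tensor[OF _ _ _ t])
    fix u v assume "u \<in> modular_functions S" "v \<in> modular_functions T"
    then have u: "u \<in> submodular_functions S" and v: "v \<in> submodular_functions T"
      by (auto intro: modular_imp_submodular)
    have sets: "S' \<inter> S = S \<inter> S'" "S' \<inter> T = T \<inter> S'" "(S \<inter> S') \<union> (S \<inter> T') = S" "(T \<inter> S') \<union> (T \<inter> T') = T"
      "S' \<union> T' - S' = T'" "(S \<inter> T') \<union> (T \<inter> T') = T'" "(S \<inter> S') \<union> (T \<inter> S') = S'"
      using ST ST' by blast+
    have S': "S' \<subseteq> S \<union> T" using ST' by blast
    let ?w = "set_prod S T u v"
    have iff: "?w S' < \<infinity> \<longleftrightarrow> u (S \<inter> S') < \<infinity> \<and> v (T \<inter> S') < \<infinity>"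
      using set_prod_less_PInf_iff[OF u v S'] by (simp only: sets)
    have rest: "restriction ?w S' = set_prod (S \<inter> S') (T \<inter> S') (restriction u (S \<inter> S')) (restriction v (T \<inter> S'))"
    proof (rule extensional_Pow_eqI[of _ S'])
      show "set_prod (S \<inter> S') (T \<inter> S') (restriction u (S \<inter> S')) (restriction v (T \<inter> S')) \<in> extensional (Pow S')"
        unfolding set_prod_def sets(7) by simp
      fix E assume E: "E \<subseteq> S'"
      then have "E \<inter> (S \<inter> S') = E \<inter> S" "E \<inter> (T \<inter> S') = E \<inter> T" and sub: "E \<subseteq> S \<union> T" "E \<subseteq> (S \<inter> S') \<union> (T \<inter> S')" "E \<inter> S \<subseteq> S \<inter> S'" "E \<inter> T \<subseteq> T \<inter> S'"
        using S' sets by auto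
      then show "restriction ?w S' E =
          set_prod (S \<inter> S') (T \<inter> S') (restriction u (S \<inter> S')) (restriction v (T \<inter> S')) E"
        by (simp only: restriction_apply[OF E] restriction_apply[OF sub(3)] restriction_apply[OF sub(4)]
            set_prod_apply[OF sub(1)] set_prod_apply[OF sub(2)])
    qed (simp add: restriction_def)
    have contr: "contraction (S' \<union> T') ?w S' =
        set_prod (S \<inter> T') (T \<inter> T') (contraction S u (S \<inter> S')) (contraction T v (T \<inter> S'))"
      if fin: "u (S \<inter> S') < \<infinity>" "v (T \<inter> S') < \<infinity>"
    proof (rule extensional_Pow_eqI[of _ T'])
      obtain a b where ab: "u (S \<inter> S') = ereal a" "v (T \<inter> S') = ereal b"
        using submodular_real[OF u _ fin(1)] submodular_real[OF v _ fin(2)] by (metis Int_lower1)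
      show "contraction (S' \<union> T') ?w S' \<in> extensional (Pow T')"
        by (simp add: contraction_def sets)
      show "set_prod (S \<inter> T') (T \<inter> T') (contraction S u (S \<inter> S')) (contraction T v (T \<inter> S')) \<in> extensional (Pow T')"
        unfolding set_prod_def sets(6) by simp
      fix E assume E: "E \<subseteq> T'"
      have s1: "E \<inter> (S \<inter> T') \<subseteq> S - S \<inter> S'" "E \<inter> (T \<inter> T') \<subseteq> T - T \<inter> S'" using ST' by auto
      have s2: "(S \<inter> S') \<union> (E \<inter> (S \<inter> T')) = (S' \<union> E) \<inter> S" "(T \<inter> S') \<union> (E \<inter> (T \<inter> T')) = (S' \<union> E) \<inter> T"
        using E by auto
      have s3: "S' \<union> E \<subseteq> S \<union> T" "E \<subseteq> (S \<inter> T') \<union> (T \<inter> T')" using E S' ST' by auto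
      have ni: "u ((S' \<union> E) \<inter> S) \<noteq> - \<infinity>" "v ((S' \<union> E) \<inter> T) \<noteq> - \<infinity>"
        using submodular_not_MInf[OF u Int_lower2] submodular_not_MInf[OF v Int_lower2] by auto
      have "contraction (S' \<union> T') ?w S' E = (u ((S' \<union> E) \<inter> S) + v ((S' \<union> E) \<inter> T)) - (ereal a + ereal b)"
        using E by (simp only: contraction_apply sets set_prod_apply[OF s3(1)] set_prod_apply[OF S'] ab)
      also have "\<dots> = (u ((S' \<union> E) \<inter> S) - ereal a) + (v ((S' \<union> E) \<inter> T) - ereal b)"
        using ni by (cases "u ((S' \<union> E) \<inter> S)"; cases "v ((S' \<union> E) \<inter> T)") auto
      also have "\<dots> = set_prod (S \<inter> T') (T \<inter> T') (contraction S u (S \<inter> S')) (contraction T v (T \<inter> S')) E"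
        unfolding set_prod_apply[OF s3(2)] contraction_apply[OF s1(1)] contraction_apply[OF s1(2)] s2 ab ..
      finally show "contraction (S' \<union> T') ?w S' E =
          set_prod (S \<inter> T') (T \<inter> T') (contraction S u (S \<inter> S')) (contraction T v (T \<inter> S')) E" .
    qed
    show "(SM_Delta S' T' \<circ> SM_mu S T) (basis u \<otimes> basis v) =
      ((SM_mu (S \<inter> S') (T \<inter> S') \<otimes>\<^sub>m SM_mu (S \<inter> T') (T \<inter> T')) \<circ>
        swap23 \<circ> (SM_Delta (S \<inter> S') (S \<inter> T') \<otimes>\<^sub>m SM_Delta (T \<inter> S') (T \<inter> T'))) (basis u \<otimes> basis v)"
    proof (cases "u (S \<inter> S') < \<infinity> \<and> v (T \<inter> S') < \<infinity>")
      case True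
      then have fin: "u (S \<inter> S') < \<infinity>" "v (T \<inter> S') < \<infinity>" by auto
      show ?thesis
        by (simp only: o_apply SM_mu_basis SM_Delta_basis iff fin if_True simp_thms tensor_map_pure
            linear_SM_Delta linear_SM_mu swap23_pure rest contr[OF fin] sets(3,4))
    next
      case False
      then have "SM_Delta S' T' (basis ?w) = 0" by (simp only: SM_Delta_basis iff if_False)
      moreover have "SM_Delta (S \<inter> S') (S \<inter> T') (basis u) \<otimes> SM_Delta (T \<inter> S') (T \<inter> T') (basis v) = 0"
        using False by (auto simp: SM_Delta_basis linear_0[OF linear_pure_left] linear_0[OF linear_pure_right])
      ultimately show ?thesis
        by (simp only: o_apply SM_mu_basis tensor_map_pure linear_SM_Delta linear_0[OF linear_swap23]
            linear_0[OF linear_tensor_map] linear_SM_mu)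
    qed
  qed (intro linear_structure_maps)+
  then show ?thesis by simp
qed

lemma eta_lin_MOD: "SM_eta I \<in> lin_maps (U_space I) (MOD I)"
proof -
  have "basis (\<lambda>E\<in>Pow {}. 0) \<in> MOD {}" by (rule basis_MOD) (simp only: modular_on_empty)
  then show ?thesis
    using linear_SM_eta[of I] subspace_scale[OF subspace_MOD] subspace_0[OF subspace_MOD]
    by (auto simp: lin_maps_def SM_eta_def simp del: Pow_empty)
qed

lemma eps_lin_MOD: "SM_eps I \<in> lin_maps (MOD I) (U_space I)"
  using linear_SM_eps[of I] by (auto simp: lin_maps_def U_space_def SM_eps_def lin_ext_def)

lemma Delta_unit_MOD: "SM_Delta {} {} (SM_eta ({} :: 'i set) 1) = SM_eta {} 1 \<otimes> SM_eta {} 1"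
proof -
  have "contraction {} (\<lambda>E\<in>Pow {}. 0) {} = (\<lambda>E\<in>Pow ({} :: 'i set). 0)"
    "restriction (\<lambda>E\<in>Pow {}. 0) {} = (\<lambda>E\<in>Pow ({} :: 'i set). 0)"
    by (auto simp: contraction_def restriction_def)
  then show ?thesis by (simp add: SM_eta_def SM_Delta_basis del: Pow_empty)
qed

lemma eps_mu_empty_MOD:
  assumes xy: "x \<in> MOD {}" "y \<in> MOD {}"
  shows "SM_eps {} (SM_mu {} {} (x \<otimes> y)) = SM_eps {} x * SM_eps {} y"
proof -
  note b = bilinear_mult_linear[OF linear_SM_eps linear_SM_eps]
  have "(SM_eps {} \<circ> SM_mu {} {}) (x \<otimes> y) = tensor_lift (\<lambda>a b. SM_eps {} a * SM_eps {} b) (x \<otimes> y)"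
    by (rule linear_eq_on_MOD_tensor[OF _ linear_tensor_lift[OF b] _ tensor_space_memI[OF xy]])
      ((intro linear_structure_maps)+, simp add: b SM_mu_basis SM_eps_basis)
  then show ?thesis by (simp add: b)
qed

lemma eps_eta_MOD: "SM_eps {} (SM_eta {} 1) = 1"
  by (simp add: SM_eta_def SM_eps_basis del: Pow_empty)

lemma bimonoid_species_MOD: "bimonoid_species MOD SM_map SM_mu SM_Delta SM_eta SM_eps"
  by (intro bimonoid_species.intro bimonoid_species_axioms.intro species_MOD)
    (rule MOD_mu_lin MOD_Delta_lin eta_lin_MOD eps_lin_MOD mu_natural_MOD Delta_natural_MOD mu_assoc_MOD
      mu_unit_MOD Delta_coassoc_MOD Delta_counit_MOD Delta_mu_MOD Delta_unit_MOD eps_mu_empty_MOD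
      eps_eta_MOD; assumption)+

section \<open>The coaction\<close>

lemma SM_delta_pair:
  "swap23 (SM_delta S (basis u) \<otimes> SM_delta T (basis v)) =
    (\<Sum>(Q\<^sub>1, Q\<^sub>2)\<in>Pre S u \<times> Pre T v.
      (basis (lower S Q\<^sub>1 u) \<otimes> basis (lower T Q\<^sub>2 v)) \<otimes> (basis (upper S Q\<^sub>1 u) \<otimes> basis (upper T Q\<^sub>2 v)))"
  unfolding SM_delta_basis[of S u] tensor_sum_left
  unfolding SM_delta_basis[of T v] tensor_sum_right linear_sum[OF linear_swap23] swap23_pure
  by (rule sum.cartesian_product)

text \<open>
  On the left, \<open>\<Delta>\<close> keeps the terms \<open>Q\<close> for which \<open>z\<^sup>Q\<close> is finite on \<open>S\<close>, that is those having \<open>S\<close> as a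
  down-set; there are none if \<open>z S = \<infinity>\<close>.  These are reindexed along \<open>bij_betw_split_Pre\<close>.
\<close>

lemma delta_Delta_basis:
  assumes "finite S" "finite T" and ST: "S \<inter> T = {}" and z: "z \<in> submodular_functions (S \<union> T)"
  shows "(id \<otimes>\<^sub>m SM_Delta S T) (SM_delta (S \<union> T) (basis z)) =
    (SM_mu S T \<otimes>\<^sub>m id) (swap23 ((SM_delta S \<otimes>\<^sub>m SM_delta T) (SM_Delta S T (basis z))))"
proof -
  let ?I = "S \<union> T"
  have I: "finite ?I" and T: "?I - S = T" and SI: "S \<subseteq> ?I" using assms by auto
  have "(id \<otimes>\<^sub>m SM_Delta S T) (SM_delta ?I (basis z)) =
      (\<Sum>Q\<in>Pre ?I z. basis (lower ?I Q z) \<otimes> SM_Delta S T (basis (upper ?I Q z)))"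
    unfolding SM_delta_basis linear_sum[OF linear_tensor_map[OF linear_id linear_SM_Delta]]
      tensor_map_pure[OF linear_id linear_SM_Delta] id_apply[of "basis z" for z] ..
  also have "\<dots> = (\<Sum>Q\<in>{Q \<in> Pre ?I z. down_set ?I Q S}. basis (lower ?I Q z) \<otimes> SM_Delta S T (basis (upper ?I Q z)))"
  proof (rule sum.mono_neutral_right[OF finite_Pre[OF I]])
    show "\<forall>Q\<in>Pre ?I z - {Q \<in> Pre ?I z. down_set ?I Q S}.
        basis (lower ?I Q z) \<otimes> SM_Delta S T (basis (upper ?I Q z)) = 0"
      by (simp add: SM_Delta_basis upper_apply[OF SI] linear_0[OF linear_pure_right])
  qed auto
  finally have lhs: "(id \<otimes>\<^sub>m SM_Delta S T) (SM_delta ?I (basis z)) =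
      (\<Sum>Q\<in>{Q \<in> Pre ?I z. down_set ?I Q S}. basis (lower ?I Q z) \<otimes> SM_Delta S T (basis (upper ?I Q z)))" .
  show ?thesis
  proof (cases "z S < \<infinity>")
    case False
    then have none: "{Q \<in> Pre ?I z. down_set ?I Q S} = {}" using Pre_finite by blast
    show ?thesis
      unfolding lhs none using False
      by (simp only: sum.empty SM_Delta_basis if_False linear_0[OF linear_tensor_map] linear_0[OF linear_swap23]
          linear_SM_delta linear_SM_mu linear_id)
  next
    case fin: True
    let ?u = "restriction z S" and ?v = "contraction ?I z S"
    let ?F = "\<lambda>(Q\<^sub>1, Q\<^sub>2). basis (set_prod S T (lower S Q\<^sub>1 ?u) (lower T Q\<^sub>2 ?v)) \<otimes>
        (basis (upper S Q\<^sub>1 ?u) \<otimes> basis (upper T Q\<^sub>2 ?v))"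
    have "(\<Sum>Q\<in>{Q \<in> Pre ?I z. down_set ?I Q S}. basis (lower ?I Q z) \<otimes> SM_Delta S T (basis (upper ?I Q z))) =
        (\<Sum>Q\<in>{Q \<in> Pre ?I z. down_set ?I Q S}. ?F (Restr Q S, Restr Q T))"
    proof (rule sum.cong[OF refl])
      fix Q assume "Q \<in> {Q \<in> Pre ?I z. down_set ?I Q S}"
      then have Q: "Q \<in> Pre ?I z" "down_set ?I Q S" by auto
      have "upper ?I Q z S < \<infinity>" using Q fin by (simp add: upper_apply[OF SI])
      then show "basis (lower ?I Q z) \<otimes> SM_Delta S T (basis (upper ?I Q z)) = ?F (Restr Q S, Restr Q T)"
        using lower_split[OF I z Q] restriction_upper[OF Q(2)] contraction_upper[OF z Q]
        by (simp only: SM_Delta_basis if_True prod.case T)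
    qed
    also have "\<dots> = (\<Sum>p\<in>Pre S ?u \<times> Pre T ?v. ?F p)"
      using sum.reindex_bij_betw[OF bij_betw_split_Pre[OF I z SI fin], of ?F] unfolding T .
    also have "\<dots> = (SM_mu S T \<otimes>\<^sub>m id) (swap23 (SM_delta S (basis ?u) \<otimes> SM_delta T (basis ?v)))"
      unfolding SM_delta_pair linear_sum[OF linear_tensor_map[OF linear_SM_mu linear_id]]
      by (rule sum.cong[OF refl])
        (clarify, simp only: prod.case tensor_map_pure linear_SM_mu linear_id SM_mu_basis id_apply[of "x \<otimes> y" for x y])
    also have "\<dots> = (SM_mu S T \<otimes>\<^sub>m id) (swap23 ((SM_delta S \<otimes>\<^sub>m SM_delta T) (SM_Delta S T (basis z))))"
      using fin by (simp only: SM_Delta_basis if_True tensor_map_pure linear_SM_delta)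
    finally show ?thesis unfolding lhs .
  qed
qed

lemma delta_Delta_SM:
  assumes "finite S" "finite T" "S \<inter> T = {}" and x: "x \<in> SM (S \<union> T)"
  shows "(id \<otimes>\<^sub>m SM_Delta S T) (SM_delta (S \<union> T) x) =
    (SM_mu S T \<otimes>\<^sub>m id) (swap23 ((SM_delta S \<otimes>\<^sub>m SM_delta T) (SM_Delta S T x)))"
proof -
  have "((id \<otimes>\<^sub>m SM_Delta S T) \<circ> SM_delta (S \<union> T)) x =
    ((SM_mu S T \<otimes>\<^sub>m id) \<circ> swap23 \<circ> (SM_delta S \<otimes>\<^sub>m SM_delta T) \<circ> SM_Delta S T) x"
    by (rule linear_eq_on_SM[OF _ _ _ x])
      ((intro linear_structure_maps)+, unfold o_apply, rule delta_Delta_basis[OF assms(1-3)])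
  then show ?thesis by (simp only: o_apply)
qed

text \<open>
  Every preorder conforming to \<open>u \<cdot> v\<close> has \<open>S\<close> as a down-set, and the minors of \<open>u \<cdot> v\<close> along \<open>S\<close> are
  \<open>u\<close> and \<open>v\<close>, so \<open>bij_betw_split_Pre\<close> applies to all of them.
\<close>

lemma delta_mu_MOD:
  assumes "finite S" "finite T" and ST: "S \<inter> T = {}" and uv: "u \<in> MOD S" "v \<in> MOD T"
  shows "SM_delta (S \<union> T) (SM_mu S T (u \<otimes> v)) = (SM_mu S T \<otimes>\<^sub>m SM_mu S T) (swap23 (SM_delta S u \<otimes> SM_delta T v))"
proof -
  have "(SM_delta (S \<union> T) \<circ> SM_mu S T) (u \<otimes> v) =
    ((SM_mu S T \<otimes>\<^sub>m SM_mu S T) \<circ> swap23 \<circ> (SM_delta S \<otimes>\<^sub>m SM_delta T)) (u \<otimes> v)"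
  proof (rule linear_eq_on_MOD_tensor[OF _ _ _ tensor_space_memI[OF uv]])
    fix u v assume "u \<in> modular_functions S" "v \<in> modular_functions T"
    then have u: "u \<in> submodular_functions S" and v: "v \<in> submodular_functions T"
      by (auto intro: modular_imp_submodular)
    let ?I = "S \<union> T" and ?z = "set_prod S T u v"
    have I: "finite ?I" and T: "?I - S = T" and SI: "S \<subseteq> ?I" using assms by auto
    note z = set_prod_submodular[OF u v]
    note minors = restriction_set_prod[OF u v ST] contraction_set_prod[OF u v ST]
    have fin: "?z S < \<infinity>"
      unfolding set_prod_less_PInf_iff[OF u v SI] using submodular_full[OF u] submodular_empty[OF v] ST
      by (simp add: Int_commute)
    have all: "{Q \<in> Pre ?I ?z. down_set ?I Q S} = Pre ?I ?z"
      using down_set_Pre_set_prod[OF u v ST] by blast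
    let ?F = "\<lambda>(Q\<^sub>1, Q\<^sub>2). basis (set_prod S T (lower S Q\<^sub>1 u) (lower T Q\<^sub>2 v)) \<otimes>
        basis (set_prod S T (upper S Q\<^sub>1 u) (upper T Q\<^sub>2 v))"
    have "SM_delta ?I (basis ?z) = (\<Sum>Q\<in>Pre ?I ?z. ?F (Restr Q S, Restr Q T))"
      unfolding SM_delta_basis
    proof (rule sum.cong[OF refl])
      fix Q assume Q: "Q \<in> Pre ?I ?z"
      show "basis (lower ?I Q ?z) \<otimes> basis (upper ?I Q ?z) = ?F (Restr Q S, Restr Q T)"
        using lower_split[OF I z Q down_set_Pre_set_prod(1)[OF u v ST Q]] upper_set_prod[OF u v ST Q]
        by (simp only: prod.case T minors)
    qed
    also have "\<dots> = (\<Sum>p\<in>Pre S u \<times> Pre T v. ?F p)"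
      using sum.reindex_bij_betw[OF bij_betw_split_Pre[OF I z SI fin], of ?F] unfolding T minors all .
    also have "\<dots> = (SM_mu S T \<otimes>\<^sub>m SM_mu S T) (swap23 (SM_delta S (basis u) \<otimes> SM_delta T (basis v)))"
      unfolding SM_delta_pair linear_sum[OF linear_tensor_map[OF linear_SM_mu linear_SM_mu]]
      by (rule sum.cong[OF refl]) (clarify, simp only: prod.case tensor_map_pure linear_SM_mu SM_mu_basis)
    finally show "(SM_delta (S \<union> T) \<circ> SM_mu S T) (basis u \<otimes> basis v) =
        ((SM_mu S T \<otimes>\<^sub>m SM_mu S T) \<circ> swap23 \<circ> (SM_delta S \<otimes>\<^sub>m SM_delta T)) (basis u \<otimes> basis v)"
      by (simp only: o_apply SM_mu_basis tensor_map_pure linear_SM_delta)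
  qed (intro linear_structure_maps)+
  then show ?thesis by (simp only: o_apply tensor_map_pure linear_SM_delta)
qed

text \<open>
  Both sides are sums over pairs of preorders, matched by \<open>bij_betw_iterated_Pre\<close>; the three tensor
  factors agree by \<open>lower_inner\<close>, \<open>upper_inner\<close> and \<open>upper_upper\<close>.
\<close>

lemma delta_coassoc_basis:
  assumes "finite I" and z: "z \<in> submodular_functions I"
  shows "tensor_assoc ((SM_delta I \<otimes>\<^sub>m id) (SM_delta I (basis z))) = (id \<otimes>\<^sub>m SM_delta I) (SM_delta I (basis z))"
proof -
  let ?F = "\<lambda>(Q, R). basis (lower I R (lower I Q z)) \<otimes> basis (upper I R (lower I Q z)) \<otimes> basis (upper I Q z)"
  have fin: "finite (Pre I w)" for w :: "'a set \<Rightarrow> ereal" by (rule finite_Pre[OF \<open>finite I\<close>])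
  have "tensor_assoc ((SM_delta I \<otimes>\<^sub>m id) (SM_delta I (basis z))) =
      (\<Sum>Q\<in>Pre I z. \<Sum>R\<in>Pre I (lower I Q z). ?F (Q, R))"
    by (simp only: SM_delta_basis linear_sum[OF linear_tensor_map[OF linear_SM_delta linear_id]]
        linear_sum[OF linear_tensor_assoc] tensor_map_pure linear_SM_delta linear_id id_apply[of "basis z" for z]
        tensor_sum_left tensor_assoc_pure prod.case)
  also have "\<dots> = (\<Sum>p\<in>(SIGMA Q:Pre I z. Pre I (lower I Q z)). ?F p)"
    using fin by (subst sum.Sigma) (auto simp: split_beta)
  also have "\<dots> = (\<Sum>p\<in>(SIGMA P:Pre I z. Pre I (upper I P z)). ?F ((\<lambda>(P, Q). (Q, P \<inter> Q\<inverse>)) p))"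
    by (rule sum.reindex_bij_betw[OF bij_betw_iterated_Pre[OF assms], symmetric])
  also have "\<dots> = (\<Sum>(P, Q)\<in>(SIGMA P:Pre I z. Pre I (upper I P z)).
      basis (lower I P z) \<otimes> basis (lower I Q (upper I P z)) \<otimes> basis (upper I Q (upper I P z)))"
  proof (rule sum.cong[OF refl])
    fix p assume "p \<in> (SIGMA P:Pre I z. Pre I (upper I P z))"
    then obtain P Q where p: "p = (P, Q)" "P \<in> Pre I z" "Q \<in> Pre I (upper I P z)" by blast
    show "?F ((\<lambda>(P, Q). (Q, P \<inter> Q\<inverse>)) p) = (case p of (P, Q) \<Rightarrow>
        basis (lower I P z) \<otimes> basis (lower I Q (upper I P z)) \<otimes> basis (upper I Q (upper I P z)))"
      by (simp only: p(1) prod.case lower_inner[OF assms p(2,3)] upper_inner[OF assms p(2,3)] upper_upper[OF assms p(2,3)])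
  qed
  also have "\<dots> = (\<Sum>P\<in>Pre I z. \<Sum>Q\<in>Pre I (upper I P z).
      basis (lower I P z) \<otimes> basis (lower I Q (upper I P z)) \<otimes> basis (upper I Q (upper I P z)))"
    using fin by (subst sum.Sigma) auto
  also have "\<dots> = (id \<otimes>\<^sub>m SM_delta I) (SM_delta I (basis z))"
    by (simp only: SM_delta_basis linear_sum[OF linear_tensor_map[OF linear_id linear_SM_delta]]
        tensor_map_pure linear_SM_delta linear_id id_apply[of "basis z" for z] tensor_sum_right)
  finally show ?thesis .
qed

lemma delta_coassoc_MOD:
  assumes "finite I" and x: "x \<in> MOD I"
  shows "tensor_assoc ((SM_delta I \<otimes>\<^sub>m id) (SM_delta I x)) = (id \<otimes>\<^sub>m SM_delta I) (SM_delta I x)"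
proof -
  have "(tensor_assoc \<circ> (SM_delta I \<otimes>\<^sub>m id) \<circ> SM_delta I) x = ((id \<otimes>\<^sub>m SM_delta I) \<circ> SM_delta I) x"
    by (rule linear_eq_on_MOD[OF _ _ _ x])
      ((intro linear_structure_maps)+, unfold o_apply, rule delta_coassoc_basis[OF \<open>finite I\<close> modular_imp_submodular])
  then show ?thesis by (simp only: o_apply)
qed

text \<open>
  Of the terms of \<open>\<delta> z\<close>, the left counit keeps only \<open>Q = pre z\<close>, for which \<open>z\<^sup>Q = z\<close>.  The right counit
  keeps only the equivalence relations, that is \<open>decomposition_relation\<close>, for which \<open>z\<^sub>Q = z\<close>.
\<close>

lemma delta_counit_MOD:
  assumes "finite I" and x: "x \<in> MOD I"
  shows "tensor_lunit ((MOD_eps I \<otimes>\<^sub>m id) (SM_delta I x)) = x"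
    "tensor_runit ((id \<otimes>\<^sub>m MOD_eps I) (SM_delta I x)) = x"
proof -
  have "(tensor_lunit \<circ> (MOD_eps I \<otimes>\<^sub>m id) \<circ> SM_delta I) x = id x"
  proof (rule linear_eq_on_MOD[OF _ _ _ x])
    fix z assume z: "z \<in> modular_functions I"
    have "tensor_lunit ((MOD_eps I \<otimes>\<^sub>m id) (SM_delta I (basis z))) =
        (\<Sum>Q\<in>Pre I z. MOD_eps I (basis (lower I Q z)) *\<^sub>R basis (upper I Q z))"
      by (simp only: SM_delta_basis linear_sum[OF linear_tensor_map[OF linear_MOD_eps linear_id]]
          linear_sum[OF linear_tensor_lunit] tensor_map_pure linear_MOD_eps linear_id id_apply[of "basis z" for z]
          tensor_lunit_pure)
    also have "\<dots> = (\<Sum>Q\<in>Pre I z. if pre I z = Q then basis (upper I Q z) else 0)"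
      by (rule sum.cong[OF refl]) (auto simp: MOD_eps_basis equiv_pre_lower_iff[OF \<open>finite I\<close> z])
    also have "\<dots> = basis z"
      using pre_Pre[OF \<open>finite I\<close> z] upper_pre[OF \<open>finite I\<close> z]
      unfolding sum.delta'[OF finite_Pre[OF \<open>finite I\<close>]] by simp
    finally show "(tensor_lunit \<circ> (MOD_eps I \<otimes>\<^sub>m id) \<circ> SM_delta I) (basis z) = id (basis z)" by simp
  qed (intro linear_structure_maps)+
  then show "tensor_lunit ((MOD_eps I \<otimes>\<^sub>m id) (SM_delta I x)) = x" by simp
  have "(tensor_runit \<circ> (id \<otimes>\<^sub>m MOD_eps I) \<circ> SM_delta I) x = id x"
  proof (rule linear_eq_on_MOD[OF _ _ _ x])
    fix z assume "z \<in> modular_functions I"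
    then have z: "z \<in> submodular_functions I" by (rule modular_imp_submodular)
    let ?Q = "decomposition_relation I z"
    have "tensor_runit ((id \<otimes>\<^sub>m MOD_eps I) (SM_delta I (basis z))) =
        (\<Sum>Q\<in>Pre I z. MOD_eps I (basis (upper I Q z)) *\<^sub>R basis (lower I Q z))"
      by (simp only: SM_delta_basis linear_sum[OF linear_tensor_map[OF linear_id linear_MOD_eps]]
          linear_sum[OF linear_tensor_runit] tensor_map_pure linear_MOD_eps linear_id id_apply[of "basis z" for z]
          tensor_runit_pure)
    also have "\<dots> = (\<Sum>Q\<in>Pre I z. if ?Q = Q then basis (lower I Q z) else 0)"
    proof (rule sum.cong[OF refl])
      fix Q assume Q: "Q \<in> Pre I z"
      have "equiv I Q \<longleftrightarrow> ?Q = Q"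
        using equiv_Pre_unique[OF \<open>finite I\<close> z Q] decomposition_relation(2)[OF \<open>finite I\<close> z] by auto
      then show "MOD_eps I (basis (upper I Q z)) *\<^sub>R basis (lower I Q z) = (if ?Q = Q then basis (lower I Q z) else 0)"
        by (simp add: MOD_eps_basis pre_upper[OF z Q])
    qed
    also have "\<dots> = basis z"
      using decomposition_relation(1)[OF \<open>finite I\<close> z] lower_decomposition_relation[OF \<open>finite I\<close> z]
      unfolding sum.delta'[OF finite_Pre[OF \<open>finite I\<close>]] by simp
    finally show "(tensor_runit \<circ> (id \<otimes>\<^sub>m MOD_eps I) \<circ> SM_delta I) (basis z) = id (basis z)" by simp
  qed (intro linear_structure_maps)+
  then show "tensor_runit ((id \<otimes>\<^sub>m MOD_eps I) (SM_delta I x)) = x" by simp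
qed

lemma delta_natural_MOD:
  assumes inj: "inj_on \<sigma> I" and x: "x \<in> MOD I"
  shows "SM_delta (\<sigma> ` I) (SM_map \<sigma> I x) = (SM_map \<sigma> I \<otimes>\<^sub>m SM_map \<sigma> I) (SM_delta I x)"
proof -
  have "(SM_delta (\<sigma> ` I) \<circ> SM_map \<sigma> I) x = ((SM_map \<sigma> I \<otimes>\<^sub>m SM_map \<sigma> I) \<circ> SM_delta I) x"
  proof (rule linear_eq_on_MOD[OF _ _ _ x])
    fix z assume "z \<in> modular_functions I"
    then have z: "z \<in> submodular_functions I" by (rule modular_imp_submodular)
    have "SM_delta (\<sigma> ` I) (basis (relabel \<sigma> I z)) =
        (\<Sum>Q\<in>Pre I z. basis (lower (\<sigma> ` I) (image_rel \<sigma> Q) (relabel \<sigma> I z)) \<otimes>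
          basis (upper (\<sigma> ` I) (image_rel \<sigma> Q) (relabel \<sigma> I z)))"
      unfolding SM_delta_basis by (rule sum.reindex_bij_betw[OF bij_betw_image_rel_Pre[OF z inj], symmetric])
    also have "\<dots> = (\<Sum>Q\<in>Pre I z. basis (relabel \<sigma> I (lower I Q z)) \<otimes> basis (relabel \<sigma> I (upper I Q z)))"
      by (rule sum.cong[OF refl]) (simp only: lower_relabel[OF z inj] upper_relabel[OF inj Pre_preorder])
    also have "\<dots> = (SM_map \<sigma> I \<otimes>\<^sub>m SM_map \<sigma> I) (SM_delta I (basis z))"
      by (simp only: SM_delta_basis linear_sum[OF linear_tensor_map[OF linear_SM_map linear_SM_map]]
          tensor_map_pure linear_SM_map SM_map_basis)
    finally show "(SM_delta (\<sigma> ` I) \<circ> SM_map \<sigma> I) (basis z) = ((SM_map \<sigma> I \<otimes>\<^sub>m SM_map \<sigma> I) \<circ> SM_delta I) (basis z)"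
      by (simp only: o_apply SM_map_basis)
  qed (intro linear_structure_maps)+
  then show ?thesis by (simp only: o_apply)
qed

lemma eps_natural_MOD:
  assumes "finite I" and inj: "inj_on \<sigma> I" and x: "x \<in> MOD I"
  shows "MOD_eps (\<sigma> ` I) (SM_map \<sigma> I x) = MOD_eps I x"
proof -
  have "(MOD_eps (\<sigma> ` I) \<circ> SM_map \<sigma> I) x = MOD_eps I x"
    by (rule linear_eq_on_MOD[OF _ _ _ x])
      ((intro linear_structure_maps)+, simp add: SM_map_basis MOD_eps_basis
        equiv_pre_relabel[OF \<open>finite I\<close> modular_imp_submodular inj])
  then show ?thesis by simp
qed

lemma eps_mu_MOD:
  assumes "finite S" "finite T" "S \<inter> T = {}" and uv: "u \<in> MOD S" "v \<in> MOD T"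
  shows "MOD_eps (S \<union> T) (SM_mu S T (u \<otimes> v)) = MOD_eps S u * MOD_eps T v"
proof -
  note b = bilinear_mult_linear[OF linear_MOD_eps linear_MOD_eps]
  have "(MOD_eps (S \<union> T) \<circ> SM_mu S T) (u \<otimes> v) = tensor_lift (\<lambda>a b. MOD_eps S a * MOD_eps T b) (u \<otimes> v)"
    by (rule linear_eq_on_MOD_tensor[OF _ linear_tensor_lift[OF b] _ tensor_space_memI[OF uv]])
      ((intro linear_structure_maps)+, simp add: b SM_mu_basis MOD_eps_basis
        equiv_pre_set_prod[OF assms(1-3) modular_imp_submodular modular_imp_submodular])
  then show ?thesis by (simp add: b)
qed

lemma eps_lin_UNIV_MOD: "MOD_eps I \<in> lin_maps (MOD I) UNIV"
  by (simp add: lin_maps_def linear_MOD_eps)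

lemma coalgebra_species_MOD: "coalgebra_species MOD SM_map SM_delta MOD_eps"
  by (intro coalgebra_species.intro coalgebra_species_axioms.intro species_MOD)
    (rule MOD_delta_lin eps_lin_UNIV_MOD delta_natural_MOD eps_natural_MOD delta_coassoc_MOD
      delta_counit_MOD; assumption)+

lemma comodule_species_MOD: "comodule_species (MOD :: 'i set \<Rightarrow> _) SM_map SM_delta MOD_eps MOD SM_map SM_delta"
proof -
  interpret coalgebra_species "MOD :: 'i set \<Rightarrow> _" SM_map SM_delta MOD_eps by (rule coalgebra_species_MOD)
  show ?thesis
    by unfold_locales (rule delta_lin delta_natural delta_coassoc delta_counit; assumption)+
qed

lemma Pre_empty_set: "Pre ({} :: 'i set) (\<lambda>E\<in>Pow {}. 0) = {{}}"
proof -
  have "{} \<in> Pre ({} :: 'i set) (\<lambda>E\<in>Pow {}. 0)"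
    by (rule PreI[OF submodular_on_empty[THEN iffD2, OF refl]]) (auto simp: down_set_def)
  moreover have "P = {}" if "P \<in> Pre {} z" for P :: "'i rel" and z
    using Pre_preorder[OF that] by (auto simp: preorder_on_def)
  ultimately show ?thesis by blast
qed

lemma delta_unit_MOD: "SM_delta ({} :: 'i set) (SM_eta {} 1) = SM_eta {} 1 \<otimes> SM_eta {} 1"
proof -
  have z: "(\<lambda>E\<in>Pow {}. 0) \<in> submodular_functions ({} :: 'i set)" by (simp only: submodular_on_empty)
  have P: "{} \<in> Pre ({} :: 'i set) (\<lambda>E\<in>Pow {}. 0)" by (simp only: Pre_empty_set insertI1)
  have "lower ({} :: 'i set) {} (\<lambda>E\<in>Pow {}. 0) = (\<lambda>E\<in>Pow {}. 0)"
    "upper ({} :: 'i set) {} (\<lambda>E\<in>Pow {}. 0) = (\<lambda>E\<in>Pow {}. 0)"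
    using lower_submodular[OF finite.emptyI z P] modular_imp_submodular[OF upper_modular[OF z P]]
    unfolding submodular_on_empty by auto
  then show ?thesis by (simp add: SM_eta_def SM_delta_basis Pre_empty_set del: Pow_empty)
qed

lemma delta_eps_MOD:
  fixes I :: "'i set"
  assumes x: "x \<in> MOD I"
  shows "tensor_runit ((id \<otimes>\<^sub>m SM_eps I) (SM_delta I x)) = SM_eta I (SM_eps I x)"
proof -
  have "(tensor_runit \<circ> (id \<otimes>\<^sub>m SM_eps I) \<circ> SM_delta I) x = (SM_eta I \<circ> SM_eps I) x"
  proof (rule linear_eq_on_MOD[OF _ _ _ x])
    fix z assume z: "z \<in> modular_functions I"
    show "(tensor_runit \<circ> (id \<otimes>\<^sub>m SM_eps I) \<circ> SM_delta I) (basis z) = (SM_eta I \<circ> SM_eps I) (basis z)"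
    proof (cases "I = {}")
      case True
      then have "basis z = SM_eta {} 1"
        using z modular_on_empty[of z] by (simp add: SM_eta_def del: Pow_empty)
      moreover have "SM_eps {} (SM_eta ({} :: 'i set) 1) = 1" by (rule eps_eta_MOD)
      ultimately show ?thesis
        by (simp only: True o_apply delta_unit_MOD tensor_map_pure linear_id linear_SM_eps tensor_runit_pure
            id_apply[of "SM_eta {} 1"] scaleR_one)
    next
      case False
      then have "(\<Sum>Q\<in>Pre I z. SM_eps I (basis (upper I Q z)) *\<^sub>R basis (lower I Q z)) = 0"
        by (simp add: SM_eps_basis)
      then have "tensor_runit ((id \<otimes>\<^sub>m SM_eps I) (SM_delta I (basis z))) = 0"
        by (simp only: SM_delta_basis linear_sum[OF linear_tensor_map[OF linear_id linear_SM_eps]]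
            linear_sum[OF linear_tensor_runit] tensor_map_pure linear_SM_eps linear_id id_apply[of "basis z" for z]
            tensor_runit_pure)
      then show ?thesis using False by (simp add: SM_eta_def)
    qed
  qed (intro linear_structure_maps)+
  then show ?thesis by simp
qed

lemma eps_unit_MOD: "MOD_eps ({} :: 'i set) (SM_eta {} 1) = 1"
proof -
  have z: "(\<lambda>E\<in>Pow {}. 0) \<in> submodular_functions ({} :: 'i set)" by (simp only: submodular_on_empty)
  have "equiv {} (pre ({} :: 'i set) (\<lambda>E\<in>Pow {}. 0))"
    unfolding equiv_pre_iff[OF finite.emptyI z] by simp
  then show ?thesis by (simp add: SM_eta_def MOD_eps_basis del: Pow_empty)
qed

lemma double_twisted_bialgebra_MOD:
  "double_twisted_bialgebra MOD SM_map SM_mu SM_Delta SM_eta SM_eps SM_delta MOD_eps"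
  by (intro double_twisted_bialgebra.intro double_twisted_bialgebra_axioms.intro
      bimonoid_species_MOD coalgebra_species_MOD)
    (rule delta_mu_MOD eps_mu_MOD delta_unit_MOD eps_unit_MOD
      delta_Delta_SM[OF _ _ _ subsetD[OF MOD_subset_SM]] delta_eps_MOD; assumption)+

theorem proposition12p5:
  shows "(\<forall>(I :: 'i set) S T. finite I \<and> I = S \<union> T \<and> S \<inter> T = {} \<longrightarrow>
            SM_delta I \<in> lin_maps (SM I) (SM I \<otimes>\<^sub>s MOD I) \<and>
            SM_Delta S T \<in> lin_maps (SM I) (SM S \<otimes>\<^sub>s SM T) \<and>
            SM_Delta S T \<in> lin_maps (MOD I) (MOD S \<otimes>\<^sub>s MOD T) \<and>
            SM_mu S T \<in> lin_maps (SM S \<otimes>\<^sub>s SM T) (SM I) \<and>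
            (id \<otimes>\<^sub>m SM_Delta S T) \<circ> SM_delta I \<in> lin_maps (SM I) (SM I \<otimes>\<^sub>s MOD S \<otimes>\<^sub>s MOD T) \<and>
            (\<forall>x \<in> SM I.
               ((id \<otimes>\<^sub>m SM_Delta S T) \<circ> SM_delta I) x =
               ((SM_mu S T \<otimes>\<^sub>m id) \<circ> swap23 \<circ> (SM_delta S \<otimes>\<^sub>m SM_delta T) \<circ> SM_Delta S T) x)) \<and>
         comodule_species (MOD :: 'i set \<Rightarrow> _) SM_map SM_delta MOD_eps MOD SM_map SM_delta \<and>
         (\<forall>(I :: 'i set) S T. finite I \<and> I = S \<union> T \<and> S \<inter> T = {} \<longrightarrow>
            (id \<otimes>\<^sub>m SM_Delta S T) \<circ> SM_delta I \<in> lin_maps (MOD I) (MOD I \<otimes>\<^sub>s MOD S \<otimes>\<^sub>s MOD T) \<and>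
            (\<forall>x \<in> MOD I.
               ((id \<otimes>\<^sub>m SM_Delta S T) \<circ> SM_delta I) x =
               ((SM_mu S T \<otimes>\<^sub>m id) \<circ> swap23 \<circ> (SM_delta S \<otimes>\<^sub>m SM_delta T) \<circ> SM_Delta S T) x)) \<and>
         double_twisted_bialgebra (MOD :: 'i set \<Rightarrow> _) SM_map SM_mu SM_Delta SM_eta SM_eps SM_delta MOD_eps"
proof (intro conjI allI impI ballI comodule_species_MOD double_twisted_bialgebra_MOD)
  fix I S T :: "'i set" assume "finite I \<and> I = S \<union> T \<and> S \<inter> T = {}"
  then have I: "finite I" "I = S \<union> T" and ST: "finite S" "finite T" "S \<inter> T = {}" by auto
  note Delta = SM_Delta_lin[OF ST(3), folded I(2)] MOD_Delta_lin[OF ST(3), folded I(2)]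
  show "SM_delta I \<in> lin_maps (SM I) (SM I \<otimes>\<^sub>s MOD I)" using I(1) by (rule SM_delta_lin)
  show "SM_Delta S T \<in> lin_maps (SM I) (SM S \<otimes>\<^sub>s SM T)" "SM_Delta S T \<in> lin_maps (MOD I) (MOD S \<otimes>\<^sub>s MOD T)"
    by (rule Delta)+
  show "SM_mu S T \<in> lin_maps (SM S \<otimes>\<^sub>s SM T) (SM I)" unfolding I(2) by (rule SM_mu_lin)
  show "(id \<otimes>\<^sub>m SM_Delta S T) \<circ> SM_delta I \<in> lin_maps (SM I) (SM I \<otimes>\<^sub>s MOD S \<otimes>\<^sub>s MOD T)"
    by (rule lin_maps_comp[OF SM_delta_lin[OF I(1)] tensor_map_lin_maps[OF id_lin_maps Delta(2)]])
  show "(id \<otimes>\<^sub>m SM_Delta S T) \<circ> SM_delta I \<in> lin_maps (MOD I) (MOD I \<otimes>\<^sub>s MOD S \<otimes>\<^sub>s MOD T)"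
    by (rule lin_maps_comp[OF MOD_delta_lin[OF I(1)] tensor_map_lin_maps[OF id_lin_maps Delta(2)]])
  show eq: "((id \<otimes>\<^sub>m SM_Delta S T) \<circ> SM_delta I) x =
      ((SM_mu S T \<otimes>\<^sub>m id) \<circ> swap23 \<circ> (SM_delta S \<otimes>\<^sub>m SM_delta T) \<circ> SM_Delta S T) x" if "x \<in> SM I" for x
    using delta_Delta_SM[OF ST, folded I(2), OF that] by (simp only: o_apply)
  show "((id \<otimes>\<^sub>m SM_Delta S T) \<circ> SM_delta I) x =
      ((SM_mu S T \<otimes>\<^sub>m id) \<circ> swap23 \<circ> (SM_delta S \<otimes>\<^sub>m SM_delta T) \<circ> SM_Delta S T) x" if "x \<in> MOD I" for x
    using that MOD_subset_SM by (intro eq) auto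
qed

end
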